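(* Let $\Phi:\mathbb R^d\to(-\infty,\infty]$ be proper, convex and lower semicontinuous, let $x\in\mathrm{cl}(\mathrm{dom}\,\Phi)$, and let $X$ be the strong solution of $$\mathrm dX(t)+\partial\Phi(X(t))\,\mathrm dt+\beta(t)\nabla\Psi(X(t))\,\mathrm dt\ni\sigma(t,X(t))\,\mathrm dW(t),\qquad X(0)=x,$$ under the assumptions of the context. Define $\bar X(t)=\frac1t\int_0^tX(s)\,\mathrm ds$ for $t>0$. Then, for all $t>0$, $$\mathbb E\big[\Phi(\bar X(t))-\min_C\Phi\,\big|\,X(0)=x\big]\le\frac{\mathrm{dist}(x,\mathcal S)^2}{2t}+\frac1{2t}\int_0^t\Sigma^2(s)\,\mathrm ds ,$$ and the right-hand side is $O(1/t)$.
   Context: Let $(\Omega,\mathcal F,(\mathcal F_t)_{t\ge0},\mathbb P)$ be a filtered probability space carrying an $m$-dimensional Brownian motion $W$. $\|\cdot\|_{\mathrm F}$ is the Frobenius norm. $\mathbb E[\cdot\,|\,X(0)=x]$ denotes expectation for the solution started at the deterministic point $x$. Objective and set: $C\subset\mathbb R^d$ is nonempty, closed and convex with normal cone mapping $\mathrm N_C$; $\mathrm{int}(\mathrm{dom}\,\partial\Phi)\ne\emptyset$; $\partial\Phi+\mathrm N_C$ is maximally monotone; and $\mathcal S=\mathrm{zer}(\partial\Phi+\mathrm N_C)=\mathrm{argmin}_C\Phi\ne\emptyset$. Penalty: $\Psi:\mathbb R^d\to\mathbb R$ is convex and continuously differentiable with Lipschitz continuous gradient, and $C=\Psi^{-1}(0)=\mathrm{argmin}\,\Psi$.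 The penalty parameter $\beta:[0,\infty)\to(0,\infty)$ is (locally) absolutely continuous and non-decreasing. Attouch--Czarnecki condition: for all $q\in\mathrm{Range}(\mathrm N_C)$, $\int_0^\infty\beta(r)\big[\Psi^*(q/\beta(r))-\mathsf s_C(q/\beta(r))\big]\mathrm dr<\infty$, where $\Psi^*$ is the Fenchel conjugate and $\mathsf s_C(x^* )=\sup_{u\in C}\langle x^*,u\rangle$. Noise: $\sigma:[0,\infty)\times\mathbb R^d\to\mathbb R^{d\times m}$ is measurable, $\|\sigma(t,x)-\sigma(t,y)\|_{\mathrm F}\le\ell(t)\|x-y\|$ for all $x,y$ with $\ell\in L^2(0,\infty;\mathbb R_{\ge0})$, and $\Sigma(t):=\sup_{x}\|\sigma(t,x)\|_{\mathrm F}$ belongs to $L^2([0,\infty);\mathbb R_+)$. Strong solution: a continuous adapted $\mathbb R^d$-valued process $X$ on $[0,\infty)$ for which there is a continuous adapted $\mathbb R^d$-valued process $K$ such that on every $[0,T]$: $X(t)\in\mathrm{cl}(\mathrm{dom}\,\partial\Phi)$ a.s. for all $t$; $X(0)$ equals the prescribed initial value a.s.; $K$ has sample paths of bounded variation on $[0,T]$ and $\mathrm dX(t)=-\beta(t)\nabla\Psi(X(t))\mathrm dt+\sigma(t,X(t))\mathrm dW(t)-\mathrm dK(t)$ a.s.; and for all $z\in\mathbb R^d$ and $0\le r\le s\le T$, a.s. $\int_r^s\langle z-X(u),\mathrm dK(u)\rangle+\int_r^s\Phi(X(u))\,\mathrm du\le(s-r)\Phi(z)$. *)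

theory Defs
  imports "HOL-Probability.Probability" "HOL-Library.Landau_Symbols"
begin

section \<open>Convex analysis\<close>

definition proper_fun :: "('a \<Rightarrow> ereal) \<Rightarrow> bool" where
  "proper_fun f \<longleftrightarrow> (\<forall>x. f x \<noteq> -\<infinity>) \<and> (\<exists>x. f x \<noteq> \<infinity>)"

text \<open>For functions with values in \<open>(-\<infinity>, \<infinity>]\<close>; at \<open>t \<in> {0, 1}\<close> the library convention
  \<open>0 * \<infinity> = 0\<close> makes the inequality trivial.\<close>

definition convex_fun :: "('a::real_vector \<Rightarrow> ereal) \<Rightarrow> bool" where
  "convex_fun f \<longleftrightarrow> (\<forall>x y t. 0 \<le> t \<longrightarrow> t \<le> 1 \<longrightarrow>
     f ((1 - t) *\<^sub>R x + t *\<^sub>R y) \<le> ereal (1 - t) * f x + ereal t * f y)"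

definition lower_semicont :: "('a::topological_space \<Rightarrow> ereal) \<Rightarrow> bool" where
  "lower_semicont f \<longleftrightarrow> (\<forall>x. f x \<le> Liminf (at x) f)"

definition eff_dom :: "('a \<Rightarrow> ereal) \<Rightarrow> 'a set" where
  "eff_dom f = {x. f x < \<infinity>}"

text \<open>For proper \<open>f\<close> this set is empty at points where \<open>f\<close> is infinite.\<close>

definition subdiff :: "('a::real_inner \<Rightarrow> ereal) \<Rightarrow> 'a \<Rightarrow> 'a set" where
  "subdiff f x = {g. \<forall>y. f x + ereal (g \<bullet> (y - x)) \<le> f y}"

definition normal_cone :: "'a::real_inner set \<Rightarrow> 'a \<Rightarrow> 'a set" where
  "normal_cone C x = (if x \<in> C then {q. \<forall>y\<in>C. q \<bullet> (y - x) \<le> 0} else {})"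

definition op_dom :: "('a \<Rightarrow> 'b set) \<Rightarrow> 'a set" where
  "op_dom A = {x. A x \<noteq> {}}"

definition op_range :: "('a \<Rightarrow> 'b set) \<Rightarrow> 'b set" where
  "op_range A = (\<Union>x. A x)"

definition op_sum :: "('a \<Rightarrow> 'b::plus set) \<Rightarrow> ('a \<Rightarrow> 'b set) \<Rightarrow> 'a \<Rightarrow> 'b set" where
  "op_sum A B x = {a + b | a b. a \<in> A x \<and> b \<in> B x}"

definition zer :: "('a \<Rightarrow> 'b::zero set) \<Rightarrow> 'a set" where
  "zer A = {x. 0 \<in> A x}"

definition monotone_op :: "('a::real_inner \<Rightarrow> 'a set) \<Rightarrow> bool" where
  "monotone_op A \<longleftrightarrow> (\<forall>x y. \<forall>u\<in>A x. \<forall>v\<in>A y. 0 \<le> (u - v) \<bullet> (x - y))"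

definition maximal_monotone_op :: "('a::real_inner \<Rightarrow> 'a set) \<Rightarrow> bool" where
  "maximal_monotone_op A \<longleftrightarrow> monotone_op A \<and>
     (\<forall>B. monotone_op B \<longrightarrow> (\<forall>x. A x \<subseteq> B x) \<longrightarrow> B = A)"

definition minimizers_on :: "'a set \<Rightarrow> ('a \<Rightarrow> 'b::ord) \<Rightarrow> 'a set" where
  "minimizers_on C f = {x \<in> C. \<forall>y\<in>C. f x \<le> f y}"

definition fenchel_conj :: "('a::real_inner \<Rightarrow> real) \<Rightarrow> 'a \<Rightarrow> ereal" where
  "fenchel_conj f q = (SUP u. ereal (q \<bullet> u - f u))"

definition support_fun :: "'a::real_inner set \<Rightarrow> 'a \<Rightarrow> ereal" where
  "support_fun C q = (SUP u\<in>C. ereal (q \<bullet> u))"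

section \<open>Integrals and regularity of paths\<close>

text \<open>Integral of an extended-real function as positive part minus negative part
  (\<^const>\<open>e2ennreal\<close> sends negative numbers to 0). It is meaningful under
  \<open>ereal_quasi_integrable\<close>, where its value lies in \<open>(-\<infinity>, \<infinity>]\<close>.\<close>

definition ereal_integral :: "'a measure \<Rightarrow> ('a \<Rightarrow> ereal) \<Rightarrow> ereal" where
  "ereal_integral M f =
     enn2ereal (\<integral>\<^sup>+ x. e2ennreal (f x) \<partial>M) - enn2ereal (\<integral>\<^sup>+ x. e2ennreal (- f x) \<partial>M)"

definition ereal_quasi_integrable :: "'a measure \<Rightarrow> ('a \<Rightarrow> ereal) \<Rightarrow> bool" where
  "ereal_quasi_integrable M f \<longleftrightarrow>
     f \<in> borel_measurable M \<and> (\<integral>\<^sup>+ x. e2ennreal (- f x) \<partial>M) < \<infinity>"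

definition L2_halfline :: "(real \<Rightarrow> real) \<Rightarrow> bool" where
  "L2_halfline f \<longleftrightarrow> set_borel_measurable lebesgue {0..} f \<and>
     set_integrable lebesgue {0..} (\<lambda>t. (f t)\<^sup>2)"

definition locally_abs_cont_halfline :: "(real \<Rightarrow> real) \<Rightarrow> bool" where
  "locally_abs_cont_halfline f \<longleftrightarrow> (\<forall>T>0. \<forall>e>0. \<exists>d>0. \<forall>(n::nat) a b.
     (\<forall>i<n. 0 \<le> a i \<and> a i \<le> b i \<and> b i \<le> T) \<longrightarrow>
     disjoint_family_on (\<lambda>i. {a i<..<b i}) {..<n} \<longrightarrow>
     (\<Sum>i<n. b i - a i) < d \<longrightarrow> (\<Sum>i<n. \<bar>f (b i) - f (a i)\<bar>) < e)"

definition bounded_variation_on :: "real \<Rightarrow> real \<Rightarrow> (real \<Rightarrow> 'a::real_normed_vector) \<Rightarrow> bool" where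
  "bounded_variation_on a b k \<longleftrightarrow>
     (\<exists>B. \<forall>D. D division_of {a..b} \<longrightarrow> (\<Sum>I\<in>D. norm (k (Sup I) - k (Inf I))) \<le> B)"

text \<open>Riemann--Stieltjes integral \<open>\<integral>\<^sub>a\<^sup>b \<langle>f(u), dk(u)\<rangle> = J\<close> of vector-valued functions, as the
  limit of the tagged sums when the mesh tends to 0. It exists, and agrees with the
  Lebesgue--Stieltjes integral, for continuous \<open>f\<close> and continuous \<open>k\<close> of bounded variation.\<close>

definition has_rs_integral ::
    "(real \<Rightarrow> 'a::real_inner) \<Rightarrow> (real \<Rightarrow> 'a) \<Rightarrow> real \<Rightarrow> real \<Rightarrow> real \<Rightarrow> bool" where
  "has_rs_integral f k a b J \<longleftrightarrow> (\<forall>e>0. \<exists>d>0. \<forall>p.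
     p tagged_division_of {a..b} \<longrightarrow> (\<lambda>x. ball x d) fine p \<longrightarrow>
     \<bar>(\<Sum>(x, I)\<in>p. f x \<bullet> (k (Sup I) - k (Inf I))) - J\<bar> < e)"

section \<open>Brownian motion and the Ito integral\<close>

text \<open>Processes and filtrations are indexed by \<^typ>\<open>real\<close>; only indices \<open>t \<ge> 0\<close> matter.\<close>

definition filtration_halfline :: "'w measure \<Rightarrow> (real \<Rightarrow> 'w measure) \<Rightarrow> bool" where
  "filtration_halfline M F \<longleftrightarrow> (\<forall>t\<ge>0. subalgebra M (F t)) \<and>
     (\<forall>s t. 0 \<le> s \<longrightarrow> s \<le> t \<longrightarrow> sets (F s) \<subseteq> sets (F t))"

definition continuous_adapted ::
    "'w measure \<Rightarrow> (real \<Rightarrow> 'w measure) \<Rightarrow> (real \<Rightarrow> 'w \<Rightarrow> 'a::topological_space) \<Rightarrow> bool" where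
  "continuous_adapted M F X \<longleftrightarrow> (\<forall>t\<ge>0. X t \<in> borel_measurable (F t)) \<and>
     (\<forall>\<omega>\<in>space M. continuous_on {0..} (\<lambda>t. X t \<omega>))"

definition brownian_motion ::
    "'w measure \<Rightarrow> (real \<Rightarrow> 'w measure) \<Rightarrow> (real \<Rightarrow> 'w \<Rightarrow> real ^ 'm) \<Rightarrow> bool" where
  "brownian_motion M F W \<longleftrightarrow> continuous_adapted M F W \<and> (AE \<omega> in M. W 0 \<omega> = 0) \<and>
     (\<forall>s t. 0 \<le> s \<longrightarrow> s < t \<longrightarrow>
        distributed M lborel (\<lambda>\<omega>. W t \<omega> - W s \<omega>)
          (\<lambda>y. ennreal (\<Prod>i\<in>UNIV. normal_density 0 (sqrt (t - s)) (y $ i))) \<and>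
        prob_space.indep_set M (sets (F s))
          {(\<lambda>\<omega>. W t \<omega> - W s \<omega>) -` A \<inter> space M | A. A \<in> sets borel})"

text \<open>The elementary integrand \<open>\<Sum>i<n. 1\<^bsub>(\<tau> i, \<tau> (i+1)]\<^esub>(s) \<xi> i\<close> with \<open>\<xi> i\<close> bounded and
  measurable with respect to the \<open>\<sigma>\<close>-algebra at time \<open>\<tau> i\<close>.\<close>

definition elementary_integrand ::
    "'w measure \<Rightarrow> (real \<Rightarrow> 'w measure) \<Rightarrow> nat \<Rightarrow> (nat \<Rightarrow> real) \<Rightarrow>
     (nat \<Rightarrow> 'w \<Rightarrow> real ^ 'm ^ 'd) \<Rightarrow> bool" where
  "elementary_integrand M F n \<tau> \<xi> \<longleftrightarrow>
     (\<forall>i<n. 0 \<le> \<tau> i \<and> \<tau> i \<le> \<tau> (Suc i) \<and> \<xi> i \<in> borel_measurable (F (\<tau> i)) \<and>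
        (\<exists>B. \<forall>\<omega>\<in>space M. norm (\<xi> i \<omega>) \<le> B))"

definition elementary_process ::
    "nat \<Rightarrow> (nat \<Rightarrow> real) \<Rightarrow> (nat \<Rightarrow> 'w \<Rightarrow> real ^ 'm ^ 'd) \<Rightarrow> real \<Rightarrow> 'w \<Rightarrow> real ^ 'm ^ 'd" where
  "elementary_process n \<tau> \<xi> s \<omega> =
     (\<Sum>i<n. indicator {\<tau> i<..\<tau> (Suc i)} s *\<^sub>R \<xi> i \<omega>)"

definition elementary_ito_integral ::
    "nat \<Rightarrow> (nat \<Rightarrow> real) \<Rightarrow> (nat \<Rightarrow> 'w \<Rightarrow> real ^ 'm ^ 'd) \<Rightarrow> (real \<Rightarrow> 'w \<Rightarrow> real ^ 'm) \<Rightarrow>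
     real \<Rightarrow> 'w \<Rightarrow> real ^ 'd" where
  "elementary_ito_integral n \<tau> \<xi> W t \<omega> =
     (\<Sum>i<n. \<xi> i \<omega> *v (W (min t (\<tau> (Suc i))) \<omega> - W (min t (\<tau> i)) \<omega>))"

text \<open>\<open>J\<close> is (a version of) the \<open>L\<^sup>2\<close> Ito integral of the progressively measurable process
  \<open>H\<close> over \<open>[0, t]\<close>: the \<open>L\<^sup>2\<close>-limit of the integrals of elementary integrands converging
  to \<open>H\<close> in \<open>L\<^sup>2([0, t] \<times> \<Omega>)\<close>. By the Ito isometry, \<open>J\<close> is unique up to null sets. The norm of
  \<open>real ^ 'm ^ 'd\<close> is the Frobenius norm.\<close>

definition has_ito_integral ::
    "'w measure \<Rightarrow> (real \<Rightarrow> 'w measure) \<Rightarrow> (real \<Rightarrow> 'w \<Rightarrow> real ^ 'm) \<Rightarrow>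
     (real \<Rightarrow> 'w \<Rightarrow> real ^ 'm ^ 'd) \<Rightarrow> real \<Rightarrow> ('w \<Rightarrow> real ^ 'd) \<Rightarrow> bool" where
  "has_ito_integral M F W H t J \<longleftrightarrow>
     (\<forall>u\<in>{0..t}. (\<lambda>(s, \<omega>). H s \<omega>) \<in> borel_measurable (restrict_space borel {0..u} \<Otimes>\<^sub>M F u)) \<and>
     J \<in> borel_measurable M \<and>
     (\<exists>n \<tau> \<xi>.
        (\<forall>k::nat. elementary_integrand M F (n k) (\<tau> k) (\<xi> k)) \<and>
        (\<lambda>k. \<integral>\<^sup>+ \<omega>. (\<integral>\<^sup>+ s\<in>{0..t}.
            ennreal ((norm (elementary_process (n k) (\<tau> k) (\<xi> k) s \<omega> - H s \<omega>))\<^sup>2) \<partial>lborel) \<partial>M)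
          \<longlonglongrightarrow> 0 \<and>
        (\<lambda>k. \<integral>\<^sup>+ \<omega>.
            ennreal ((norm (elementary_ito_integral (n k) (\<tau> k) (\<xi> k) W t \<omega> - J \<omega>))\<^sup>2) \<partial>M)
          \<longlonglongrightarrow> 0)"

section \<open>Strong solutions of the stochastic differential inclusion\<close>

text \<open>Strong solution of
  \<open>dX(t) + \<partial>\<Phi>(X(t)) dt + \<beta>(t) \<nabla>\<Psi>(X(t)) dt \<ni> \<sigma>(t, X(t)) dW(t)\<close>, \<open>X(0) = x\<close>; the argument \<open>G\<close>
  is the gradient of \<open>\<Psi>\<close>. Since all processes have continuous paths, the equation may be
  required almost surely for each fixed \<open>t\<close>.\<close>

definition strong_solution ::
    "'w measure \<Rightarrow> (real \<Rightarrow> 'w measure) \<Rightarrow> (real \<Rightarrow> 'w \<Rightarrow> real ^ 'm) \<Rightarrow>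
     (real ^ 'd \<Rightarrow> ereal) \<Rightarrow> (real \<Rightarrow> real) \<Rightarrow> (real ^ 'd \<Rightarrow> real ^ 'd) \<Rightarrow>
     (real \<Rightarrow> real ^ 'd \<Rightarrow> real ^ 'm ^ 'd) \<Rightarrow> real ^ 'd \<Rightarrow> (real \<Rightarrow> 'w \<Rightarrow> real ^ 'd) \<Rightarrow> bool" where
  "strong_solution M F W \<Phi> \<beta> G \<sigma> x X \<longleftrightarrow>
     continuous_adapted M F X \<and>
     (\<exists>K. continuous_adapted M F K \<and>
        (\<forall>t\<ge>0. AE \<omega> in M. X t \<omega> \<in> closure (op_dom (subdiff \<Phi>))) \<and>
        (AE \<omega> in M. X 0 \<omega> = x) \<and>
        (\<forall>T\<ge>0. AE \<omega> in M. bounded_variation_on 0 T (\<lambda>t. K t \<omega>)) \<and>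
        (\<forall>t\<ge>0. \<exists>J. has_ito_integral M F W (\<lambda>s \<omega>. \<sigma> s (X s \<omega>)) t J \<and>
           (AE \<omega> in M. X t \<omega> - X 0 \<omega> =
              - integral {0..t} (\<lambda>s. \<beta> s *\<^sub>R G (X s \<omega>)) + J \<omega> - (K t \<omega> - K 0 \<omega>))) \<and>
        (\<forall>z r s. 0 \<le> r \<longrightarrow> r \<le> s \<longrightarrow>
           (AE \<omega> in M. \<exists>J. has_rs_integral (\<lambda>u. z - X u \<omega>) (\<lambda>u. K u \<omega>) r s J \<and>
              ereal J + ereal_integral (restrict_space lborel {r..s}) (\<lambda>u. \<Phi> (X u \<omega>))
                \<le> ereal (s - r) * \<Phi> z)))"

definition time_average :: "(real \<Rightarrow> 'w \<Rightarrow> 'a::euclidean_space) \<Rightarrow> real \<Rightarrow> 'w \<Rightarrow> 'a" where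
  "time_average X t \<omega> = (1 / t) *\<^sub>R integral {0..t} (\<lambda>s. X s \<omega>)"

end

theory Submission
  imports Defs
begin

text \<open>
  Fix \<open>z \<in> S\<close> and a subgradient \<open>g\<close> of \<open>\<Phi>\<close> at \<open>z\<close>. Along the solution the squared distance to \<open>z\<close>
  satisfies, in the sense of Ito,
  \<open>d|X - z|\<^sup>2 / 2 = - \<beta> \<langle>\<nabla>\<Psi>(X), X - z\<rangle> dt - \<langle>X - z, dK\<rangle> + |\<sigma>|\<^sup>2 / 2 dt + dN\<close> with a martingale \<open>N\<close>.
  The penalty term has a sign, because \<open>\<Psi>\<close> is convex and attains its minimum \<open>0\<close> at \<open>z\<close>
  (\<open>convex_gradient_inequality\<close>), and the inequality that characterises \<open>K\<close>, tested with \<open>z\<close>,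
  bounds the second term by \<open>(\<Phi>(z) - \<Phi>(X)) dt\<close>. Taking expectations gives
  \<open>E \<integral>\<^sub>0\<^sup>t (\<Phi>(X) - \<Phi>(z)) ds \<le> |x - z|\<^sup>2 / 2 + \<integral>\<^sub>0\<^sup>t \<Sigma>\<^sup>2 ds / 2\<close>, Jensen's inequality moves the
  average inside \<open>\<Phi>\<close> (\<open>average_in_closed_convex\<close>), and the infimum over \<open>z \<in> S\<close> turns \<open>|x - z|\<close>
  into the distance to \<open>S\<close>.

  Two points need work. The first is the energy balance. It is derived on uniform
  grids: if an increment of \<open>v = X - z\<close> is split as \<open>dA + dM\<close> into a part of bounded variation and
  a martingale part, then
  \<open>|v'|\<^sup>2 - |v|\<^sup>2 \<le> 2 \<langle>v', dA\<rangle> + 2 \<langle>v, dM\<rangle> + |dM|\<^sup>2\<close>,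
  where \<open>v\<close> and \<open>v'\<close> are the values at the left and the right end point. As the mesh
  tends to 0 the first sum is controlled path by path (\<open>damped_energy_inequality\<close>). The other
  two are controlled in expectation (\<open>damped_expectation\<close>): this uses only that the increments
  of the stochastic integral are orthogonal to the past and satisfy \<open>E|dM|\<^sup>2 \<le> \<integral> \<Sigma>\<^sup>2\<close>, and both
  facts pass from elementary integrands to the limit by the Ito isometry.

  The second point is integrability: \<open>\<Phi>(X)\<close> is bounded below only by an affine function of
  \<open>X\<close>, whose moments are not known beforehand. Therefore \<open>r = |v|\<^sup>2\<close> is replaced by
  \<open>r / (1 + e r)\<close>. This function is concave, so the inequality above survives with the derivative
  \<open>1 / (1 + e r)\<^sup>2\<close> as a weight, and the weighted stochastic sums have bounded multipliers. The
  damped estimate bounds the second moment of \<open>v\<close> uniformly in \<open>e\<close>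
  (\<open>damped_moment_bound\<close>), after which \<open>e\<close> tends to 0 by Fatou's lemma for the nonnegative part
  of the integrand and by dominated convergence for the affine part (\<open>undamped_estimate\<close>).
\<close>

section \<open>Moments of Brownian increments\<close>

lemma has_bochner_integral_lborel_vec_prod:
  fixes f :: "'m::finite \<Rightarrow> real \<Rightarrow> real"
  assumes f: "\<And>i. has_bochner_integral lborel (f i) (c i)"
  shows "has_bochner_integral lborel (\<lambda>y::real^'m. \<Prod>i\<in>UNIV. f i (y $ i)) (\<Prod>i\<in>UNIV. c i)"
proof -
  define e where "e = (\<lambda>i::'m. axis i (1::real))"
  have inj: "inj e" unfolding e_def by (auto intro!: injI simp: axis_eq_axis)
  have B: "Basis = range e" unfolding e_def Basis_vec_def by auto
  interpret product_sigma_finite "\<lambda>b::real^'m. lborel :: real measure" by standard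
  have f': "integrable lborel (f i)" "integral\<^sup>L lborel (f i) = c i" for i
    using f[of i] by (auto simp: has_bochner_integral_iff)
  have [measurable]: "f i \<in> borel_measurable borel" for i
    using f'(1)[of i] by auto
  define g where "g = (\<lambda>b::real^'m. f (inv e b))"
  have gp: "(\<Prod>b\<in>Basis. g b (x b)) = (\<Prod>i\<in>UNIV. f i (x (e i)))" for x
    unfolding B g_def by (subst prod.reindex[OF inj]) (simp add: inj)
  have comp: "(\<Sum>b\<in>Basis. x b *\<^sub>R b) $ i = x (e i)" for x :: "real^'m \<Rightarrow> real" and i
  proof -
    have "(\<Sum>b\<in>Basis. x b *\<^sub>R b) \<bullet> e i = x (e i)"
      by (subst inner_sum_left_Basis) (auto simp: B)
    then show ?thesis by (simp add: e_def inner_axis)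
  qed
  have gi: "integrable lborel (g b)" for b by (simp add: g_def f')
  have "integrable (\<Pi>\<^sub>M b\<in>Basis. lborel) (\<lambda>x. \<Prod>b\<in>Basis. g b (x b))"
    by (rule product_integrable_prod) (auto intro: gi)
  moreover have "(\<integral>x. (\<Prod>b\<in>Basis. g b (x b)) \<partial>(\<Pi>\<^sub>M b\<in>Basis. lborel)) = (\<Prod>b\<in>Basis. integral\<^sup>L lborel (g b))"
    by (rule product_integral_prod) (auto intro: gi)
  moreover have "(\<Prod>b\<in>Basis. integral\<^sup>L lborel (g b)) = (\<Prod>i\<in>UNIV. c i)"
    unfolding B g_def by (subst prod.reindex[OF inj]) (simp add: inj f')
  ultimately have "has_bochner_integral (\<Pi>\<^sub>M b\<in>Basis. lborel) (\<lambda>x. \<Prod>i\<in>UNIV. f i (x (e i))) (\<Prod>i\<in>UNIV. c i)"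
    by (simp add: has_bochner_integral_iff gp)
  then show ?thesis
    by (subst lborel_eq)
       (simp add: has_bochner_integral_iff integrable_distr_eq integral_distr comp
         del: sum_component vector_scaleR_component)
qed

lemma normal_density_moments:
  assumes "0 < s"
  shows "has_bochner_integral lborel (\<lambda>x. normal_density 0 s x) 1"
    "has_bochner_integral lborel (\<lambda>x. x * normal_density 0 s x) 0"
    "has_bochner_integral lborel (\<lambda>x. x * x * normal_density 0 s x) (s\<^sup>2)"
  using assms normal_moment_even[of s 0 0] normal_moment_even[of s 0 1] normal_moment_odd[of s 0 0]
  by (simp_all add: power2_eq_square mult.commute mult.left_commute)

lemma gaussian_vec_moments:
  fixes i j :: "'m::finite"
  assumes s: "0 < s"
  defines "N \<equiv> \<lambda>y::real^'m. \<Prod>k\<in>UNIV. normal_density 0 s (y $ k)"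
  shows "has_bochner_integral lborel (\<lambda>y. N y * (y $ i)) 0"
    and "has_bochner_integral lborel (\<lambda>y. N y * (y $ i * y $ j)) (if i = j then s\<^sup>2 else 0)"
proof -
  note m = normal_density_moments[OF s]
  have 1: "N y * (y $ i) = (\<Prod>k\<in>UNIV. (if k = i then y $ k else 1) * normal_density 0 s (y $ k))" for y
    unfolding N_def prod.distrib by (simp add: prod.delta)
  have "has_bochner_integral lborel
      (\<lambda>y::real^'m. \<Prod>k\<in>UNIV. (if k = i then y $ k else 1) * normal_density 0 s (y $ k))
      (\<Prod>k\<in>UNIV. if k = i then 0 else 1)"
    by (rule has_bochner_integral_lborel_vec_prod) (use m in auto)
  then show "has_bochner_integral lborel (\<lambda>y. N y * (y $ i)) 0"
    unfolding 1 by (simp add: prod.delta)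
  have 2: "N y * (y $ i * y $ j) = (\<Prod>k\<in>UNIV. (if k = i then y $ k else 1) * (if k = j then y $ k else 1)
      * normal_density 0 s (y $ k))" for y
    unfolding N_def prod.distrib by (simp add: prod.delta)
  have "has_bochner_integral lborel
      (\<lambda>y::real^'m. \<Prod>k\<in>UNIV. (if k = i then y $ k else 1) * (if k = j then y $ k else 1) * normal_density 0 s (y $ k))
      (\<Prod>k\<in>UNIV. if k = i then (if k = j then s\<^sup>2 else 0) else if k = j then 0 else 1)"
    by (rule has_bochner_integral_lborel_vec_prod) (use m in auto)
  moreover have "(\<Prod>k\<in>UNIV. if k = i then (if k = j then s\<^sup>2 else 0) else if k = j then 0 else (1::real))
     = (if i = j then s\<^sup>2 else 0)"
  proof (cases "i = j")
    case True
    then have "(\<Prod>k\<in>UNIV. if k = i then (if k = j then s\<^sup>2 else 0) else if k = j then 0 else (1::real))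
      = (\<Prod>k\<in>UNIV. if k = i then s\<^sup>2 else 1)" by (intro prod.cong) auto
    then show ?thesis using True by (simp add: prod.delta)
  next
    case False
    then show ?thesis by (auto intro!: prod_zero bexI[of _ i])
  qed
  ultimately show "has_bochner_integral lborel (\<lambda>y. N y * (y $ i * y $ j)) (if i = j then s\<^sup>2 else 0)"
    unfolding 2 by simp
qed

section \<open>The Ito isometry for elementary integrands\<close>

abbreviation sqnorm :: "'a measure \<Rightarrow> ('a \<Rightarrow> 'b::real_normed_vector) \<Rightarrow> ennreal" where
  "sqnorm N f \<equiv> \<integral>\<^sup>+x. ennreal ((norm (f x))\<^sup>2) \<partial>N"

lemma borel_measurable_vec_nth' [measurable (raw)]:
  fixes f :: "'a \<Rightarrow> 'b::{second_countable_topology, real_normed_vector} ^ 'n"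
  shows "f \<in> borel_measurable M \<Longrightarrow> (\<lambda>x. f x $ i) \<in> borel_measurable M"
  by (rule measurable_compose[of f M borel]) (auto intro!: borel_measurable_continuous_onI continuous_intros)

locale brownian_filtration = prob_space M for M :: "'w measure" +
  fixes F :: "real \<Rightarrow> 'w measure" and W :: "real \<Rightarrow> 'w \<Rightarrow> real ^ 'm"
  assumes filt: "filtration_halfline M F" and bm: "brownian_motion M F W"
begin

lemma F_measurable:
  assumes "f \<in> borel_measurable (F s)" "0 \<le> s"
  shows F_measurable_mono: "s \<le> t \<Longrightarrow> f \<in> borel_measurable (F t)"
    and F_measurable_M: "f \<in> borel_measurable M"
proof -
  have sub: "subalgebra M (F t)" if "0 \<le> t" for t
    using filt that by (auto simp: filtration_halfline_def)
  show "f \<in> borel_measurable M"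
    by (rule measurable_from_subalg[OF sub[OF assms(2)] assms(1)])
  assume st: "s \<le> t"
  have "subalgebra (F t) (F s)"
    using sub[OF assms(2)] sub[of t] st assms(2) filt by (auto simp: subalgebra_def filtration_halfline_def)
  then show "f \<in> borel_measurable (F t)" by (rule measurable_from_subalg[OF _ assms(1)])
qed

lemma W_measurable: "0 \<le> s \<Longrightarrow> s \<le> t \<Longrightarrow> W s \<in> borel_measurable (F t)"
  using bm F_measurable_mono[of "W s" s t] by (auto simp: brownian_motion_def continuous_adapted_def)

lemma W_measurable_M [measurable]: "0 \<le> s \<Longrightarrow> W s \<in> borel_measurable M"
  using F_measurable_M[OF W_measurable[of s s]] by simp

abbreviation D :: "real \<Rightarrow> real \<Rightarrow> 'm \<Rightarrow> 'w \<Rightarrow> real" where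
  "D a b i w \<equiv> W b w $ i - W a w $ i"

lemma D_measurable: "0 \<le> a \<Longrightarrow> a \<le> t \<Longrightarrow> 0 \<le> b \<Longrightarrow> b \<le> t \<Longrightarrow> (\<lambda>w. D a b i w) \<in> borel_measurable (F t)"
  by (intro borel_measurable_diff borel_measurable_vec_nth' W_measurable)

lemma indep_increment:
  fixes \<eta> :: "'w \<Rightarrow> real" and g :: "real^'m \<Rightarrow> real"
  assumes st: "0 \<le> s" "s < t" and \<eta>: "\<eta> \<in> borel_measurable (F s)" and g: "g \<in> borel_measurable borel"
  shows "indep_var borel \<eta> borel (\<lambda>w. g (W t w - W s w))"
proof -
  have sub: "subalgebra M (F s)" using filt st by (auto simp: filtration_halfline_def)
  have \<eta>M: "\<eta> \<in> borel_measurable M" by (rule F_measurable_M[OF \<eta> st(1)])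
  have WM: "(\<lambda>w. W t w - W s w) \<in> borel_measurable M"
    using st by (intro borel_measurable_diff W_measurable_M) auto
  have gM: "(\<lambda>w. g (W t w - W s w)) \<in> borel_measurable M"
    by (rule measurable_compose[OF WM g])
  have ind: "indep_set (sets (F s)) {(\<lambda>w. W t w - W s w) -` A \<inter> space M | A. A \<in> sets borel}"
    using bm st by (auto simp: brownian_motion_def)
  have 1: "\<eta> -` A \<inter> space M \<in> sets (F s)" if "A \<in> sets borel" for A
    using measurable_sets[OF \<eta> that] sub by (simp add: subalgebra_def)
  have 2: "\<exists>B. (\<lambda>w. g (W t w - W s w)) -` A \<inter> space M = (\<lambda>w. W t w - W s w) -` B \<inter> space M \<and> B \<in> sets borel"
    if "A \<in> sets borel" for A
    using measurable_sets[OF g that] by (intro exI[of _ "g -` A"]) auto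
  have "indep_set {\<eta> -` A \<inter> space M | A. A \<in> sets borel}
     {(\<lambda>w. g (W t w - W s w)) -` A \<inter> space M | A. A \<in> sets borel}"
    using ind 1 2 unfolding indep_sets2_eq by (auto; blast)
  moreover have "Int_stable {f -` A \<inter> space M | A. A \<in> sets (borel :: real measure)}" for f :: "'w \<Rightarrow> real"
    by (rule Int_stableI) (clarsimp, metis Int_assoc Int_left_commute Int_absorb sets.Int vimage_Int)
  ultimately show ?thesis unfolding indep_var_eq using \<eta>M gM
    by (intro conjI indep_set_sigma_sets)
qed

lemma increment_moments:
  fixes \<eta> :: "'w \<Rightarrow> real"
  assumes st: "0 \<le> s" "s \<le> t" and \<eta>: "\<eta> \<in> borel_measurable (F s)" "integrable M \<eta>"
  shows "has_bochner_integral M (\<lambda>w. \<eta> w * D s t i w) 0"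
    and "has_bochner_integral M (\<lambda>w. \<eta> w * (D s t i w * D s t j w)) (expectation \<eta> * (if i = j then t - s else 0))"
proof (atomize(full), cases "s = t")
  case False
  then have st': "s < t" "0 < sqrt (t - s)" using st by auto
  let ?N = "\<lambda>y::real^'m. \<Prod>i\<in>UNIV. normal_density 0 (sqrt (t - s)) (y $ i)"
  have dist: "distributed M lborel (\<lambda>w. W t w - W s w) ?N"
    using bm st st' by (auto simp: brownian_motion_def)
  have mom: "has_bochner_integral M (\<lambda>w. g (W t w - W s w)) c"
    if "has_bochner_integral lborel (\<lambda>y. ?N y * g y) c" "g \<in> borel_measurable borel" for g :: "_ \<Rightarrow> real" and c
    using that distributed_integrable[OF dist, of g] distributed_integral[OF dist, of g]
    by (auto simp: has_bochner_integral_iff prod_nonneg)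
  have gen: "has_bochner_integral M (\<lambda>w. \<eta> w * g (W t w - W s w)) (expectation \<eta> * c)"
    if "has_bochner_integral lborel (\<lambda>y. ?N y * g y) c" "g \<in> borel_measurable borel" for g :: "_ \<Rightarrow> real" and c
  proof -
    note m = mom[OF that]
    note i = indep_increment[OF st(1) st'(1) \<eta>(1) that(2)]
    show ?thesis using indep_var_integrable[OF i \<eta>(2)] indep_var_lebesgue_integral[OF i \<eta>(2)] m
      by (auto simp: has_bochner_integral_iff)
  qed
  show "has_bochner_integral M (\<lambda>w. \<eta> w * D s t i w) 0 \<and>
     has_bochner_integral M (\<lambda>w. \<eta> w * (D s t i w * D s t j w)) (expectation \<eta> * (if i = j then t - s else 0))"
    using gen[OF gaussian_vec_moments(1)[OF st'(2), of i]] gen[OF gaussian_vec_moments(2)[OF st'(2), of i j]] st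
    by (cases "i = j") auto
qed auto

text \<open>The length of \<open>(a, b] \<inter> (c, d]\<close>.\<close>

definition overlap :: "real \<Rightarrow> real \<Rightarrow> real \<Rightarrow> real \<Rightarrow> real" where
  "overlap a b c d = max 0 (min b d - max a c)"

text \<open>The part of time covered by both intervals contributes its length. On the rest, one factor is an
  increment after everything else is already known, hence independent of it and of mean zero.\<close>

lemma increment_product:
  fixes x y :: "'w \<Rightarrow> real"
  assumes ab: "0 \<le> a" "a \<le> b" "0 \<le> c" "c \<le> d"
    and x: "x \<in> borel_measurable (F a)" "\<forall>w\<in>space M. \<bar>x w\<bar> \<le> B"
    and y: "y \<in> borel_measurable (F c)" "\<forall>w\<in>space M. \<bar>y w\<bar> \<le> B"
  shows "has_bochner_integral M (\<lambda>w. (x w * D a b i w) * (y w * D c d j w))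
    (if i = j then overlap a b c d * expectation (\<lambda>w. x w * y w) else 0)"
proof -
  \<comment> \<open>By symmetry the interval that starts first may be taken to be \<open>(a, b]\<close>.\<close>
  have main: "has_bochner_integral M (\<lambda>w. (x w * D a b i w) * (y w * D c d j w))
    (if i = j then overlap a b c d * expectation (\<lambda>w. x w * y w) else 0)"
    if ab: "0 \<le> a" "a \<le> b" "0 \<le> c" "c \<le> d" "a \<le> c"
    and x: "x \<in> borel_measurable (F a)" "\<forall>w\<in>space M. \<bar>x w\<bar> \<le> B"
    and y: "y \<in> borel_measurable (F c)" "\<forall>w\<in>space M. \<bar>y w\<bar> \<le> B"
    for a b c d x y i j
  proof -
    have xy: "(\<lambda>w. x w * y w) \<in> borel_measurable (F c)"
      using x y ab by (intro borel_measurable_times F_measurable_mono[OF x(1)]) auto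
    have xyB: "\<bar>x w * y w\<bar> \<le> B * B" if "w \<in> space M" for w
      unfolding abs_mult using x(2) y(2) that by (intro mult_mono) (auto intro: order_trans[OF abs_ge_zero])
    have xyi: "integrable M (\<lambda>w. x w * y w)"
      using F_measurable_M[OF xy ab(3)] xyB by (intro integrable_const_bound[of _ "B * B"]) auto
    have xi: "integrable M x"
      using F_measurable_M[OF x(1) ab(1)] x(2) by (intro integrable_const_bound[of _ B]) auto
    \<comment> \<open>An increment after time \<open>s \<ge> c\<close> is orthogonal to \<open>x y\<close> times an increment before \<open>s\<close>.\<close>
    have orth: "has_bochner_integral M (\<lambda>w. x w * y w * D u v k w * D s t l w) 0"
      if "0 \<le> u" "u \<le> v" "v \<le> s" "c \<le> s" "s \<le> t" "c \<le> u" for u v s t k l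
    proof (rule increment_moments(1))
      show "0 \<le> s" "s \<le> t" using that ab by auto
      show "(\<lambda>w. x w * y w * D u v k w) \<in> borel_measurable (F s)"
        using that ab by (intro borel_measurable_times F_measurable_mono[OF xy] D_measurable F_measurable_mono[OF x(1)] F_measurable_mono[OF y(1)]) auto
      show "integrable M (\<lambda>w. x w * y w * D u v k w)"
        using increment_moments(1)[OF _ _ F_measurable_mono[OF xy ab(3)] xyi, of u v] that
        by (auto simp: has_bochner_integral_iff)
    qed
    have orth0: "has_bochner_integral M (\<lambda>w. x w * D a v k w * y w * D c t l w) 0"
      if "a \<le> v" "v \<le> c" "c \<le> t" for v t k l
    proof (rule increment_moments(1))
      show "0 \<le> c" "c \<le> t" using that ab by auto
      show "(\<lambda>w. x w * D a v k w * y w) \<in> borel_measurable (F c)"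
        using that ab by (intro borel_measurable_times D_measurable F_measurable_mono[OF x(1)] y(1)) auto
      have "integrable M (\<lambda>w. x w * D a v k w)"
        using increment_moments(1)[OF ab(1) that(1) x(1) xi] by (auto simp: has_bochner_integral_iff)
      then show "integrable M (\<lambda>w. x w * D a v k w * y w)"
        by (rule Bochner_Integration.integrable_bound[OF integrable_mult_left[of B]])
          (use that ab y(2) F_measurable_M[OF x(1)] F_measurable_M[OF y(1)] D_measurable[THEN F_measurable_M]
           in \<open>auto simp: abs_mult intro!: AE_I2 mult_left_mono borel_measurable_times
                intro: order_trans[OF _ abs_ge_self]\<close>)
    qed
    show ?thesis
    proof (cases "b \<le> c")
      case True
      then have "overlap a b c d = 0" by (auto simp: overlap_def)
      then show ?thesis using orth0[OF ab(2) True ab(4), of i j]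
        by (cases "i = j") (auto simp: mult_ac)
    next
      case False
      define m where "m = min b d"
      have m: "c \<le> m" "m \<le> b" "m \<le> d" "0 \<le> m" using False ab by (auto simp: m_def)
      have ov: "overlap a b c d = m - c" using False ab by (auto simp: overlap_def m_def)
      have md: "m = b \<or> m = d" by (auto simp: m_def)
      have "has_bochner_integral M (\<lambda>w. x w * D a c i w * y w * D c d j w +
          (x w * y w * (D c m i w * D c m j w) + (x w * y w * D c m i w * D m d j w
           + x w * y w * D c d j w * D m b i w)))
         (0 + (expectation (\<lambda>w. x w * y w) * (if i = j then m - c else 0) + (0 + 0)))"
      proof (intro has_bochner_integral_add)
        show "has_bochner_integral M (\<lambda>w. x w * y w * D c d j w * D m b i w) 0"
          using md orth[of c d m b j i] m ab by auto
      qed (use ab m orth0[of c d] increment_moments(2)[OF ab(3) m(1) xy xyi] orth[of c m m d] in auto)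
      moreover have "x w * D a c i w * y w * D c d j w +
          (x w * y w * (D c m i w * D c m j w) + (x w * y w * D c m i w * D m d j w
           + x w * y w * D c d j w * D m b i w))
         = (x w * D a b i w) * (y w * D c d j w)" for w
        by (simp add: algebra_simps)
      ultimately show ?thesis by (cases "i = j") (auto simp: ov mult_ac)
    qed
  qed
  show ?thesis
  proof (cases "a \<le> c")
    case True
    show ?thesis by (rule main[OF ab True x y])
  next
    case False
    then have "overlap c d a b = overlap a b c d" "c \<le> a" by (auto simp: overlap_def)
    then show ?thesis using main[OF ab(3,4,1,2) _ y x, of j i] by (auto simp: mult_ac)
  qed
qed

lemma has_bochner_integral_overlap:
  "has_bochner_integral lborel (\<lambda>s. indicator {a<..b} s * indicator {c<..d} s :: real) (overlap a b c d)"
proof -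
  have 1: "(indicator {a<..b} s * indicator {c<..d} s :: real) = indicator {max a c<..min b d} s" for s
    by (auto simp: indicator_def)
  have fin: "emeasure lborel {u<..v} < \<infinity>" for u v :: real by (cases "u \<le> v") auto
  have "has_bochner_integral lborel (indicator {max a c<..min b d} :: real \<Rightarrow> real) (measure lborel {max a c<..min b d})"
    by (rule has_bochner_integral_real_indicator) (use fin in auto)
  moreover have "measure lborel {max a c<..min b d} = overlap a b c d"
    by (cases "max a c \<le> min b d") (auto simp: overlap_def)
  ultimately show ?thesis unfolding 1 by simp
qed

lemma increment_inner:
  fixes \<xi> \<zeta> :: "'w \<Rightarrow> real^'m^'d"
  assumes ab: "0 \<le> a" "a \<le> b" "0 \<le> c" "c \<le> d"
    and \<xi>: "\<xi> \<in> borel_measurable (F a)" "\<forall>w\<in>space M. norm (\<xi> w) \<le> B"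
    and \<zeta>: "\<zeta> \<in> borel_measurable (F c)" "\<forall>w\<in>space M. norm (\<zeta> w) \<le> B"
  shows "integrable M (\<lambda>w. \<xi> w \<bullet> \<zeta> w)"
    "has_bochner_integral M (\<lambda>w. (\<xi> w *v (W b w - W a w)) \<bullet> (\<zeta> w *v (W d w - W c w)))
     (overlap a b c d * expectation (\<lambda>w. \<xi> w \<bullet> \<zeta> w))"
proof -
  have bnd: "\<bar>A $ k $ i\<bar> \<le> norm A" for A :: "real^'m^'d" and k i
    by (rule order_trans[OF component_le_norm_cart Finite_Cartesian_Product.norm_nth_le])
  have x: "\<forall>w\<in>space M. \<bar>\<xi> w $ k $ i\<bar> \<le> B" "\<forall>w\<in>space M. \<bar>\<zeta> w $ k $ i\<bar> \<le> B" for k i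
    using \<xi>(2) \<zeta>(2) bnd order_trans by blast+
  have [measurable]: "\<xi> \<in> borel_measurable M" "\<zeta> \<in> borel_measurable M"
    using F_measurable_M \<xi>(1) \<zeta>(1) ab by auto
  have int1: "integrable M (\<lambda>w. \<xi> w $ k $ i * \<zeta> w $ k $ i)" for k i
  proof (rule integrable_const_bound[of _ "B * B"])
    show "AE w in M. norm (\<xi> w $ k $ i * \<zeta> w $ k $ i) \<le> B * B"
    proof (rule AE_I2)
      fix w assume "w \<in> space M"
      then have "\<bar>\<xi> w $ k $ i\<bar> \<le> B" "\<bar>\<zeta> w $ k $ i\<bar> \<le> B" using x by blast+
      then show "norm (\<xi> w $ k $ i * \<zeta> w $ k $ i) \<le> B * B"
        unfolding real_norm_def abs_mult by (intro mult_mono) auto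
    qed
  qed auto
  have in1: "\<xi> w \<bullet> \<zeta> w = (\<Sum>k\<in>UNIV. \<Sum>i\<in>UNIV. \<xi> w $ k $ i * \<zeta> w $ k $ i)" for w
    by (simp add: inner_vec_def)
  show "integrable M (\<lambda>w. \<xi> w \<bullet> \<zeta> w)" unfolding in1 by (intro Bochner_Integration.integrable_sum int1)
  have E1: "expectation (\<lambda>w. \<xi> w \<bullet> \<zeta> w)
     = (\<Sum>k\<in>UNIV. \<Sum>i\<in>UNIV. expectation (\<lambda>w. \<xi> w $ k $ i * \<zeta> w $ k $ i))"
    unfolding in1 by (simp add: Bochner_Integration.integral_sum Bochner_Integration.integrable_sum int1)
  have in2: "(\<xi> w *v (W b w - W a w)) \<bullet> (\<zeta> w *v (W d w - W c w))
    = (\<Sum>k\<in>UNIV. \<Sum>i\<in>UNIV. \<Sum>j\<in>UNIV. (\<xi> w $ k $ i * D a b i w) * (\<zeta> w $ k $ j * D c d j w))" for w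
    by (simp add: inner_vec_def matrix_vector_mult_def sum_product)
  have "has_bochner_integral M (\<lambda>w. (\<xi> w *v (W b w - W a w)) \<bullet> (\<zeta> w *v (W d w - W c w)))
     (\<Sum>k\<in>UNIV. \<Sum>i\<in>UNIV. \<Sum>j\<in>UNIV. if i = j then overlap a b c d * expectation (\<lambda>w. \<xi> w $ k $ i * \<zeta> w $ k $ j) else 0)"
    unfolding in2
    by (intro has_bochner_integral_sum increment_product[OF ab, where B=B] borel_measurable_vec_nth' \<xi>(1) \<zeta>(1) x)
  then show "has_bochner_integral M (\<lambda>w. (\<xi> w *v (W b w - W a w)) \<bullet> (\<zeta> w *v (W d w - W c w)))
     (overlap a b c d * expectation (\<lambda>w. \<xi> w \<bullet> \<zeta> w))"
    by (simp add: E1 sum_distrib_left)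
qed

text \<open>Since the time intervals may overlap, the isometry also applies to differences of elementary
  integrands that live on different partitions.\<close>

lemma elementary_isometry:
  fixes \<xi> :: "nat \<Rightarrow> 'w \<Rightarrow> real^'m^'d"
  assumes ab: "\<forall>i<n. 0 \<le> a i \<and> a i \<le> b i"
    and \<xi>: "\<forall>i<n. \<xi> i \<in> borel_measurable (F (a i)) \<and> (\<exists>B. \<forall>w\<in>space M. norm (\<xi> i w) \<le> B)"
  shows "(sqnorm M (\<lambda>w. \<Sum>i<n. \<xi> i w *v (W (b i) w - W (a i) w)))
    = (\<integral>\<^sup>+w. (\<integral>\<^sup>+s. ennreal ((norm (\<Sum>i<n. indicator {a i<..b i} s *\<^sub>R \<xi> i w))\<^sup>2) \<partial>lborel) \<partial>M)"
proof -
  obtain B where B: "\<forall>i<n. \<forall>w\<in>space M. norm (\<xi> i w) \<le> B i"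
    using \<xi> by metis
  define C where "C = (\<Sum>i<n. \<bar>B i\<bar>)"
  have C: "\<forall>w\<in>space M. norm (\<xi> i w) \<le> C" if "i < n" for i
  proof
    fix w assume "w \<in> space M"
    then have "norm (\<xi> i w) \<le> \<bar>B i\<bar>" using B that by fastforce
    also have "\<dots> \<le> C" unfolding C_def using that by (intro member_le_sum) auto
    finally show "norm (\<xi> i w) \<le> C" .
  qed
  let ?o = "\<lambda>i j. overlap (a i) (b i) (a j) (b j)"
  have e1: "(norm (\<Sum>i<n. f i))\<^sup>2 = (\<Sum>i<n. \<Sum>j<n. f i \<bullet> f j)" for f :: "nat \<Rightarrow> real^'d"
    unfolding power2_norm_eq_inner inner_sum_left by (simp add: inner_sum_right)
  have e1': "(norm (\<Sum>i<n. f i))\<^sup>2 = (\<Sum>i<n. \<Sum>j<n. f i \<bullet> f j)" for f :: "nat \<Rightarrow> real^'m^'d"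
    unfolding power2_norm_eq_inner inner_sum_left by (simp add: inner_sum_right)
  have e2: "(norm (\<Sum>i<n. indicator {a i<..b i} s *\<^sub>R \<xi> i w))\<^sup>2
      = (\<Sum>i<n. \<Sum>j<n. (indicator {a i<..b i} s * indicator {a j<..b j} s) * (\<xi> i w \<bullet> \<xi> j w))" for s w
    unfolding e1' inner_scaleR_left inner_scaleR_right
    by (intro sum.cong refl) (simp add: mult_ac)
  have nn: "(\<integral>\<^sup>+x. ennreal (f x) \<partial>N) = ennreal c" if "has_bochner_integral N f c" "\<And>x. 0 \<le> f x" for N f c
    using that by (auto simp: has_bochner_integral_iff nn_integral_eq_integral)
  have "has_bochner_integral M (\<lambda>w. (norm (\<Sum>i<n. \<xi> i w *v (W (b i) w - W (a i) w)))\<^sup>2)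
     (\<Sum>i<n. \<Sum>j<n. ?o i j * expectation (\<lambda>w. \<xi> i w \<bullet> \<xi> j w))"
    unfolding e1 by (intro has_bochner_integral_sum increment_inner(2)[where B=C]) (use ab \<xi> C in auto)
  from nn[OF this] have 1: "(sqnorm M (\<lambda>w. \<Sum>i<n. \<xi> i w *v (W (b i) w - W (a i) w)))
    = ennreal (\<Sum>i<n. \<Sum>j<n. ?o i j * expectation (\<lambda>w. \<xi> i w \<bullet> \<xi> j w))" by simp
  have h2: "has_bochner_integral lborel (\<lambda>s. (norm (\<Sum>i<n. indicator {a i<..b i} s *\<^sub>R \<xi> i w))\<^sup>2)
     (\<Sum>i<n. \<Sum>j<n. ?o i j * (\<xi> i w \<bullet> \<xi> j w))" for w
    unfolding e2 by (intro has_bochner_integral_sum has_bochner_integral_mult_left has_bochner_integral_overlap)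
  have h3: "0 \<le> (\<Sum>i<n. \<Sum>j<n. ?o i j * (\<xi> i w \<bullet> \<xi> j w))" for w
    unfolding has_bochner_integral_integral_eq[OF h2[of w], symmetric] by simp
  have ii: "integrable M (\<lambda>w. \<xi> i w \<bullet> \<xi> j w)" if "i < n" "j < n" for i j
    by (rule increment_inner(1)[of "a i" "b i" "a j" "b j" _ C]) (use ab \<xi> C that in auto)
  have "has_bochner_integral M (\<lambda>w. \<Sum>i<n. \<Sum>j<n. ?o i j * (\<xi> i w \<bullet> \<xi> j w))
     (\<Sum>i<n. \<Sum>j<n. ?o i j * expectation (\<lambda>w. \<xi> i w \<bullet> \<xi> j w))"
    by (intro has_bochner_integral_sum has_bochner_integral_mult_right has_bochner_integral_integrable
        ii) auto
  from nn[OF this h3] show ?thesis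
    unfolding 1 nn[OF h2 zero_le_power2] by simp
qed

lemma elementary_mean:
  fixes \<xi> :: "nat \<Rightarrow> 'w \<Rightarrow> real^'m^'d" and \<eta> :: "'w \<Rightarrow> real^'d"
  assumes ab: "\<forall>i<n. s \<le> a i \<and> a i \<le> b i" and s: "0 \<le> s"
    and \<xi>: "\<forall>i<n. \<xi> i \<in> borel_measurable (F (a i)) \<and> (\<exists>B. \<forall>w\<in>space M. norm (\<xi> i w) \<le> B)"
    and \<eta>: "\<eta> \<in> borel_measurable (F s)" "\<forall>w\<in>space M. norm (\<eta> w) \<le> B'"
  shows "has_bochner_integral M (\<lambda>w. \<eta> w \<bullet> (\<Sum>i<n. \<xi> i w *v (W (b i) w - W (a i) w))) 0"
proof -
  have bnd: "\<bar>A $ k $ i\<bar> \<le> norm A" for A :: "real^'m^'d" and k i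
    by (rule order_trans[OF component_le_norm_cart Finite_Cartesian_Product.norm_nth_le])
  have e: "\<eta> w \<bullet> (\<Sum>i<n. \<xi> i w *v (W (b i) w - W (a i) w))
     = (\<Sum>i<n. \<Sum>k\<in>UNIV. \<Sum>j\<in>UNIV. (\<eta> w $ k * \<xi> i w $ k $ j) * D (a i) (b i) j w)" for w
    by (simp add: inner_sum_right inner_vec_def[of "\<eta> w"] matrix_vector_mult_def sum_distrib_left mult.assoc)
  have "has_bochner_integral M (\<lambda>w. \<eta> w \<bullet> (\<Sum>i<n. \<xi> i w *v (W (b i) w - W (a i) w)))
     (\<Sum>i<n. \<Sum>k\<in>(UNIV::'d set). \<Sum>j\<in>(UNIV::'m set). 0)"
    unfolding e
  proof (intro has_bochner_integral_sum increment_moments(1))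
    fix i k j assume "i \<in> {..<n}"
    then have i: "s \<le> a i" "a i \<le> b i" "\<xi> i \<in> borel_measurable (F (a i))" using ab \<xi> by auto
    obtain B where B: "\<forall>w\<in>space M. norm (\<xi> i w) \<le> B" using \<xi> \<open>i \<in> _\<close> by auto
    show "0 \<le> a i" "a i \<le> b i" using i s by auto
    show m: "(\<lambda>w. \<eta> w $ k * \<xi> i w $ k $ j) \<in> borel_measurable (F (a i))"
      using F_measurable_mono[OF \<eta>(1) s i(1)] i(3)
      by (intro borel_measurable_times borel_measurable_vec_nth')
    show "integrable M (\<lambda>w. \<eta> w $ k * \<xi> i w $ k $ j)"
    proof (rule integrable_const_bound[of _ "B' * B"])
      show "AE w in M. norm (\<eta> w $ k * \<xi> i w $ k $ j) \<le> B' * B"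
      proof (rule AE_I2)
        fix w assume w: "w \<in> space M"
        have "\<bar>\<eta> w $ k\<bar> \<le> B'" using \<eta>(2) w component_le_norm_cart order_trans by blast
        moreover have "\<bar>\<xi> i w $ k $ j\<bar> \<le> B" using B w bnd order_trans by blast
        ultimately show "norm (\<eta> w $ k * \<xi> i w $ k $ j) \<le> B' * B"
          unfolding real_norm_def abs_mult by (intro mult_mono) auto
      qed
    qed (use F_measurable_M[OF m] i s in auto)
  qed
  then show ?thesis by simp
qed

end

section \<open>Increments of the Ito integral\<close>

text \<open>The free parameter puts a factor arbitrarily close to 1 on one of the summands, at the expense
  of the other. Sharp constants therefore survive a passage to the limit.\<close>

lemma norm_add_squared_le:
  fixes x y :: "'a::real_inner"
  assumes "0 < d"
  shows "(norm (x + y))\<^sup>2 \<le> (1 + d) * (norm x)\<^sup>2 + (1 + 1 / d) * (norm y)\<^sup>2"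
proof -
  have "(norm (x + y))\<^sup>2 \<le> (norm x + norm y)\<^sup>2"
    by (intro power_mono norm_triangle_ineq norm_ge_zero)
  moreover have "0 \<le> (d * norm x - norm y)\<^sup>2 / d" using assms by auto
  moreover have "(d * norm x - norm y)\<^sup>2 / d = d * (norm x)\<^sup>2 - 2 * norm x * norm y + (norm y)\<^sup>2 / d"
    using assms by (simp add: power2_eq_square field_simps)
  ultimately show ?thesis by (simp add: power2_sum algebra_simps)
qed

lemma nn_integral_norm_add_squared_le:
  fixes f g :: "'a \<Rightarrow> 'b::{real_inner, second_countable_topology}"
  assumes [measurable]: "f \<in> borel_measurable N" "g \<in> borel_measurable N" and d: "0 < d"
  shows "(sqnorm N (\<lambda>x. f x + g x))
    \<le> ennreal (1 + d) * (sqnorm N (\<lambda>x. f x)) + ennreal (1 + 1 / d) * (sqnorm N (\<lambda>x. g x))"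
proof -
  have "(sqnorm N (\<lambda>x. f x + g x))
    \<le> (\<integral>\<^sup>+x. ennreal (1 + d) * ennreal ((norm (f x))\<^sup>2) + ennreal (1 + 1 / d) * ennreal ((norm (g x))\<^sup>2) \<partial>N)"
    using norm_add_squared_le[OF d, of "f x" "g x" for x] d
    by (intro nn_integral_mono) (simp add: ennreal_mult[symmetric] ennreal_plus[symmetric] del: ennreal_plus)
  then show ?thesis by (simp add: nn_integral_add nn_integral_cmult)
qed

lemma L2_tendsto_add:
  fixes f g :: "nat \<Rightarrow> 'a \<Rightarrow> 'b::{real_inner, second_countable_topology}"
  assumes "\<And>k. f k \<in> borel_measurable N" "\<And>k. g k \<in> borel_measurable N"
    and f: "(\<lambda>k. sqnorm N (\<lambda>x. f k x)) \<longlonglongrightarrow> 0"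
    and g: "(\<lambda>k. sqnorm N (\<lambda>x. g k x)) \<longlonglongrightarrow> 0"
  shows "(\<lambda>k. sqnorm N (\<lambda>x. f k x + g k x)) \<longlonglongrightarrow> 0"
proof (rule tendsto_sandwich[OF _ _ tendsto_const])
  show "\<forall>\<^sub>F k in sequentially. (sqnorm N (\<lambda>x. f k x + g k x))
    \<le> ennreal 2 * (sqnorm N (\<lambda>x. f k x)) + ennreal 2 * (sqnorm N (\<lambda>x. g k x))"
    using nn_integral_norm_add_squared_le[OF assms(1,2), of 1] by (intro always_eventually) auto
  show "(\<lambda>k. ennreal 2 * (sqnorm N (\<lambda>x. f k x)) + ennreal 2 * (sqnorm N (\<lambda>x. g k x))) \<longlonglongrightarrow> 0"
    using tendsto_add[OF ennreal_tendsto_cmult[OF _ f, of "ennreal 2"] ennreal_tendsto_cmult[OF _ g, of "ennreal 2"]] by simp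
qed auto

text \<open>The two sequences may live on different measure spaces: below, one consists of stochastic integrals
  on \<open>\<Omega>\<close> and the other of their integrands on \<open>\<Omega> \<times> [0, t]\<close>.\<close>

lemma L2_norm_limit_le:
  fixes f :: "'a \<Rightarrow> 'b::{real_inner, second_countable_topology}"
    and g :: "'c \<Rightarrow> 'e::{real_inner, second_countable_topology}"
  assumes fm: "\<And>k. fs k \<in> borel_measurable N" "f \<in> borel_measurable N"
    and gm: "\<And>k. gs k \<in> borel_measurable N'" "g \<in> borel_measurable N'"
    and f: "(\<lambda>k. sqnorm N (\<lambda>x. fs k x - f x)) \<longlonglongrightarrow> 0"
    and g: "(\<lambda>k. sqnorm N' (\<lambda>x. gs k x - g x)) \<longlonglongrightarrow> 0"
    and eq: "\<And>k. (sqnorm N (\<lambda>x. fs k x)) = (sqnorm N' (\<lambda>x. gs k x))"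
  shows "(sqnorm N (\<lambda>x. f x)) \<le> (sqnorm N' (\<lambda>x. g x))"
    (is "?f \<le> ?g")
proof (cases "?g = \<infinity>")
  case False
  have bound: "?f \<le> ennreal (1 + d) * (ennreal (1 + d) * ?g)" if d: "0 < d" for d
  proof (rule LIMSEQ_le_const)
    let ?a = "\<lambda>k. sqnorm N (\<lambda>x. fs k x - f x)"
    let ?b = "\<lambda>k. sqnorm N' (\<lambda>x. gs k x - g x)"
    have "?f \<le> ennreal (1 + d) * (ennreal (1 + d) * ?g + ennreal (1 + 1 / d) * ?b k) + ennreal (1 + 1 / d) * ?a k" for k
    proof -
      have "?f \<le> ennreal (1 + d) * (sqnorm N (\<lambda>x. fs k x)) + ennreal (1 + 1 / d) * ?a k"
        using nn_integral_norm_add_squared_le[OF fm(1) _ d, of "\<lambda>x. f x - fs k x" k] fm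
        by (simp add: norm_minus_commute)
      moreover have "(sqnorm N' (\<lambda>x. gs k x)) \<le> ennreal (1 + d) * ?g + ennreal (1 + 1 / d) * ?b k"
        using nn_integral_norm_add_squared_le[OF gm(2) _ d, of "\<lambda>x. gs k x - g x"] gm by simp
      ultimately show ?thesis unfolding eq
        by (meson add_mono order_refl order_trans mult_left_mono zero_le)
    qed
    then show "\<exists>N. \<forall>n\<ge>N. ?f \<le> ennreal (1 + d) * (ennreal (1 + d) * ?g + ennreal (1 + 1 / d) * ?b n) + ennreal (1 + 1 / d) * ?a n"
      by blast
    have "(\<lambda>n. ennreal (1 + d) * (ennreal (1 + d) * ?g + ennreal (1 + 1 / d) * ?b n) + ennreal (1 + 1 / d) * ?a n)
      \<longlonglongrightarrow> ennreal (1 + d) * (ennreal (1 + d) * ?g + ennreal (1 + 1 / d) * 0) + ennreal (1 + 1 / d) * 0"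
      by (intro tendsto_add ennreal_tendsto_cmult tendsto_const f g) auto
    then show "(\<lambda>n. ennreal (1 + d) * (ennreal (1 + d) * ?g + ennreal (1 + 1 / d) * ?b n) + ennreal (1 + 1 / d) * ?a n)
      \<longlonglongrightarrow> ennreal (1 + d) * (ennreal (1 + d) * ?g)" by simp
  qed
  obtain c where c: "0 \<le> c" "?g = ennreal c" using False by (cases ?g) auto
  have "?f \<le> ennreal ((1 + 1 / real (Suc n)) * ((1 + 1 / real (Suc n)) * c))" for n
    using bound[of "1 / real (Suc n)"] c by (simp add: ennreal_mult[symmetric] del: ennreal_plus of_nat_Suc)
  moreover have "(\<lambda>n. ennreal ((1 + 1 / real (Suc n)) * ((1 + 1 / real (Suc n)) * c))) \<longlonglongrightarrow> ennreal ((1 + 0) * ((1 + 0) * c))"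
    by (intro tendsto_ennrealI tendsto_intros LIMSEQ_Suc[OF lim_1_over_n])
  ultimately show ?thesis using c LIMSEQ_le_const by fastforce
qed auto

lemma borel_measurable_extend_fst:
  fixes f :: "'a \<times> 'b \<Rightarrow> 'c::real_normed_vector"
  assumes f: "f \<in> borel_measurable (restrict_space N A \<Otimes>\<^sub>M P)" and A: "A \<in> sets N"
  shows "(\<lambda>x. indicator A (fst x) *\<^sub>R f x) \<in> borel_measurable (N \<Otimes>\<^sub>M P)"
proof -
  have "(\<lambda>x. (fst x, snd x)) \<in> restrict_space (N \<Otimes>\<^sub>M P) {x. fst x \<in> A} \<rightarrow>\<^sub>M restrict_space N A \<Otimes>\<^sub>M P"
    by (intro measurable_Pair measurable_restrict_space2) (auto simp: space_restrict_space measurable_restrict_space1)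
  then have "f \<in> restrict_space (N \<Otimes>\<^sub>M P) {x. fst x \<in> A} \<rightarrow>\<^sub>M borel"
    using measurable_comp[OF _ f] by (simp add: comp_def)
  moreover have "{x \<in> space (N \<Otimes>\<^sub>M P). fst x \<in> A} \<in> sets (N \<Otimes>\<^sub>M P)"
    using A by measurable
  ultimately have "(\<lambda>x. if fst x \<in> A then f x else 0) \<in> borel_measurable (N \<Otimes>\<^sub>M P)"
    by (subst measurable_If_restrict_space_iff) auto
  moreover have "(\<lambda>x. if fst x \<in> A then f x else 0) = (\<lambda>x. indicator A (fst x) *\<^sub>R f x)"
    by (auto simp: indicator_def)
  ultimately show ?thesis by simp
qed

lemma sum_concat:
  fixes f g :: "nat \<Rightarrow> 'a::ab_group_add"
  shows "(\<Sum>i<n+m. if i < n then f i else g (i - n)) = (\<Sum>i<n. f i) + (\<Sum>i<m. g i)"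
  by (induction m) (auto simp: add.assoc)

context brownian_filtration
begin

abbreviation clip :: "real \<Rightarrow> real \<Rightarrow> real \<Rightarrow> real" where
  "clip u v r \<equiv> max u (min v r)"

text \<open>Integrands that start after time \<open>v\<close> are replaced by 0, since they need not be
  measurable at the clipped time \<open>v\<close>.\<close>

lemma clipped_integrand:
  assumes e: "elementary_integrand M F n \<tau> \<xi>" and uv: "0 \<le> u" "u \<le> v"
  defines "\<xi>' \<equiv> \<lambda>i w. if \<tau> i \<le> v then \<xi> i w else 0"
  shows "\<forall>i<n. u \<le> clip u v (\<tau> i) \<and> clip u v (\<tau> i) \<le> clip u v (\<tau> (Suc i))"
    "\<forall>i<n. \<xi>' i \<in> borel_measurable (F (clip u v (\<tau> i))) \<and> (\<exists>B. \<forall>w\<in>space M. norm (\<xi>' i w) \<le> B)"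
    "(\<Sum>i<n. \<xi>' i w *v (W (clip u v (\<tau> (Suc i))) w - W (clip u v (\<tau> i)) w))
      = elementary_ito_integral n \<tau> \<xi> W v w - elementary_ito_integral n \<tau> \<xi> W u w"
    "(\<Sum>i<n. indicator {clip u v (\<tau> i)<..clip u v (\<tau> (Suc i))} r *\<^sub>R \<xi>' i w)
      = indicator {u<..v} r *\<^sub>R elementary_process n \<tau> \<xi> r w"
proof -
  have \<tau>: "0 \<le> \<tau> i" "\<tau> i \<le> \<tau> (Suc i)" "\<xi> i \<in> borel_measurable (F (\<tau> i))"
      "\<exists>B. \<forall>w\<in>space M. norm (\<xi> i w) \<le> B" if "i < n" for i
    using e that by (auto simp: elementary_integrand_def)
  show "\<forall>i<n. u \<le> clip u v (\<tau> i) \<and> clip u v (\<tau> i) \<le> clip u v (\<tau> (Suc i))"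
    using \<tau> uv by fastforce
  show "\<forall>i<n. \<xi>' i \<in> borel_measurable (F (clip u v (\<tau> i))) \<and> (\<exists>B. \<forall>w\<in>space M. norm (\<xi>' i w) \<le> B)"
  proof (intro allI impI)
    fix i assume i: "i < n"
    show "\<xi>' i \<in> borel_measurable (F (clip u v (\<tau> i))) \<and> (\<exists>B. \<forall>w\<in>space M. norm (\<xi>' i w) \<le> B)"
    proof (cases "\<tau> i \<le> v")
      case True
      then have "\<xi>' i = \<xi> i" by (auto simp: \<xi>'_def)
      then show ?thesis using \<tau>[OF i] F_measurable_mono[OF \<tau>(3,1)[OF i], of "clip u v (\<tau> i)"] True by auto
    next
      case False
      then have "\<xi>' i = (\<lambda>_. 0)" by (auto simp: \<xi>'_def)
      then show ?thesis by auto
    qed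
  qed
  show "(\<Sum>i<n. \<xi>' i w *v (W (clip u v (\<tau> (Suc i))) w - W (clip u v (\<tau> i)) w))
      = elementary_ito_integral n \<tau> \<xi> W v w - elementary_ito_integral n \<tau> \<xi> W u w"
    unfolding elementary_ito_integral_def sum_subtractf[symmetric]
  proof (rule sum.cong[OF refl])
    fix i assume "i \<in> {..<n}"
    then have "\<tau> i \<le> \<tau> (Suc i)" using \<tau> by auto
    then consider "\<tau> (Suc i) \<le> u" | "\<tau> i \<le> u" "u < \<tau> (Suc i)" | "u < \<tau> i" "\<tau> i \<le> v" | "v < \<tau> i" by linarith
    then show "\<xi>' i w *v (W (clip u v (\<tau> (Suc i))) w - W (clip u v (\<tau> i)) w)
      = \<xi> i w *v (W (min v (\<tau> (Suc i))) w - W (min v (\<tau> i)) w)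
       - \<xi> i w *v (W (min u (\<tau> (Suc i))) w - W (min u (\<tau> i)) w)"
      using uv \<open>\<tau> i \<le> \<tau> (Suc i)\<close>
      by cases (auto simp: \<xi>'_def min_def max_def matrix_vector_mult_diff_distrib[symmetric])
  qed
  show "(\<Sum>i<n. indicator {clip u v (\<tau> i)<..clip u v (\<tau> (Suc i))} r *\<^sub>R \<xi>' i w)
      = indicator {u<..v} r *\<^sub>R elementary_process n \<tau> \<xi> r w"
    unfolding elementary_process_def scaleR_sum_right
  proof (rule sum.cong[OF refl])
    fix i assume "i \<in> {..<n}"
    then have "\<tau> i \<le> \<tau> (Suc i)" using \<tau> by auto
    then show "indicator {clip u v (\<tau> i)<..clip u v (\<tau> (Suc i))} r *\<^sub>R \<xi>' i w
      = indicator {u<..v} r *\<^sub>R indicator {\<tau> i<..\<tau> (Suc i)} r *\<^sub>R \<xi> i w"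
      using uv by (auto simp: \<xi>'_def indicator_def)
  qed
qed

lemma elementary_ito_integral_0:
  "elementary_integrand M F n \<tau> \<xi> \<Longrightarrow> elementary_ito_integral n \<tau> \<xi> W 0 w = 0"
proof -
  assume e: "elementary_integrand M F n \<tau> \<xi>"
  have "min 0 (\<tau> i) = 0" "min 0 (\<tau> (Suc i)) = 0" if "i < n" for i
    using e that by (fastforce simp: elementary_integrand_def)+
  then show ?thesis unfolding elementary_ito_integral_def by (intro sum.neutral) auto
qed

lemma elementary_increment_isometry:
  assumes e: "elementary_integrand M F n \<tau> \<xi>" and uv: "0 \<le> u" "u \<le> v"
  shows "(sqnorm M (\<lambda>w. elementary_ito_integral n \<tau> \<xi> W v w - elementary_ito_integral n \<tau> \<xi> W u w))
    = (\<integral>\<^sup>+w. (\<integral>\<^sup>+r. ennreal ((norm (indicator {u<..v} r *\<^sub>R elementary_process n \<tau> \<xi> r w))\<^sup>2) \<partial>lborel) \<partial>M)"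
  unfolding clipped_integrand(3,4)[OF e uv, symmetric]
  by (rule elementary_isometry) (use clipped_integrand(1,2)[OF e uv] uv in \<open>auto intro: order_trans[OF uv(1)]\<close>)

text \<open>Both integrands are put into one family, the second one with the opposite sign, so that
  the isometry for overlapping intervals applies.\<close>

lemma elementary_difference_isometry:
  assumes e: "elementary_integrand M F n \<tau> \<xi>" and e': "elementary_integrand M F n' \<tau>' \<xi>'" and v: "0 \<le> v"
  shows "(sqnorm M (\<lambda>w. elementary_ito_integral n \<tau> \<xi> W v w - elementary_ito_integral n' \<tau>' \<xi>' W v w))
    = (\<integral>\<^sup>+w. (\<integral>\<^sup>+r. ennreal ((norm (indicator {0<..v} r *\<^sub>R
        (elementary_process n \<tau> \<xi> r w - elementary_process n' \<tau>' \<xi>' r w)))\<^sup>2) \<partial>lborel) \<partial>M)"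
proof -
  note c = clipped_integrand[OF e order_refl v] and c' = clipped_integrand[OF e' order_refl v]
  let ?x = "\<lambda>i w. if \<tau> i \<le> v then \<xi> i w else 0" and ?x' = "\<lambda>i w. if \<tau>' i \<le> v then \<xi>' i w else 0"
  define a where "a = (\<lambda>i. if i < n then clip 0 v (\<tau> i) else clip 0 v (\<tau>' (i - n)))"
  define b where "b = (\<lambda>i. if i < n then clip 0 v (\<tau> (Suc i)) else clip 0 v (\<tau>' (Suc (i - n))))"
  define x where "x = (\<lambda>i w. if i < n then ?x i w else - ?x' (i - n) w)"
  have 1: "(\<Sum>i<n+n'. x i w *v (W (b i) w - W (a i) w))
     = elementary_ito_integral n \<tau> \<xi> W v w - elementary_ito_integral n' \<tau>' \<xi>' W v w" for w
  proof -
    have neg: "(- A) *v y = - (A *v y)" for A :: "real^'m^'d" and y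
      by (simp add: matrix_vector_mult_def vec_eq_iff sum_negf)
    have "(\<Sum>i<n+n'. x i w *v (W (b i) w - W (a i) w))
      = (\<Sum>i<n+n'. if i < n then ?x i w *v (W (clip 0 v (\<tau> (Suc i))) w - W (clip 0 v (\<tau> i)) w)
         else - (?x' (i - n) w *v (W (clip 0 v (\<tau>' (Suc (i - n)))) w - W (clip 0 v (\<tau>' (i - n))) w)))"
      by (intro sum.cong refl) (simp only: x_def a_def b_def neg split: if_split; simp)
    also have "\<dots> = (\<Sum>i<n. ?x i w *v (W (clip 0 v (\<tau> (Suc i))) w - W (clip 0 v (\<tau> i)) w))
       + (\<Sum>i<n'. - (?x' i w *v (W (clip 0 v (\<tau>' (Suc i))) w - W (clip 0 v (\<tau>' i)) w)))"
      by (rule sum_concat)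
    also have "\<dots> = elementary_ito_integral n \<tau> \<xi> W v w - elementary_ito_integral n' \<tau>' \<xi>' W v w"
      unfolding sum_negf c(3) c'(3) by (simp add: elementary_ito_integral_0 e e')
    finally show ?thesis .
  qed
  have 2: "(\<Sum>i<n+n'. indicator {a i<..b i} r *\<^sub>R x i w)
     = indicator {0<..v} r *\<^sub>R (elementary_process n \<tau> \<xi> r w - elementary_process n' \<tau>' \<xi>' r w)" for r w
  proof -
    have "(\<Sum>i<n+n'. indicator {a i<..b i} r *\<^sub>R x i w)
      = (\<Sum>i<n+n'. if i < n then indicator {clip 0 v (\<tau> i)<..clip 0 v (\<tau> (Suc i))} r *\<^sub>R ?x i w
         else - (indicator {clip 0 v (\<tau>' (i - n))<..clip 0 v (\<tau>' (Suc (i - n)))} r *\<^sub>R ?x' (i - n) w))"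
      by (intro sum.cong refl) (simp only: x_def a_def b_def scaleR_minus_right split: if_split; simp)
    also have "\<dots> = (\<Sum>i<n. indicator {clip 0 v (\<tau> i)<..clip 0 v (\<tau> (Suc i))} r *\<^sub>R ?x i w)
       + (\<Sum>i<n'. - (indicator {clip 0 v (\<tau>' i)<..clip 0 v (\<tau>' (Suc i))} r *\<^sub>R ?x' i w))"
      by (rule sum_concat)
    also have "\<dots> = indicator {0<..v} r *\<^sub>R (elementary_process n \<tau> \<xi> r w - elementary_process n' \<tau>' \<xi>' r w)"
      unfolding sum_negf c(4) c'(4) by (simp add: scaleR_diff_right)
    finally show ?thesis .
  qed
  show ?thesis unfolding 1[symmetric] 2[symmetric]
  proof (rule elementary_isometry)
    show "\<forall>i<n + n'. 0 \<le> a i \<and> a i \<le> b i"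
      using c(1) c'(1) by (auto simp: a_def b_def)
    show "\<forall>i<n + n'. x i \<in> borel_measurable (F (a i)) \<and> (\<exists>B. \<forall>w\<in>space M. norm (x i w) \<le> B)"
    proof (intro allI impI)
      fix i assume i: "i < n + n'"
      show "x i \<in> borel_measurable (F (a i)) \<and> (\<exists>B. \<forall>w\<in>space M. norm (x i w) \<le> B)"
      proof (cases "i < n")
        case True
        then have "x i = ?x i" "a i = clip 0 v (\<tau> i)" by (auto simp: x_def a_def)
        then show ?thesis using c(2) True by simp
      next
        case False
        then have j: "i - n < n'" and xa: "x i = (\<lambda>w. - ?x' (i - n) w)" "a i = clip 0 v (\<tau>' (i - n))"
          using i by (auto simp: x_def a_def)
        show ?thesis unfolding xa norm_minus_cancel
          using c'(2) j by (intro conjI borel_measurable_uminus) blast+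
      qed
    qed
  qed
qed

lemma elementary_process_measurable:
  assumes e: "elementary_integrand M F n \<tau> \<xi>"
  shows "(\<lambda>x. elementary_process n \<tau> \<xi> (snd x) (fst x)) \<in> borel_measurable (M \<Otimes>\<^sub>M lborel)"
  unfolding elementary_process_def
proof (intro borel_measurable_sum borel_measurable_scaleR)
  fix i assume "i \<in> {..<n}"
  then have "\<xi> i \<in> borel_measurable M"
    using e F_measurable_M by (auto simp: elementary_integrand_def)
  then show "(\<lambda>x. \<xi> i (fst x)) \<in> borel_measurable (M \<Otimes>\<^sub>M lborel)" by measurable
  show "(\<lambda>x. indicat_real {\<tau> i<..\<tau> (Suc i)} (snd x)) \<in> borel_measurable (M \<Otimes>\<^sub>M lborel)" by measurable
qed

lemma elementary_ito_integral_measurable: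
  assumes e: "elementary_integrand M F n \<tau> \<xi>" and t: "0 \<le> t"
  shows "elementary_ito_integral n \<tau> \<xi> W t \<in> borel_measurable M"
proof -
  have "(\<lambda>w. \<xi> i w *v (W (min t (\<tau> (Suc i))) w - W (min t (\<tau> i)) w)) \<in> borel_measurable M" if i: "i < n" for i
  proof -
    have \<tau>: "0 \<le> \<tau> i" "0 \<le> \<tau> (Suc i)" "\<xi> i \<in> borel_measurable (F (\<tau> i))"
      using e i by (auto simp: elementary_integrand_def intro: order_trans)
    have [measurable]: "\<xi> i \<in> borel_measurable M" by (rule F_measurable_M[OF \<tau>(3,1)])
    have [measurable]: "W (min t (\<tau> (Suc i))) \<in> borel_measurable M" "W (min t (\<tau> i)) \<in> borel_measurable M"
      using \<tau> t by auto
    have c: "continuous_on UNIV (\<lambda>p::(real^'m^'d) \<times> (real^'m). fst p *v snd p)"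
      unfolding matrix_vector_mult_def by (intro continuous_intros)
    have "(\<lambda>w. (\<lambda>p. fst p *v snd p) (\<xi> i w, W (min t (\<tau> (Suc i))) w - W (min t (\<tau> i)) w)) \<in> borel_measurable M"
      by (rule measurable_compose[OF _ borel_measurable_continuous_onI[OF c]]) measurable
    then show ?thesis by simp
  qed
  then show ?thesis unfolding elementary_ito_integral_def by (intro borel_measurable_sum) auto
qed

text \<open>Comparing the approximations that belong to two different times needs the isometry for
  differences of elementary integrands.\<close>

lemma ito_increment_approx:
  fixes Js Jt :: "'w \<Rightarrow> real^'d"
  assumes st: "0 \<le> s" "s \<le> t"
    and Js: "has_ito_integral M F W H s Js" and Jt: "has_ito_integral M F W H t Jt"
  obtains n \<tau> \<xi> where "\<And>k. elementary_integrand M F (n k) (\<tau> k) (\<xi> k)"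
    "(\<lambda>k. sqnorm (M \<Otimes>\<^sub>M lborel) (\<lambda>x. indicator {0..t} (snd x) *\<^sub>R (elementary_process (n k) (\<tau> k) (\<xi> k) (snd x) (fst x)
        - H (snd x) (fst x)))) \<longlonglongrightarrow> 0"
    "(\<lambda>k. sqnorm M (\<lambda>w. elementary_ito_integral (n k) (\<tau> k) (\<xi> k) W t w
        - elementary_ito_integral (n k) (\<tau> k) (\<xi> k) W s w - (Jt w - Js w))) \<longlonglongrightarrow> 0"
    "(\<lambda>x. indicator {0..t} (snd x) *\<^sub>R H (snd x) (fst x)) \<in> borel_measurable (M \<Otimes>\<^sub>M lborel)"
    "Js \<in> borel_measurable M" "Jt \<in> borel_measurable M"
proof -
  have Jm[measurable]: "Js \<in> borel_measurable M" "Jt \<in> borel_measurable M"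
    using Js Jt by (auto simp: has_ito_integral_def)
  have meas: "(\<lambda>x. indicator {0..u} (snd x) *\<^sub>R H (snd x) (fst x)) \<in> borel_measurable (M \<Otimes>\<^sub>M lborel)"
    if u: "0 \<le> u" and J: "has_ito_integral M F W H u J" for u and J :: "'w \<Rightarrow> real^'d"
  proof -
    have "(\<lambda>(s, w). H s w) \<in> borel_measurable (restrict_space borel {0..u} \<Otimes>\<^sub>M F u)"
      using J u by (auto simp: has_ito_integral_def)
    from borel_measurable_extend_fst[OF this]
    have Hm: "(\<lambda>x. indicator {0..u} (fst x) *\<^sub>R H (fst x) (snd x)) \<in> borel_measurable (borel \<Otimes>\<^sub>M F u)"
      by (simp add: split_beta)
    have sw: "(\<lambda>x. (snd x, fst x)) \<in> M \<Otimes>\<^sub>M lborel \<rightarrow>\<^sub>M borel \<Otimes>\<^sub>M F u"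
    proof (rule measurable_Pair)
      have "subalgebra M (F u)" using filt u by (auto simp: filtration_halfline_def)
      then have "(\<lambda>x. x) \<in> M \<rightarrow>\<^sub>M F u" by (rule measurable_from_subalg) simp
      then show "fst \<in> M \<Otimes>\<^sub>M lborel \<rightarrow>\<^sub>M F u"
        using measurable_compose[OF measurable_fst] by auto
    qed auto
    show ?thesis using measurable_compose[OF sw Hm] by simp
  qed
  note mt[measurable] = meas[OF order_trans[OF st] Jt] and ms[measurable] = meas[OF st(1) Js]
  from Jt obtain n \<tau> \<xi> where e: "\<And>k::nat. elementary_integrand M F (n k) (\<tau> k) (\<xi> k)"
    and p: "(\<lambda>k. \<integral>\<^sup>+ w. (\<integral>\<^sup>+ s\<in>{0..t}.
            ennreal ((norm (elementary_process (n k) (\<tau> k) (\<xi> k) s w - H s w))\<^sup>2) \<partial>lborel) \<partial>M) \<longlonglongrightarrow> 0"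
    and i: "(\<lambda>k. sqnorm M (\<lambda>w. elementary_ito_integral (n k) (\<tau> k) (\<xi> k) W t w - Jt w)) \<longlonglongrightarrow> 0"
    unfolding has_ito_integral_def by auto
  from Js obtain n' \<tau>' \<xi>' where e': "\<And>k::nat. elementary_integrand M F (n' k) (\<tau>' k) (\<xi>' k)"
    and p': "(\<lambda>k. \<integral>\<^sup>+ w. (\<integral>\<^sup>+ r\<in>{0..s}.
            ennreal ((norm (elementary_process (n' k) (\<tau>' k) (\<xi>' k) r w - H r w))\<^sup>2) \<partial>lborel) \<partial>M) \<longlonglongrightarrow> 0"
    and i': "(\<lambda>k. sqnorm M (\<lambda>w. elementary_ito_integral (n' k) (\<tau>' k) (\<xi>' k) W s w - Js w)) \<longlonglongrightarrow> 0"
    unfolding has_ito_integral_def by auto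
  let ?P = "\<lambda>k x. elementary_process (n k) (\<tau> k) (\<xi> k) (snd x) (fst x)"
  let ?P' = "\<lambda>k x. elementary_process (n' k) (\<tau>' k) (\<xi>' k) (snd x) (fst x)"
  let ?H = "\<lambda>x. H (snd x) (fst x)"
  let ?Q = "M \<Otimes>\<^sub>M (lborel :: real measure)"
  have Pm[measurable]: "?P k \<in> borel_measurable ?Q" "?P' k \<in> borel_measurable ?Q" for k
    by (rule elementary_process_measurable[OF e], rule elementary_process_measurable[OF e'])
  have iP: "(\<lambda>x. indicator {0..u} (snd x) *\<^sub>R ?P k x) \<in> borel_measurable ?Q"
    "(\<lambda>x. indicator {0..u} (snd x) *\<^sub>R ?P' k x) \<in> borel_measurable ?Q" for u :: real and k by measurable
  have dm: "(\<lambda>x. indicator {0..t} (snd x) *\<^sub>R (?P k x - ?H x)) \<in> borel_measurable ?Q"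
    "(\<lambda>x. indicator {0..s} (snd x) *\<^sub>R (?P k x - ?H x)) \<in> borel_measurable ?Q"
    "(\<lambda>x. indicator {0..s} (snd x) *\<^sub>R (?P' k x - ?H x)) \<in> borel_measurable ?Q"
    "(\<lambda>x. indicator {0..s} (snd x) *\<^sub>R (?H x - ?P' k x)) \<in> borel_measurable ?Q" for k
    using borel_measurable_diff[OF iP(1) mt] borel_measurable_diff[OF iP(1) ms]
      borel_measurable_diff[OF iP(2) ms] borel_measurable_diff[OF ms iP(2)]
    by (simp_all only: scaleR_diff_right)
  have conv: "(\<integral>\<^sup>+ w. (\<integral>\<^sup>+ r\<in>{0..u}. ennreal ((norm (f r w))\<^sup>2) \<partial>lborel) \<partial>M)
    = (sqnorm ?Q (\<lambda>x. indicator {0..u} (snd x) *\<^sub>R f (snd x) (fst x)))"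
    if "(\<lambda>x. indicator {0..u} (snd x) *\<^sub>R f (snd x) (fst x)) \<in> borel_measurable ?Q"
    for u and f :: "real \<Rightarrow> 'w \<Rightarrow> real^'m^'d"
  proof -
    have "(\<lambda>x. ennreal ((norm (indicator {0..u} (snd x) *\<^sub>R f (snd x) (fst x)))\<^sup>2)) \<in> borel_measurable ?Q"
      using that by measurable
    from lborel.nn_integral_fst[OF this] show ?thesis
      by (subst (asm) eq_commute) (auto intro!: nn_integral_cong simp: indicator_def)
  qed
  have p2: "(\<lambda>k. sqnorm ?Q (\<lambda>x. indicator {0..t} (snd x) *\<^sub>R (?P k x - ?H x))) \<longlonglongrightarrow> 0"
    using p by (subst (asm) conv[OF dm(1)])
  have p2': "(\<lambda>k. sqnorm ?Q (\<lambda>x. indicator {0..s} (snd x) *\<^sub>R (?H x - ?P' k x))) \<longlonglongrightarrow> 0"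
    using p' by (subst (asm) conv[OF dm(3)]) (simp add: norm_minus_commute)
  have p3: "(\<lambda>k. sqnorm ?Q (\<lambda>x. indicator {0..s} (snd x) *\<^sub>R (?P k x - ?H x))) \<longlonglongrightarrow> 0"
    by (rule tendsto_sandwich[OF _ _ tendsto_const p2])
       (use st in \<open>auto intro!: always_eventually nn_integral_mono ennreal_leI simp: indicator_def\<close>)
  have p4: "(\<lambda>k. sqnorm ?Q (\<lambda>x. indicator {0..s} (snd x) *\<^sub>R (?P k x - ?H x)
      + indicator {0..s} (snd x) *\<^sub>R (?H x - ?P' k x))) \<longlonglongrightarrow> 0"
    by (rule L2_tendsto_add[OF dm(2,4) p3 p2'])
  have d1: "(\<lambda>k. sqnorm M (\<lambda>w. elementary_ito_integral (n k) (\<tau> k) (\<xi> k) W s w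
       - elementary_ito_integral (n' k) (\<tau>' k) (\<xi>' k) W s w)) \<longlonglongrightarrow> 0"
  proof (rule tendsto_sandwich[OF _ _ tendsto_const p4])
    have "(sqnorm M (\<lambda>w. elementary_ito_integral (n k) (\<tau> k) (\<xi> k) W s w
       - elementary_ito_integral (n' k) (\<tau>' k) (\<xi>' k) W s w))
      \<le> (\<integral>\<^sup>+ w. (\<integral>\<^sup>+ r\<in>{0..s}. ennreal ((norm (elementary_process (n k) (\<tau> k) (\<xi> k) r w
           - elementary_process (n' k) (\<tau>' k) (\<xi>' k) r w))\<^sup>2) \<partial>lborel) \<partial>M)" for k
      unfolding elementary_difference_isometry[OF e e' st(1)]
      by (intro nn_integral_mono) (auto simp: indicator_def)
    also have "\<And>k. \<dots> k = (sqnorm ?Q (\<lambda>x. indicator {0..s} (snd x) *\<^sub>R (?P k x - ?H x)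
      + indicator {0..s} (snd x) *\<^sub>R (?H x - ?P' k x)))"
      by (subst conv) (auto simp: scaleR_right_distrib[symmetric])
    finally show "\<forall>\<^sub>F k in sequentially. (sqnorm M (\<lambda>w. elementary_ito_integral (n k) (\<tau> k) (\<xi> k) W s w
       - elementary_ito_integral (n' k) (\<tau>' k) (\<xi>' k) W s w))
      \<le> (sqnorm ?Q (\<lambda>x. indicator {0..s} (snd x) *\<^sub>R (?P k x - ?H x)
      + indicator {0..s} (snd x) *\<^sub>R (?H x - ?P' k x)))"
      by (intro always_eventually) auto
  qed auto
  let ?E = "\<lambda>k u w. elementary_ito_integral (n k) (\<tau> k) (\<xi> k) W u w"
  let ?E' = "\<lambda>k u w. elementary_ito_integral (n' k) (\<tau>' k) (\<xi>' k) W u w"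
  have Em: "?E k s \<in> borel_measurable M" "?E k t \<in> borel_measurable M" "?E' k s \<in> borel_measurable M" for k
    using elementary_ito_integral_measurable[OF e st(1)] elementary_ito_integral_measurable[OF e order_trans[OF st]]
      elementary_ito_integral_measurable[OF e' st(1)] by blast+
  have m1: "(\<lambda>w. ?E k s w - ?E' k s w) \<in> borel_measurable M" "(\<lambda>w. ?E' k s w - Js w) \<in> borel_measurable M"
    "(\<lambda>w. ?E k t w - Jt w) \<in> borel_measurable M" for k
    by (intro borel_measurable_diff Em Jm)+
  have d2: "(\<lambda>k. sqnorm M (\<lambda>w. (?E k s w - ?E' k s w) + (?E' k s w - Js w))) \<longlonglongrightarrow> 0"
    by (rule L2_tendsto_add[OF m1(1,2) d1 i'])
  have d2': "(\<lambda>k. sqnorm M (\<lambda>w. Js w - ?E k s w)) \<longlonglongrightarrow> 0"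
    using d2 by (simp add: norm_minus_commute)
  have d3: "(\<lambda>k. sqnorm M (\<lambda>w. (?E k t w - Jt w) + (Js w - ?E k s w))) \<longlonglongrightarrow> 0"
    by (rule L2_tendsto_add[OF m1(3) borel_measurable_diff[OF Jm(1) Em(1)] i d2'])
  have d4: "?E k t w - ?E k s w - (Jt w - Js w) = (?E k t w - Jt w) + (Js w - ?E k s w)" for k w
    by (simp add: algebra_simps)
  show ?thesis
  proof (rule that[OF e p2 _ mt Jm])
    show "(\<lambda>k. sqnorm M (\<lambda>w. ?E k t w - ?E k s w - (Jt w - Js w))) \<longlonglongrightarrow> 0"
      unfolding d4 by (rule d3)
  qed
qed

text \<open>A deterministic majorant of the integrand replaces the expectation of its squared norm.\<close>

lemma ito_increment_L2_le:
  fixes Js Jt :: "'w \<Rightarrow> real^'d"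
  assumes st: "0 \<le> s" "s \<le> t"
    and Js: "has_ito_integral M F W H s Js" and Jt: "has_ito_integral M F W H t Jt"
    and Sg: "AE u in lborel. u \<in> {s..t} \<longrightarrow> (\<forall>w\<in>space M. norm (H u w) \<le> Sg u)"
  shows "(sqnorm M (\<lambda>w. Jt w - Js w)) \<le> (\<integral>\<^sup>+u\<in>{s..t}. ennreal ((Sg u)\<^sup>2) \<partial>lborel)"
proof -
  obtain n \<tau> \<xi> where e: "\<And>k. elementary_integrand M F (n k) (\<tau> k) (\<xi> k)"
    and p: "(\<lambda>k. sqnorm (M \<Otimes>\<^sub>M lborel) (\<lambda>x. indicator {0..t} (snd x) *\<^sub>R (elementary_process (n k) (\<tau> k) (\<xi> k) (snd x) (fst x)
        - H (snd x) (fst x)))) \<longlonglongrightarrow> 0"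
    and i: "(\<lambda>k. sqnorm M (\<lambda>w. elementary_ito_integral (n k) (\<tau> k) (\<xi> k) W t w
        - elementary_ito_integral (n k) (\<tau> k) (\<xi> k) W s w - (Jt w - Js w))) \<longlonglongrightarrow> 0"
    and mt[measurable]: "(\<lambda>x. indicator {0..t} (snd x) *\<^sub>R H (snd x) (fst x)) \<in> borel_measurable (M \<Otimes>\<^sub>M lborel)"
    and Jm[measurable]: "Js \<in> borel_measurable M" "Jt \<in> borel_measurable M"
    by (rule ito_increment_approx[OF st Js Jt]) blast
  let ?Q = "M \<Otimes>\<^sub>M (lborel :: real measure)"
  let ?P = "\<lambda>k x. elementary_process (n k) (\<tau> k) (\<xi> k) (snd x) (fst x)"
  let ?g = "\<lambda>x. indicator {s<..t} (snd x) *\<^sub>R H (snd x) (fst x)"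
  have Pm[measurable]: "?P k \<in> borel_measurable ?Q" for k
    by (rule elementary_process_measurable[OF e])
  have "?g = (\<lambda>x. indicator {s<..t} (snd x) *\<^sub>R (indicator {0..t} (snd x) *\<^sub>R H (snd x) (fst x)))"
    using st by (auto simp: indicator_def)
  moreover have "\<dots> \<in> borel_measurable ?Q" by measurable
  ultimately have gm[measurable]: "?g \<in> borel_measurable ?Q" by (simp only:)
  note Em[measurable] = elementary_ito_integral_measurable[OF e st(1)]
    elementary_ito_integral_measurable[OF e order_trans[OF st]]
  have "(sqnorm M (\<lambda>w. Jt w - Js w)) \<le> (sqnorm ?Q (\<lambda>x. ?g x))"
  proof (rule L2_norm_limit_le[OF _ _ _ gm i])
    show "(\<lambda>k. sqnorm ?Q (\<lambda>x. indicator {s<..t} (snd x) *\<^sub>R ?P k x - ?g x)) \<longlonglongrightarrow> 0"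
      by (rule tendsto_sandwich[OF _ _ tendsto_const p])
       (use st in \<open>auto intro!: always_eventually nn_integral_mono ennreal_leI simp: indicator_def\<close>)
    show "(sqnorm M (\<lambda>w. elementary_ito_integral (n k) (\<tau> k) (\<xi> k) W t w
        - elementary_ito_integral (n k) (\<tau> k) (\<xi> k) W s w))
      = (sqnorm ?Q (\<lambda>x. indicator {s<..t} (snd x) *\<^sub>R ?P k x))" for k
      unfolding elementary_increment_isometry[OF e st]
      by (subst lborel.nn_integral_fst[symmetric]) auto
  qed measurable
  also have "\<dots> = (\<integral>\<^sup>+w. \<integral>\<^sup>+u. ennreal ((norm (indicator {s<..t} u *\<^sub>R H u w))\<^sup>2) \<partial>lborel \<partial>M)"
  proof -
    have "(\<lambda>x. ennreal ((norm (?g x))\<^sup>2)) \<in> borel_measurable ?Q"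
      using gm by (intro measurable_compose[OF gm, of "\<lambda>y. ennreal ((norm y)\<^sup>2)"]) measurable
    from lborel.nn_integral_fst[OF this] show ?thesis by (simp only: fst_conv snd_conv)
  qed
  also have "\<dots> \<le> (\<integral>\<^sup>+w. (\<integral>\<^sup>+u\<in>{s..t}. ennreal ((Sg u)\<^sup>2) \<partial>lborel) \<partial>M)"
  proof (rule nn_integral_mono, rule nn_integral_mono_AE)
    fix w assume w: "w \<in> space M"
    show "AE u in lborel. ennreal ((norm (indicator {s<..t} u *\<^sub>R H u w))\<^sup>2) \<le> ennreal ((Sg u)\<^sup>2) * indicator {s..t} u"
      using Sg by eventually_elim (use w in \<open>auto simp: indicator_def intro!: ennreal_leI power_mono\<close>)
  qed
  finally show ?thesis by (simp add: emeasure_space_1)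
qed

text \<open>The elementary approximations \<open>I k\<close> of the increment satisfy \<open>E \<langle>\<eta>, I k\<rangle> = 0\<close>. Since variances are
  nonnegative, the square of \<open>E \<langle>\<eta>, Jt - Js\<rangle>\<close> is at most \<open>E \<langle>\<eta>, I k - (Jt - Js)\<rangle>\<^sup>2\<close>, which tends to 0.\<close>

lemma ito_increment_mean_bounded:
  fixes Js Jt :: "'w \<Rightarrow> real^'d"
  assumes st: "0 \<le> s" "s \<le> t"
    and Js: "has_ito_integral M F W H s Js" and Jt: "has_ito_integral M F W H t Jt"
    and fin: "(sqnorm M (\<lambda>w. Jt w - Js w)) < \<infinity>"
    and \<eta>: "\<eta> \<in> borel_measurable (F s)" "\<forall>w\<in>space M. norm (\<eta> w) \<le> B"
  shows "has_bochner_integral M (\<lambda>w. \<eta> w \<bullet> (Jt w - Js w)) 0"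
proof -
  obtain n \<tau> \<xi> where e: "\<And>k. elementary_integrand M F (n k) (\<tau> k) (\<xi> k)"
    and i: "(\<lambda>k. sqnorm M (\<lambda>w. elementary_ito_integral (n k) (\<tau> k) (\<xi> k) W t w
        - elementary_ito_integral (n k) (\<tau> k) (\<xi> k) W s w - (Jt w - Js w))) \<longlonglongrightarrow> 0"
    and Jm[measurable]: "Js \<in> borel_measurable M" "Jt \<in> borel_measurable M"
    by (rule ito_increment_approx[OF st Js Jt]) blast
  define I where "I = (\<lambda>k w. elementary_ito_integral (n k) (\<tau> k) (\<xi> k) W t w
        - elementary_ito_integral (n k) (\<tau> k) (\<xi> k) W s w)"
  define J where "J = (\<lambda>w. Jt w - Js w)"
  have [measurable]: "I k \<in> borel_measurable M" for k
    unfolding I_def by (intro borel_measurable_diff elementary_ito_integral_measurable e) (use st in auto)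
  have [measurable]: "J \<in> borel_measurable M" "\<eta> \<in> borel_measurable M"
    unfolding J_def by (measurable, rule F_measurable_M[OF \<eta>(1) st(1)])
  have I0: "has_bochner_integral M (\<lambda>w. \<eta> w \<bullet> I k w) 0" for k
    unfolding I_def clipped_integrand(3)[OF e st, symmetric]
    by (rule elementary_mean[OF _ st(1) _ \<eta>]) (use clipped_integrand(1,2)[OF e st] in auto)
  have sq: "integrable M (\<lambda>w. (\<eta> w \<bullet> Z w)\<^sup>2) \<and>
      ennreal (expectation (\<lambda>w. (\<eta> w \<bullet> Z w)\<^sup>2)) \<le> ennreal (B\<^sup>2) * (sqnorm M (\<lambda>w. Z w))"
    if Z[measurable]: "Z \<in> borel_measurable M" and f: "(sqnorm M (\<lambda>w. Z w)) < \<infinity>" for Z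
  proof -
    have "(\<integral>\<^sup>+w. ennreal ((\<eta> w \<bullet> Z w)\<^sup>2) \<partial>M) \<le> (\<integral>\<^sup>+w. ennreal (B\<^sup>2) * ennreal ((norm (Z w))\<^sup>2) \<partial>M)"
    proof (intro nn_integral_mono)
      fix w assume w: "w \<in> space M"
      have "\<bar>\<eta> w \<bullet> Z w\<bar> \<le> norm (\<eta> w) * norm (Z w)" by (rule Cauchy_Schwarz_ineq2)
      also have "\<dots> \<le> B * norm (Z w)" using \<eta>(2) w by (intro mult_right_mono) auto
      finally have "\<bar>\<eta> w \<bullet> Z w\<bar>\<^sup>2 \<le> (B * norm (Z w))\<^sup>2" by (intro power_mono) auto
      then show "ennreal ((\<eta> w \<bullet> Z w)\<^sup>2) \<le> ennreal (B\<^sup>2) * ennreal ((norm (Z w))\<^sup>2)"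
        by (simp add: ennreal_mult[symmetric] power_mult_distrib)
    qed
    also have "\<dots> = ennreal (B\<^sup>2) * (sqnorm M (\<lambda>w. Z w))" by (rule nn_integral_cmult) measurable
    finally have le: "(\<integral>\<^sup>+w. ennreal ((\<eta> w \<bullet> Z w)\<^sup>2) \<partial>M) \<le> ennreal (B\<^sup>2) * (sqnorm M (\<lambda>w. Z w))" .
    moreover have "ennreal (B\<^sup>2) * (sqnorm M (\<lambda>w. Z w)) < \<infinity>"
      using f by (simp add: ennreal_mult_less_top)
    ultimately have "integrable M (\<lambda>w. (\<eta> w \<bullet> Z w)\<^sup>2)"
      by (intro integrableI_nonneg) auto
    then show ?thesis using le by (simp add: nn_integral_eq_integral)
  qed
  have sqJ: "integrable M (\<lambda>w. (\<eta> w \<bullet> J w)\<^sup>2)" using sq[of J] fin by (auto simp: J_def)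
  have intJ: "integrable M (\<lambda>w. \<eta> w \<bullet> J w)"
    by (rule square_integrable_imp_integrable[OF _ sqJ]) measurable
  have ev: "\<forall>\<^sub>F k in sequentially. ennreal ((expectation (\<lambda>w. \<eta> w \<bullet> J w))\<^sup>2)
     \<le> ennreal (B\<^sup>2) * (sqnorm M (\<lambda>w. I k w - J w))"
  proof -
    have "\<forall>\<^sub>F k in sequentially. (sqnorm M (\<lambda>w. I k w - J w)) < \<infinity>"
      using order_tendstoD(2)[OF i, of \<infinity>] by (simp add: I_def J_def)
    then show ?thesis
    proof eventually_elim
      case (elim k)
      have s: "integrable M (\<lambda>w. (\<eta> w \<bullet> (I k w - J w))\<^sup>2)"
        "ennreal (expectation (\<lambda>w. (\<eta> w \<bullet> (I k w - J w))\<^sup>2)) \<le> ennreal (B\<^sup>2) * (sqnorm M (\<lambda>w. I k w - J w))"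
        using sq[of "\<lambda>w. I k w - J w"] elim by auto
      have Y: "integrable M (\<lambda>w. \<eta> w \<bullet> (I k w - J w))"
        "expectation (\<lambda>w. \<eta> w \<bullet> (I k w - J w)) = - expectation (\<lambda>w. \<eta> w \<bullet> J w)"
        using intJ I0[of k] by (auto simp: inner_diff_right has_bochner_integral_iff)
      have "0 \<le> expectation (\<lambda>w. (\<eta> w \<bullet> (I k w - J w))\<^sup>2) - (expectation (\<lambda>w. \<eta> w \<bullet> (I k w - J w)))\<^sup>2"
        using variance_positive[of "\<lambda>w. \<eta> w \<bullet> (I k w - J w)"] by (simp only: variance_eq[OF Y(1) s(1)])
      then have "(expectation (\<lambda>w. \<eta> w \<bullet> J w))\<^sup>2 \<le> expectation (\<lambda>w. (\<eta> w \<bullet> (I k w - J w))\<^sup>2)"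
        unfolding Y(2) power2_minus by linarith
      then show ?case using s(2) by (meson ennreal_leI order_trans)
    qed
  qed
  have "(\<lambda>k. ennreal (B\<^sup>2) * (sqnorm M (\<lambda>w. I k w - J w))) \<longlonglongrightarrow> ennreal (B\<^sup>2) * 0"
    by (intro ennreal_tendsto_cmult i[folded I_def J_def]) (use i in \<open>auto simp: I_def J_def\<close>)
  from tendsto_lowerbound[OF this ev] have "ennreal ((expectation (\<lambda>w. \<eta> w \<bullet> J w))\<^sup>2) = 0" by simp
  then have "expectation (\<lambda>w. \<eta> w \<bullet> J w) = 0" by (simp add: ennreal_eq_0_iff)
  with intJ show ?thesis by (simp add: has_bochner_integral_iff J_def)
qed

text \<open>The multiplier is truncated at level \<open>k\<close>. The integrable function \<open>|\<langle>\<eta>, Jt - Js\<rangle>|\<close> dominates the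
  truncated products.\<close>

lemma ito_increment_mean:
  fixes Js Jt :: "'w \<Rightarrow> real^'d"
  assumes st: "0 \<le> s" "s \<le> t"
    and Js: "has_ito_integral M F W H s Js" and Jt: "has_ito_integral M F W H t Jt"
    and fin: "(sqnorm M (\<lambda>w. Jt w - Js w)) < \<infinity>"
    and \<eta>: "\<eta> \<in> borel_measurable (F s)" and int: "integrable M (\<lambda>w. \<eta> w \<bullet> (Jt w - Js w))"
  shows "expectation (\<lambda>w. \<eta> w \<bullet> (Jt w - Js w)) = 0"
proof -
  define e where "e = (\<lambda>k::nat. \<lambda>w. (if norm (\<eta> w) \<le> real k then 1 else 0) *\<^sub>R \<eta> w)"
  have em: "e k \<in> borel_measurable (F s)" for k
    unfolding e_def using \<eta> by measurable
  have eb: "\<forall>w\<in>space M. norm (e k w) \<le> real k" for k by (auto simp: e_def)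
  note b = ito_increment_mean_bounded[OF st Js Jt fin em eb]
  have [measurable]: "Jt \<in> borel_measurable M" "Js \<in> borel_measurable M" "e k \<in> borel_measurable M" for k
    using Js Jt F_measurable_M[OF em st(1)] by (auto simp: has_ito_integral_def)
  have "(\<lambda>k. expectation (\<lambda>w. e k w \<bullet> (Jt w - Js w))) \<longlonglongrightarrow> expectation (\<lambda>w. \<eta> w \<bullet> (Jt w - Js w))"
  proof (rule integral_dominated_convergence[OF _ _ integrable_abs[OF int]])
    show "AE w in M. (\<lambda>k. e k w \<bullet> (Jt w - Js w)) \<longlonglongrightarrow> \<eta> w \<bullet> (Jt w - Js w)"
    proof (rule AE_I2)
      fix w
      obtain k0 :: nat where "norm (\<eta> w) \<le> real k0" using real_arch_simple by blast
      then have "\<forall>\<^sub>F k in sequentially. e k w \<bullet> (Jt w - Js w) = \<eta> w \<bullet> (Jt w - Js w)"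
        by (intro eventually_sequentiallyI[of k0]) (auto simp: e_def)
      then show "(\<lambda>k. e k w \<bullet> (Jt w - Js w)) \<longlonglongrightarrow> \<eta> w \<bullet> (Jt w - Js w)" by (rule tendsto_eventually)
    qed
    show "AE w in M. norm (e k w \<bullet> (Jt w - Js w)) \<le> \<bar>\<eta> w \<bullet> (Jt w - Js w)\<bar>" for k
      by (auto simp: e_def)
  qed (use int in auto)
  moreover have "expectation (\<lambda>w. e k w \<bullet> (Jt w - Js w)) = 0" for k
    using b by (auto simp: has_bochner_integral_iff)
  ultimately show ?thesis by (simp add: LIMSEQ_const_iff)
qed

end

section \<open>A pathwise energy inequality\<close>

text \<open>A division of \<open>[0, a]\<close> and one of \<open>[a, b]\<close> together form a division of \<open>[0, b]\<close>, so the variation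
  \<open>V t\<close> on \<open>[0, t]\<close> has the required growth. Errors of size \<open>V b - V a\<close> on the intervals of a grid
  telescope to the total variation.\<close>

lemma variation_function:
  fixes k :: "real \<Rightarrow> 'a::real_normed_vector"
  assumes bv: "bounded_variation_on 0 T k" and T: "0 \<le> T"
  obtains V where "\<And>a b D. 0 \<le> a \<Longrightarrow> a \<le> b \<Longrightarrow> b \<le> T \<Longrightarrow> D division_of {a..b} \<Longrightarrow>
    (\<Sum>I\<in>D. norm (k (Sup I) - k (Inf I))) \<le> V b - V a"
proof -
  let ?n = "\<lambda>I. norm (k (Sup I) - k (Inf I))"
  define S where "S = (\<lambda>t. {(\<Sum>I\<in>D. ?n I) | D. D division_of {0..t}})"
  define V where "V = (\<lambda>t. Sup (S t))"
  obtain B where B: "\<And>D. D division_of {0..T} \<Longrightarrow> (\<Sum>I\<in>D. ?n I) \<le> B"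
    using bv by (auto simp: bounded_variation_on_def)
  have add: "(D \<union> D') division_of {a..c} \<and> (\<Sum>I\<in>D \<union> D'. ?n I) = (\<Sum>I\<in>D. ?n I) + (\<Sum>I\<in>D'. ?n I)"
    if D: "D division_of {a..b}" and D': "D' division_of {b..c}" and "a \<le> b" "b \<le> c" for a b c D D'
  proof
    have "{a..c} = {a..b} \<union> {b..c}" using that by auto
    then show "(D \<union> D') division_of {a..c}" using division_disjoint_union[OF D D'] by auto
    have "I = {b}" if "I \<in> D \<inter> D'" for I
      using division_ofD(2,3)[OF D, of I] division_ofD(2)[OF D', of I] that by fastforce
    then have "(\<Sum>I\<in>D \<inter> D'. ?n I) = 0" by (intro sum.neutral) fastforce
    then show "(\<Sum>I\<in>D \<union> D'. ?n I) = (\<Sum>I\<in>D. ?n I) + (\<Sum>I\<in>D'. ?n I)"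
      using sum.union_inter[of D D' ?n] division_ofD(1)[OF D] division_ofD(1)[OF D'] by simp
  qed
  have single: "{{a..b}} division_of {a..b}" if "a \<le> b" for a b :: real
    using division_of_self[of a b] that by simp
  have bdd: "bdd_above (S t)" if t: "0 \<le> t" "t \<le> T" for t
  proof (rule bdd_aboveI[of _ B])
    fix s assume "s \<in> S t"
    then obtain D where D: "D division_of {0..t}" "s = (\<Sum>I\<in>D. ?n I)" by (auto simp: S_def)
    have a: "D \<union> {{t..T}} division_of {0..T}"
      "(\<Sum>I\<in>D \<union> {{t..T}}. ?n I) = (\<Sum>I\<in>D. ?n I) + (\<Sum>I\<in>{{t..T}}. ?n I)"
      using add[OF D(1) single[OF t(2)] t] by blast+
    have "0 \<le> (\<Sum>I\<in>{{t..T}}. ?n I)" by (intro sum_nonneg norm_ge_zero)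
    then show "s \<le> B" using B[OF a(1)] a(2) D(2) by linarith
  qed
  have ne: "S t \<noteq> {}" if "0 \<le> t" for t using single[OF that] by (auto simp: S_def)
  show ?thesis
  proof (rule that[of V])
    fix a b D assume ab: "0 \<le> a" "a \<le> b" "b \<le> T" and D: "D division_of {a..b}"
    have "V a \<le> V b - (\<Sum>I\<in>D. ?n I)"
      unfolding V_def
    proof (rule cSup_least[OF ne[OF ab(1)]])
      fix s assume "s \<in> S a"
      then obtain D0 where D0: "D0 division_of {0..a}" "s = (\<Sum>I\<in>D0. ?n I)" by (auto simp: S_def)
      have "s + (\<Sum>I\<in>D. ?n I) \<in> S b"
        using add[OF D0(1) D ab(1,2)] D0(2) unfolding S_def by auto metis
      then have "s + (\<Sum>I\<in>D. ?n I) \<le> Sup (S b)"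
        using bdd[of b] ab by (intro cSup_upper) auto
      then show "s \<le> Sup (S b) - (\<Sum>I\<in>D. ?n I)" by simp
    qed
    then show "(\<Sum>I\<in>D. ?n I) \<le> V b - V a" by simp
  qed
qed

text \<open>On a short interval the integrand is nearly constant, and a tagged sum with a constant
  integrand telescopes.\<close>

lemma rs_integral_approx:
  fixes f k :: "real \<Rightarrow> 'a::real_inner"
  assumes J: "has_rs_integral f k a b J" and ab: "a \<le> b"
    and V: "\<And>D. D division_of {a..b} \<Longrightarrow> (\<Sum>I\<in>D. norm (k (Sup I) - k (Inf I))) \<le> V"
    and c: "\<And>x. x \<in> {a..b} \<Longrightarrow> norm (f x - c) \<le> e"
  shows "\<bar>J - c \<bullet> (k b - k a)\<bar> \<le> e * V"
proof (rule field_le_epsilon)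
  fix r :: real assume "0 < r"
  then obtain d where d: "0 < d" and p': "\<And>p. p tagged_division_of {a..b} \<Longrightarrow> (\<lambda>x. ball x d) fine p \<Longrightarrow>
     \<bar>(\<Sum>(x, I)\<in>p. f x \<bullet> (k (Sup I) - k (Inf I))) - J\<bar> < r"
    using J unfolding has_rs_integral_def by blast
  obtain p where p: "p tagged_division_of {a..b}" "(\<lambda>x. ball x d) fine p"
    using fine_division_exists_real[of "\<lambda>x. ball x d" a b] d by (auto intro: gauge_ball)
  note pf = tagged_division_ofD[OF p(1)]
  have e0: "0 \<le> e" using order_trans[OF norm_ge_zero c[of a]] ab by simp
  define g where "g = (\<lambda>I. if I = {} then 0 else e * norm (k (Sup I) - k (Inf I)))"
  have t: "(\<Sum>(x, I)\<in>p. k (Sup I) - k (Inf I)) = k b - k a"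
    by (rule additive_tagged_division_1[OF ab p(1)])
  have "(\<Sum>(x, I)\<in>p. f x \<bullet> (k (Sup I) - k (Inf I))) - c \<bullet> (k b - k a)
      = (\<Sum>(x, I)\<in>p. (f x - c) \<bullet> (k (Sup I) - k (Inf I)))"
    unfolding t[symmetric] inner_sum_right sum_subtractf[symmetric]
    by (intro sum.cong) (auto simp: inner_diff_left)
  also have "\<bar>\<dots>\<bar> \<le> (\<Sum>(x, I)\<in>p. e * norm (k (Sup I) - k (Inf I)))"
  proof (rule order_trans[OF sum_abs sum_mono], clarify)
    fix x I assume "(x, I) \<in> p"
    then have "x \<in> {a..b}" using pf(2,3) by blast
    have "\<bar>(f x - c) \<bullet> (k (Sup I) - k (Inf I))\<bar> \<le> norm (f x - c) * norm (k (Sup I) - k (Inf I))"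
      by (rule Cauchy_Schwarz_ineq2)
    also have "\<dots> \<le> e * norm (k (Sup I) - k (Inf I))"
      using c[OF \<open>x \<in> {a..b}\<close>] by (intro mult_right_mono) auto
    finally show "\<bar>(f x - c) \<bullet> (k (Sup I) - k (Inf I))\<bar> \<le> e * norm (k (Sup I) - k (Inf I))" .
  qed
  also have "\<dots> = (\<Sum>(x, I)\<in>p. g I)"
  proof (intro sum.cong refl, clarify)
    fix x I assume "(x, I) \<in> p"
    then have "I \<noteq> {}" using pf(2) by blast
    then show "e * norm (k (Sup I) - k (Inf I)) = g I" by (simp add: g_def)
  qed
  also have "\<dots> = (\<Sum>I\<in>snd ` p. g I)"
  proof (rule sum.over_tagged_division_lemma[OF p(1), of g])
    fix u v :: real assume "box u v = {}"
    then have "v \<le> u" by simp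
    then show "g (cbox u v) = 0" by (cases "u = v") (auto simp: g_def)
  qed
  also have "\<dots> \<le> (\<Sum>I\<in>snd ` p. e * norm (k (Sup I) - k (Inf I)))"
    using e0 by (intro sum_mono) (auto simp: g_def)
  also have "\<dots> \<le> e * V"
    unfolding sum_distrib_left[symmetric]
    by (intro mult_left_mono V division_of_tagged_division[OF p(1)] e0)
  finally show "\<bar>J - c \<bullet> (k b - k a)\<bar> \<le> e * V + r" using p'[OF p] by linarith
qed

lemma damping_concave:
  fixes e r r' :: real
  assumes "0 \<le> e" "0 \<le> r" "0 \<le> r'"
  shows "r' / (1 + e * r') - r / (1 + e * r) \<le> (r' - r) / (1 + e * r)\<^sup>2"
proof -
  define a b where "a = 1 + e * r" and "b = 1 + e * r'"
  have p: "0 < a" "0 < b" using assms by (auto intro: add_pos_nonneg simp: a_def b_def)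
  have "r' / b - r / a = (r' - r) / (a * b)"
    using p by (simp add: field_simps) (simp add: a_def b_def algebra_simps)
  moreover have "(r' - r) / a\<^sup>2 - (r' - r) / (a * b) = (r' - r) * (b - a) / (a\<^sup>2 * b)"
    using p by (simp add: field_simps power2_eq_square)
  moreover have "(r' - r) * (b - a) = e * (r' - r)\<^sup>2"
    by (simp add: a_def b_def power2_eq_square algebra_simps)
  moreover have "0 \<le> e * (r' - r)\<^sup>2 / (a\<^sup>2 * b)" using p assms by simp
  ultimately have "r' / b - r / a = (r' - r) / (a * b)" "0 \<le> (r' - r) / a\<^sup>2 - (r' - r) / (a * b)"
    by (simp_all only:)
  then show ?thesis unfolding a_def[symmetric] b_def[symmetric] by linarith
qed

lemma sum_integral_grid:
  fixes g :: "real \<Rightarrow> 'a::euclidean_space"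
  assumes g: "g integrable_on {0..T}" and T: "0 < T" and n: "0 < n"
  shows "(\<Sum>i<n. integral {T * real i / n..T * real (Suc i) / n} g) = integral {0..T} g"
proof -
  have "(\<Sum>i<j. integral {T * real i / n..T * real (Suc i) / n} g) = integral {0..T * real j / n} g" if "j \<le> n" for j
    using that
  proof (induction j)
    case (Suc j)
    have "T * real (Suc j) / n \<le> T"
      using Suc.prems n T by (simp add: divide_le_eq)
    then have "g integrable_on {0..T * real (Suc j) / n}"
      by (intro integrable_on_subinterval[OF g]) auto
    then have "integral {0..T * real j / n} g + integral {T * real j / n..T * real (Suc j) / n} g
       = integral {0..T * real (Suc j) / n} g"
      using T n by (intro Henstock_Kurzweil_Integration.integral_combine) (auto simp: divide_right_mono)
    then show ?case using Suc by simp
  qed simp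
  from this[of n] show ?thesis using n by simp
qed

text \<open>The bounded-variation increments are paired with \<open>v\<close> at the right end point and the increments of
  \<open>m\<close> with \<open>v\<close> at the left end point. The mixed quadratic terms then combine to
  \<open>|dm|\<^sup>2 - |dv - dm|\<^sup>2\<close>, so only \<open>|dm|\<^sup>2\<close> remains and the quadratic variation of the rest never has to be
  estimated. Replacing the sums by integrals costs at most the modulus of continuity of \<open>v\<close>
  and \<open>w\<close>, times constants that depend on the path only.\<close>

lemma damped_energy_inequality:
  fixes v k f :: "real \<Rightarrow> 'a::euclidean_space" and q :: "real \<Rightarrow> real"
  assumes e: "0 \<le> e" and T: "0 < T"
    and v: "continuous_on {0..T} v" and f: "continuous_on {0..T} f"
    and vf: "\<And>s. s \<in> {0..T} \<Longrightarrow> 0 \<le> v s \<bullet> f s"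
    and k: "bounded_variation_on 0 T k"
    and q: "q absolutely_integrable_on {0..T}"
    and J: "\<And>(n::nat) i. i < n \<Longrightarrow> \<exists>J. has_rs_integral (\<lambda>u. - v u) k (T * real i / n) (T * real (Suc i) / n) J \<and>
        J + integral {T * real i / n..T * real (Suc i) / n} q \<le> 0"
    and m: "\<And>s. s \<in> {0..T} \<Longrightarrow> m s = v s - v 0 + integral {0..s} f + (k s - k 0)"
    and d: "0 < d"
  defines "w \<equiv> \<lambda>u. 1 / (1 + e * (norm (v u))\<^sup>2)\<^sup>2"
  shows "\<forall>\<^sub>F n in sequentially.
    (norm (v T))\<^sup>2 / (1 + e * (norm (v T))\<^sup>2) + 2 * integral {0..T} (\<lambda>u. w u * q u)
    \<le> (norm (v 0))\<^sup>2 / (1 + e * (norm (v 0))\<^sup>2)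
      + (\<Sum>i<n. w (T * real i / n) * (2 * (v (T * real i / n) \<bullet> (m (T * real (Suc i) / n) - m (T * real i / n)))
          + (norm (m (T * real (Suc i) / n) - m (T * real i / n)))\<^sup>2)) + d"
proof -
  define h where "h = (\<lambda>u. (norm (v u))\<^sup>2 / (1 + e * (norm (v u))\<^sup>2))"
  have wpos: "0 < 1 + e * (norm (v u))\<^sup>2" "1 \<le> 1 + e * (norm (v u))\<^sup>2" for u
    using e by (auto intro: add_pos_nonneg)
  have w01: "0 \<le> w u" "w u \<le> 1" for u
    using wpos[of u] by (auto simp: w_def divide_le_eq one_le_power)
  have wc: "continuous_on {0..T} w"
    unfolding w_def using wpos(1) by (intro continuous_intros v) (simp add: less_imp_neq[symmetric])
  obtain V where V: "\<And>a b D. 0 \<le> a \<Longrightarrow> a \<le> b \<Longrightarrow> b \<le> T \<Longrightarrow> D division_of {a..b} \<Longrightarrow>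
    (\<Sum>I\<in>D. norm (k (Sup I) - k (Inf I))) \<le> V b - V a"
    using variation_function[OF k] T by auto
  have V0: "V a \<le> V b" if "0 \<le> a" "a \<le> b" "b \<le> T" for a b
  proof -
    have "{{a..b}} division_of {a..b}" using division_of_self[of a b] that by simp
    from V[OF that this] have "norm (k b - k a) \<le> V b - V a" using that by simp
    then show ?thesis using norm_ge_zero[of "k b - k a"] by linarith
  qed
  have "compact (f ` {0..T})" by (intro compact_continuous_image f compact_Icc)
  then obtain Fm where Fm: "\<And>s. s \<in> {0..T} \<Longrightarrow> norm (f s) \<le> Fm"
    using compact_imp_bounded bounded_iff by (metis imageI)
  have Fm0: "0 \<le> Fm" using order_trans[OF norm_ge_zero Fm[of 0]] T by simp
  define Q where "Q = integral {0..T} (\<lambda>u. \<bar>q u\<bar>)"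
  have qi: "q integrable_on {0..T}" "(\<lambda>u. \<bar>q u\<bar>) integrable_on {0..T}"
    using q by (auto simp: absolutely_integrable_on_def)
  have wq: "(\<lambda>u. w u * q u) integrable_on {0..T}"
  proof -
    have "w \<in> borel_measurable (lebesgue_on {0..T})"
      by (rule continuous_imp_measurable_on_sets_lebesgue[OF wc]) simp
    moreover have "bounded (w ` {0..T})"
      by (intro compact_imp_bounded compact_continuous_image wc compact_Icc)
    ultimately have "(\<lambda>u. w u * q u) absolutely_integrable_on {0..T}"
      by (intro absolutely_integrable_bounded_measurable_product_real q) auto
    then show ?thesis by (auto simp: absolutely_integrable_on_def)
  qed
  have Q0: "0 \<le> Q" unfolding Q_def by (intro integral_nonneg qi) auto
  \<comment> \<open>All errors on the grid are proportional to these three masses: drift, variation of \<open>k\<close>, and \<open>|q|\<close>.\<close>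
  define C where "C = Fm * T + (V T - V 0) + Q"
  have C0: "0 \<le> C" unfolding C_def using Fm0 T V0[of 0 T] Q0 by auto
  define \<epsilon> where "\<epsilon> = d / (2 * (C + 1))"
  have \<epsilon>: "0 < \<epsilon>" "2 * \<epsilon> * C \<le> d"
    using C0 d by (auto simp: \<epsilon>_def field_simps)
  have "uniformly_continuous_on {0..T} v" "uniformly_continuous_on {0..T} w"
    by (intro compact_uniformly_continuous v wc compact_Icc)+
  then obtain \<delta>1 \<delta>2 where \<delta>: "\<delta>1 > 0" "\<And>x x'. x \<in> {0..T} \<Longrightarrow> x' \<in> {0..T} \<Longrightarrow> dist x' x < \<delta>1 \<Longrightarrow> dist (v x') (v x) < \<epsilon>"
    "\<delta>2 > 0" "\<And>x x'. x \<in> {0..T} \<Longrightarrow> x' \<in> {0..T} \<Longrightarrow> dist x' x < \<delta>2 \<Longrightarrow> dist (w x') (w x) < \<epsilon>"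
    using \<epsilon>(1) by (metis uniformly_continuous_onE)
  have "(\<lambda>n. T / real n) \<longlonglongrightarrow> 0" by (rule lim_const_over_n)
  then have "\<forall>\<^sub>F n in sequentially. T / real n < min \<delta>1 \<delta>2"
    using \<delta>(1,3) order_tendstoD(2) by (metis min_less_iff_conj)
  then show ?thesis using eventually_gt_at_top[of 0]
  proof eventually_elim
    case (elim n)
    define t where "t = (\<lambda>i. T * real i / n)"
    have t0: "t 0 = 0" "t n = T" using elim by (auto simp: t_def)
    have grid: "(\<Sum>i<n. integral {t i..t (Suc i)} g) = integral {0..T} g" if "g integrable_on {0..T}" for g :: "real \<Rightarrow> real"
      unfolding t_def by (rule sum_integral_grid[OF that T elim(2)])
    have step: "h (t (Suc i)) - h (t i) + 2 * integral {t i..t (Suc i)} (\<lambda>u. w u * q u)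
      \<le> w (t i) * (2 * (v (t i) \<bullet> (m (t (Suc i)) - m (t i))) + (norm (m (t (Suc i)) - m (t i)))\<^sup>2)
        + 2 * \<epsilon> * (Fm * (t (Suc i) - t i) + (V (t (Suc i)) - V (t i)) + integral {t i..t (Suc i)} (\<lambda>u. \<bar>q u\<bar>))"
      if i: "i < n" for i
    proof -
      define a b where "a = t i" and "b = t (Suc i)"
      have len: "b - a = T / n" by (simp add: a_def b_def t_def distrib_left add_divide_distrib)
      have "T * real (Suc i) \<le> T * real n" using i T by (intro mult_left_mono) auto
      then have ab: "0 \<le> a" "a \<le> b" "b \<le> T"
        using T elim by (auto simp: a_def b_def t_def divide_le_eq field_simps)
      have I: "a \<in> {0..T}" "b \<in> {0..T}" "\<And>s. s \<in> {a..b} \<Longrightarrow> s \<in> {0..T}" using ab by auto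
      have near: "norm (v s - v b) \<le> \<epsilon>" "\<bar>w s - w a\<bar> \<le> \<epsilon>" if "s \<in> {a..b}" for s
        using \<delta>(2)[OF I(2) I(3)[OF that]] \<delta>(4)[OF I(1) I(3)[OF that]] that len elim
        by (auto simp: dist_norm)
      obtain Ji where Ji: "has_rs_integral (\<lambda>u. - v u) k a b Ji" "Ji + integral {a..b} q \<le> 0"
        using J[OF i] by (auto simp: a_def b_def t_def)
      have "\<bar>Ji - (- v b) \<bullet> (k b - k a)\<bar> \<le> \<epsilon> * (V b - V a)"
        by (rule rs_integral_approx[OF Ji(1) ab(2) V[OF ab]]) (use near in \<open>auto simp: norm_minus_commute\<close>)
      then have K: "- (v b \<bullet> (k b - k a)) \<le> - integral {a..b} q + \<epsilon> * (V b - V a)"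
        using Ji(2) by simp
      have fi: "f integrable_on {a..b}"
        by (rule integrable_on_subinterval[OF integrable_continuous_interval[OF f]]) (use ab in auto)
      have f0: "f integrable_on {0..b}"
        by (rule integrable_on_subinterval[OF integrable_continuous_interval[OF f]]) (use ab in auto)
      have "integral {a..b} (\<lambda>s. - \<epsilon> * Fm) \<le> integral {a..b} (\<lambda>s. v b \<bullet> f s)"
      proof (rule integral_le)
        show "(\<lambda>s. v b \<bullet> f s) integrable_on {a..b}"
          using fi by (rule integrable_linear[OF _ bounded_linear_inner_right, unfolded o_def])
        fix s assume s: "s \<in> {a..b}"
        have "\<bar>(v b - v s) \<bullet> f s\<bar> \<le> norm (v b - v s) * norm (f s)" by (rule Cauchy_Schwarz_ineq2)
        also have "\<dots> \<le> \<epsilon> * Fm" using near(1)[OF s] Fm[OF I(3)[OF s]] \<epsilon>(1)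
          by (intro mult_mono) (auto simp: norm_minus_commute)
        finally show "- \<epsilon> * Fm \<le> v b \<bullet> f s"
          using vf[OF I(3)[OF s]] by (simp add: inner_diff_left)
      qed auto
      moreover have "integral {a..b} (\<lambda>s. v b \<bullet> f s) = v b \<bullet> integral {a..b} f"
        using integral_linear[OF fi bounded_linear_inner_right[of "v b"]] by (simp add: o_def)
      ultimately have D: "- (v b \<bullet> integral {a..b} f) \<le> \<epsilon> * (Fm * (b - a))"
        using ab by (simp add: algebra_simps)
      have comb: "integral {0..b} f = integral {0..a} f + integral {a..b} f"
        using ab f0 by (simp add: Henstock_Kurzweil_Integration.integral_combine)
      define \<Delta> where "\<Delta> = m b - m a"
      have dv: "v b = v a + \<Delta> - integral {a..b} f - (k b - k a)"
        unfolding \<Delta>_def m[OF I(1)] m[OF I(2)] comb by (simp add: algebra_simps)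
      have "(norm (v b))\<^sup>2 - (norm (v a))\<^sup>2 \<le> 2 * (v b \<bullet> (v b - v a - \<Delta>)) + 2 * (v a \<bullet> \<Delta>) + (norm \<Delta>)\<^sup>2"
      proof -
        have "0 \<le> (norm (v b - v a - \<Delta>))\<^sup>2" by simp
        then show ?thesis unfolding power2_norm_eq_inner
          by (simp add: inner_diff_left inner_diff_right inner_commute algebra_simps)
      qed
      also have "v b \<bullet> (v b - v a - \<Delta>) = - (v b \<bullet> integral {a..b} f) - v b \<bullet> (k b - k a)"
      proof -
        have "v b - v a - \<Delta> = - integral {a..b} f - (k b - k a)" using dv by (simp add: algebra_simps)
        then show ?thesis by (simp only: inner_diff_right inner_minus_right)
      qed
      finally have en0: "(norm (v b))\<^sup>2 - (norm (v a))\<^sup>2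
          \<le> 2 * (- (v b \<bullet> integral {a..b} f) - v b \<bullet> (k b - k a)) + 2 * (v a \<bullet> \<Delta>) + (norm \<Delta>)\<^sup>2" .
      have arith: "x \<le> 2 * A + 2 * B + c1 + c2" if "x \<le> 2 * (- p1 - p2) + c1 + c2" "- p2 \<le> B" "- p1 \<le> A"
        for x p1 p2 A B c1 c2 :: real using that by (simp add: algebra_simps)
      have en: "(norm (v b))\<^sup>2 - (norm (v a))\<^sup>2 \<le>
          2 * (\<epsilon> * (Fm * (b - a))) + 2 * (- integral {a..b} q + \<epsilon> * (V b - V a)) + 2 * (v a \<bullet> \<Delta>) + (norm \<Delta>)\<^sup>2"
        by (rule arith[OF en0 K D])
      have "integral {a..b} (\<lambda>u. w u * q u) \<le> integral {a..b} (\<lambda>u. w a * q u + \<epsilon> * \<bar>q u\<bar>)"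
      proof (rule integral_le)
        show "(\<lambda>u. w u * q u) integrable_on {a..b}"
          by (rule integrable_on_subinterval[OF wq]) (use ab in auto)
        show "(\<lambda>u. w a * q u + \<epsilon> * \<bar>q u\<bar>) integrable_on {a..b}"
          by (intro integrable_add integrable_on_mult_right integrable_on_subinterval[OF qi(1)] integrable_on_subinterval[OF qi(2)])
             (use ab in auto)
        fix u assume u: "u \<in> {a..b}"
        have "(w u - w a) * q u \<le> \<bar>w u - w a\<bar> * \<bar>q u\<bar>" unfolding abs_mult[symmetric] by (rule abs_ge_self)
        also have "\<dots> \<le> \<epsilon> * \<bar>q u\<bar>" using near(2)[OF u] by (intro mult_right_mono) auto
        finally show "w u * q u \<le> w a * q u + \<epsilon> * \<bar>q u\<bar>" by (simp add: algebra_simps)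
      qed
      also have "\<dots> = w a * integral {a..b} q + \<epsilon> * integral {a..b} (\<lambda>u. \<bar>q u\<bar>)"
        by (subst integral_add)
           (use ab in \<open>auto intro!: integrable_on_mult_right integrable_on_subinterval[OF qi(1)] integrable_on_subinterval[OF qi(2)]\<close>)
      finally have wqi: "integral {a..b} (\<lambda>u. w u * q u) \<le> w a * integral {a..b} q + \<epsilon> * integral {a..b} (\<lambda>u. \<bar>q u\<bar>)" .
      have "h b - h a \<le> ((norm (v b))\<^sup>2 - (norm (v a))\<^sup>2) * w a"
        using damping_concave[OF e, of "(norm (v a))\<^sup>2" "(norm (v b))\<^sup>2"] by (simp add: h_def w_def)
      also have "\<dots> \<le> (2 * (\<epsilon> * (Fm * (b - a))) + 2 * (- integral {a..b} q + \<epsilon> * (V b - V a)) + 2 * (v a \<bullet> \<Delta>) + (norm \<Delta>)\<^sup>2) * w a"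
        by (rule mult_right_mono[OF en w01(1)])
      also have "\<dots> = w a * (2 * (v a \<bullet> \<Delta>) + (norm \<Delta>)\<^sup>2) - 2 * (w a * integral {a..b} q)
          + w a * (2 * \<epsilon> * (Fm * (b - a) + (V b - V a)))"
        by (simp add: algebra_simps)
      also have "w a * (2 * \<epsilon> * (Fm * (b - a) + (V b - V a))) \<le> 1 * (2 * \<epsilon> * (Fm * (b - a) + (V b - V a)))"
        using \<epsilon>(1) Fm0 ab V0[OF ab] by (intro mult_right_mono w01(2)) auto
      finally show ?thesis using wqi unfolding a_def[symmetric] b_def[symmetric] \<Delta>_def[symmetric]
        by (simp add: algebra_simps)
    qed
    have "(\<Sum>i<n. h (t (Suc i)) - h (t i) + 2 * integral {t i..t (Suc i)} (\<lambda>u. w u * q u))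
      \<le> (\<Sum>i<n. w (t i) * (2 * (v (t i) \<bullet> (m (t (Suc i)) - m (t i))) + (norm (m (t (Suc i)) - m (t i)))\<^sup>2)
        + 2 * \<epsilon> * (Fm * (t (Suc i) - t i) + (V (t (Suc i)) - V (t i)) + integral {t i..t (Suc i)} (\<lambda>u. \<bar>q u\<bar>)))"
      by (intro sum_mono step) auto
    moreover have "(\<Sum>i<n. h (t (Suc i)) - h (t i) + 2 * integral {t i..t (Suc i)} (\<lambda>u. w u * q u))
      = h T - h 0 + 2 * integral {0..T} (\<lambda>u. w u * q u)"
      by (simp only: sum.distrib sum_distrib_left[symmetric] grid[OF wq] sum_lessThan_telescope[of "\<lambda>i. h (t i)"] t0)
    moreover have "(\<Sum>i<n. 2 * \<epsilon> * (Fm * (t (Suc i) - t i) + (V (t (Suc i)) - V (t i)) + integral {t i..t (Suc i)} (\<lambda>u. \<bar>q u\<bar>)))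
      = 2 * \<epsilon> * C"
      by (simp only: sum.distrib sum_distrib_left[symmetric] grid[OF qi(2)] sum_lessThan_telescope[of t]
          sum_lessThan_telescope[of "\<lambda>i. V (t i)"] t0 C_def Q_def) simp
    ultimately show ?case
      using \<epsilon>(2) by (simp add: sum.distrib h_def t_def)
  qed
qed

section \<open>Passing to expectations\<close>

text \<open>Fatou's lemma needs a lower bound for the terms \<open>N n\<close>, so they are truncated from below at \<open>- R\<close>.
  The truncation changes their expectation by at most \<open>E (N n)\<^sup>2 / R \<le> b / R\<close>, and \<open>R\<close> is arbitrary.\<close>

lemma (in prob_space) expectation_le_of_pathwise_limit:
  fixes P Y :: "'a \<Rightarrow> real" and N Q :: "nat \<Rightarrow> 'a \<Rightarrow> real"
  assumes P: "P \<in> borel_measurable M" "\<And>w. 0 \<le> P w" and Y: "integrable M Y"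
    and N: "\<And>n. integrable M (N n)" "\<And>n. expectation (N n) = 0"
      "\<And>n. integrable M (\<lambda>w. (N n w)\<^sup>2)" "\<And>n. expectation (\<lambda>w. (N n w)\<^sup>2) \<le> b"
    and Q: "\<And>n w. 0 \<le> Q n w" "\<And>n. integrable M (Q n)" "\<And>n. expectation (Q n) \<le> c"
    and lim: "AE w in M. \<forall>d>0. \<forall>\<^sub>F n in sequentially. P w + Y w \<le> N n w + Q n w + d"
  shows "integrable M P" "expectation P + expectation Y \<le> c"
proof -
  let ?Yp = "\<lambda>w. max 0 (Y w)" and ?Ym = "\<lambda>w. max 0 (- Y w)"
  have [measurable]: "P \<in> borel_measurable M" "Y \<in> borel_measurable M" "N n \<in> borel_measurable M" "Q n \<in> borel_measurable M" for n
    using P(1) Y N(1) Q(2) by auto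
  have Yi: "integrable M ?Yp" "integrable M ?Ym" using Y by auto
  have Yd: "expectation Y = expectation ?Yp - expectation ?Ym"
    unfolding Bochner_Integration.integral_diff[OF Yi, symmetric] by (intro Bochner_Integration.integral_cong) auto
  have Ym0: "0 \<le> expectation ?Ym" by (intro integral_nonneg_AE) auto
  have b0: "0 \<le> b" using order_trans[OF _ N(4)[of 0]] by (auto intro!: integral_nonneg_AE)
  have c0: "0 \<le> c" using order_trans[OF _ Q(3)[of 0]] Q(1) by (auto intro!: integral_nonneg_AE)
  have main: "integrable M P \<and> expectation P + expectation Y \<le> c + b / R + d"
    if R: "0 < R" and d: "0 < d" for R d
  proof -
    let ?g = "\<lambda>n w. max (N n w) (- R) + R + Q n w + ?Ym w + d"
    let ?B = "b / R + R + c + expectation ?Ym + d"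
    have B0: "0 \<le> ?B" using R d b0 c0 Ym0 by auto
    have gi: "(\<integral>\<^sup>+w. ennreal (?g n w) \<partial>M) \<le> ennreal ?B" for n
    proof -
      have mi: "integrable M (\<lambda>w. max (N n w) (- R))" using N(1) by auto
      have "expectation (\<lambda>w. max (N n w) (- R)) - expectation (N n) = expectation (\<lambda>w. max (N n w) (- R) - N n w)"
        using mi N(1) by simp
      also have "\<dots> \<le> expectation (\<lambda>w. (N n w)\<^sup>2 / R)"
      proof (rule integral_mono)
        fix w
        show "max (N n w) (- R) - N n w \<le> (N n w)\<^sup>2 / R"
        proof (cases "N n w \<le> - R")
          case True
          have "R * - N n w \<le> (- N n w) * (- N n w)" using True R by (intro mult_right_mono) auto
          then have "- N n w \<le> (N n w)\<^sup>2 / R" using R by (simp add: field_simps power2_eq_square)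
          then show ?thesis using True R by simp
        qed (use R in auto)
      qed (use mi N in auto)
      also have "\<dots> \<le> b / R" using N(4)[of n] R by (simp add: divide_right_mono)
      finally have mE: "expectation (\<lambda>w. max (N n w) (- R)) \<le> b / R" using N(2) by simp
      have int: "integrable M (?g n)" using mi Q(2) Yi by auto
      have "expectation (?g n) = expectation (\<lambda>w. max (N n w) (- R)) + R + expectation (Q n) + expectation ?Ym + d"
        using mi Q(2) Yi by (simp add: prob_space)
      then have "expectation (?g n) \<le> ?B" using mE Q(3)[of n] by linarith
      moreover have "0 \<le> ?g n w" for w using Q(1)[of n w] d by (smt (verit) max.cobounded1 max.cobounded2)
      ultimately show ?thesis using int by (subst nn_integral_eq_integral) (auto intro!: ennreal_leI)
    qed
    have "(\<integral>\<^sup>+w. ennreal (P w + ?Yp w + R) \<partial>M) \<le> (\<integral>\<^sup>+w. liminf (\<lambda>n. ennreal (?g n w)) \<partial>M)"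
    proof (rule nn_integral_mono_AE)
      show "AE w in M. ennreal (P w + ?Yp w + R) \<le> liminf (\<lambda>n. ennreal (?g n w))"
        using lim
      proof eventually_elim
        case (elim w)
        then have "\<forall>\<^sub>F n in sequentially. P w + Y w \<le> N n w + Q n w + d" using d by blast
        then have "\<forall>\<^sub>F n in sequentially. ennreal (P w + ?Yp w + R) \<le> ennreal (?g n w)"
        proof eventually_elim
          case (elim n)
          then have "P w + ?Yp w + R \<le> ?g n w" by (auto simp: max_def)
          then show ?case by (rule ennreal_leI)
        qed
        then show ?case by (rule Liminf_bounded)
      qed
    qed
    also have "\<dots> \<le> liminf (\<lambda>n. \<integral>\<^sup>+w. ennreal (?g n w) \<partial>M)" by (rule nn_integral_liminf) measurable
    also have "\<dots> \<le> limsup (\<lambda>n. \<integral>\<^sup>+w. ennreal (?g n w) \<partial>M)" by (rule Liminf_le_Limsup) simp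
    also have "\<dots> \<le> ennreal ?B" by (rule Limsup_bounded) (use gi in auto)
    finally have le: "(\<integral>\<^sup>+w. ennreal (P w + ?Yp w + R) \<partial>M) \<le> ennreal ?B" .
    have nn: "0 \<le> P w + ?Yp w + R" for w using P(2)[of w] R by auto
    have "(\<integral>\<^sup>+w. ennreal (P w + ?Yp w + R) \<partial>M) < \<infinity>" using le by (rule le_less_trans) simp
    then have i: "integrable M (\<lambda>w. P w + ?Yp w + R)"
      using nn by (intro integrableI_nonneg) auto
    have "integrable M (\<lambda>w. (P w + ?Yp w + R) - ?Yp w - R)" using i Yi by (intro Bochner_Integration.integrable_diff) auto
    then have Pi: "integrable M P" by simp
    have "expectation (\<lambda>w. P w + ?Yp w + R) \<le> ?B"
      using le nn i B0 by (simp add: nn_integral_eq_integral)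
    then show ?thesis using Pi Yi Yd by (simp add: prob_space)
  qed
  show "integrable M P" using main[of 1 1] by simp
  have "expectation P + expectation Y \<le> c + b / real (Suc n) + 1 / real (Suc n)" for n
    using main[of "real (Suc n)" "1 / real (Suc n)"] by simp
  moreover have "(\<lambda>n. c + b / real (Suc n) + 1 / real (Suc n)) \<longlonglongrightarrow> c + 0 + 0"
    by (intro tendsto_intros LIMSEQ_Suc[OF lim_const_over_n])
  ultimately show "expectation P + expectation Y \<le> c" using LIMSEQ_le_const by fastforce
qed

text \<open>At each fixed time \<open>m\<close> is a version of the Ito integral of \<open>H\<close>. Adaptedness is required of \<open>m\<close>
  itself, because its past increments occur as multipliers of later ones, while the integral is
  determined only up to null sets.\<close>

locale ito_process = brownian_filtration M F W
  for M :: "'w measure" and F and W :: "real \<Rightarrow> 'w \<Rightarrow> real ^ 'm" +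
  fixes H :: "real \<Rightarrow> 'w \<Rightarrow> real ^ 'm ^ 'd" and m :: "real \<Rightarrow> 'w \<Rightarrow> real ^ 'd"
    and Sg :: "real \<Rightarrow> real" and T :: real
  assumes m_adapted: "\<And>t. t \<in> {0..T} \<Longrightarrow> m t \<in> borel_measurable (F t)"
    and m_ito: "\<And>t. t \<in> {0..T} \<Longrightarrow> \<exists>J. has_ito_integral M F W H t J \<and> (AE w in M. m t w = J w)"
    and H_le: "AE u in lborel. u \<in> {0..T} \<longrightarrow> (\<forall>w\<in>space M. norm (H u w) \<le> Sg u)"
    and Sg_int: "(\<lambda>u. (Sg u)\<^sup>2) absolutely_integrable_on {0..T}"
begin

definition energy :: "real \<Rightarrow> real \<Rightarrow> real" where
  "energy s t = integral {s..t} (\<lambda>u. (Sg u)\<^sup>2)"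

lemma Sg_integrable_on: "0 \<le> s \<Longrightarrow> t \<le> T \<Longrightarrow> (\<lambda>u. (Sg u)\<^sup>2) integrable_on {s..t}"
  using Sg_int by (auto intro!: integrable_on_subinterval[of _ "{0..T}"] simp: absolutely_integrable_on_def)

lemma energy_add: "0 \<le> s \<Longrightarrow> s \<le> t \<Longrightarrow> t \<le> u \<Longrightarrow> u \<le> T \<Longrightarrow> energy s t + energy t u = energy s u"
  unfolding energy_def by (intro Henstock_Kurzweil_Integration.integral_combine Sg_integrable_on) auto

lemma energy_nonneg: "0 \<le> energy s t"
  unfolding energy_def
  by (cases "(\<lambda>u. (Sg u)\<^sup>2) integrable_on {s..t}") (auto intro: integral_nonneg simp: not_integrable_integral)

lemma increment_energy:
  assumes st: "0 \<le> s" "s \<le> t" "t \<le> T"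
  shows "integrable M (\<lambda>w. (norm (m t w - m s w))\<^sup>2)"
    "expectation (\<lambda>w. (norm (m t w - m s w))\<^sup>2) \<le> energy s t"
proof -
  have [measurable]: "m t \<in> borel_measurable M" "m s \<in> borel_measurable M"
    using F_measurable_M[OF m_adapted] st by auto
  obtain Js Jt where J: "has_ito_integral M F W H s Js" "AE w in M. m s w = Js w"
    "has_ito_integral M F W H t Jt" "AE w in M. m t w = Jt w"
    using m_ito[of s] m_ito[of t] st by auto
  have "(sqnorm M (\<lambda>w. m t w - m s w)) = (sqnorm M (\<lambda>w. Jt w - Js w))"
    by (rule nn_integral_cong_AE) (use J(2,4) in eventually_elim, auto)
  also have "\<dots> \<le> (\<integral>\<^sup>+u\<in>{s..t}. ennreal ((Sg u)\<^sup>2) \<partial>lborel)"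
    by (rule ito_increment_L2_le[OF st(1,2) J(1,3)]) (use H_le in eventually_elim, use st in auto)
  also have "\<dots> = ennreal (energy s t)"
  proof -
    have "(\<integral>\<^sup>+u. ennreal (indicator {s..t} u * (Sg u)\<^sup>2) \<partial>lborel) = ennreal (energy s t)"
      unfolding energy_def
      by (rule nn_integral_has_integral_lebesgue[OF _ integrable_integral[OF Sg_integrable_on[OF st(1,3)]]]) simp
    moreover have "ennreal ((Sg u)\<^sup>2) * indicator {s..t} u = ennreal (indicator {s..t} u * (Sg u)\<^sup>2)" for u
      by (cases "u \<in> {s..t}") auto
    ultimately show ?thesis by (simp only:)
  qed
  finally have le: "(sqnorm M (\<lambda>w. m t w - m s w)) \<le> ennreal (energy s t)" .
  then have "(sqnorm M (\<lambda>w. m t w - m s w)) < \<infinity>" by (rule le_less_trans) simp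
  then show i: "integrable M (\<lambda>w. (norm (m t w - m s w))\<^sup>2)" by (intro integrableI_nonneg) auto
  show "expectation (\<lambda>w. (norm (m t w - m s w))\<^sup>2) \<le> energy s t"
    using le i energy_nonneg by (simp add: nn_integral_eq_integral)
qed

lemma increment_mean:
  assumes st: "0 \<le> s" "s \<le> t" "t \<le> T"
    and \<eta>: "\<eta> \<in> borel_measurable (F s)" and int: "integrable M (\<lambda>w. \<eta> w \<bullet> (m t w - m s w))"
  shows "expectation (\<lambda>w. \<eta> w \<bullet> (m t w - m s w)) = 0"
proof -
  obtain Js Jt where J: "has_ito_integral M F W H s Js" "AE w in M. m s w = Js w"
    "has_ito_integral M F W H t Jt" "AE w in M. m t w = Jt w"
    using m_ito[of s] m_ito[of t] st by auto
  have [measurable]: "m t \<in> borel_measurable M" "m s \<in> borel_measurable M" "Jt \<in> borel_measurable M"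
    "Js \<in> borel_measurable M" "\<eta> \<in> borel_measurable M"
    using F_measurable_M[OF m_adapted] F_measurable_M[OF \<eta>] st J(1,3) by (auto simp: has_ito_integral_def)
  have ae: "AE w in M. \<eta> w \<bullet> (m t w - m s w) = \<eta> w \<bullet> (Jt w - Js w)"
    using J(2,4) by eventually_elim auto
  have "(sqnorm M (\<lambda>w. Jt w - Js w)) = (sqnorm M (\<lambda>w. m t w - m s w))"
    by (rule nn_integral_cong_AE) (use J(2,4) in eventually_elim, auto)
  also have "\<dots> < \<infinity>" using increment_energy(1)[OF st] by (simp add: nn_integral_eq_integral)
  finally have "expectation (\<lambda>w. \<eta> w \<bullet> (Jt w - Js w)) = 0"
    by (rule ito_increment_mean[OF st(1,2) J(1,3) _ \<eta>])
       (use int in \<open>subst (asm) integrable_cong_AE[OF _ _ ae]; measurable\<close>)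
  then show ?thesis by (subst integral_cong_AE[OF _ _ ae]) auto
qed

text \<open>The square of the sum is expanded one increment at a time: the new increment is
  orthogonal to the preceding partial sum times its own multiplier.\<close>

lemma square_transform:
  assumes t: "\<And>i. i < n \<Longrightarrow> t i \<le> t (Suc i)" "0 \<le> t 0" "t n \<le> T"
    and \<eta>: "\<And>i. i < n \<Longrightarrow> \<eta> i \<in> borel_measurable (F (t i))" "\<And>i w. i < n \<Longrightarrow> norm (\<eta> i w) \<le> B"
  defines "N \<equiv> \<lambda>w. \<Sum>i<n. \<eta> i w \<bullet> (m (t (Suc i)) w - m (t i) w)"
  shows "integrable M N" "expectation N = 0" "integrable M (\<lambda>w. (N w)\<^sup>2)"
    "expectation (\<lambda>w. (N w)\<^sup>2) \<le> B\<^sup>2 * energy (t 0) (t n)"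
proof -
  have "0 \<le> t n \<and> t 0 \<le> t n \<and> N \<in> borel_measurable (F (t n)) \<and> integrable M N \<and> expectation N = 0 \<and> integrable M (\<lambda>w. (N w)\<^sup>2) \<and>
    expectation (\<lambda>w. (N w)\<^sup>2) \<le> B\<^sup>2 * energy (t 0) (t n)"
    using t \<eta> unfolding N_def
  proof (induction n)
    case 0
    then show ?case by (simp add: energy_def)
  next
    case (Suc n)
    let ?N = "\<lambda>w. \<Sum>i<n. \<eta> i w \<bullet> (m (t (Suc i)) w - m (t i) w)"
    let ?D = "\<lambda>w. m (t (Suc n)) w - m (t n) w"
    let ?E = "\<lambda>w. \<eta> n w \<bullet> ?D w"
    have tn: "t n \<le> t (Suc n)" "t (Suc n) \<le> T" "t n \<le> T" using Suc.prems(1)[of n] Suc.prems(3) by auto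
    have IH: "0 \<le> t n" "t 0 \<le> t n" "?N \<in> borel_measurable (F (t n))" "integrable M ?N" "expectation ?N = 0" "integrable M (\<lambda>w. (?N w)\<^sup>2)"
      "expectation (\<lambda>w. (?N w)\<^sup>2) \<le> B\<^sup>2 * energy (t 0) (t n)"
      using Suc.IH Suc.prems tn(3) by auto
    have \<eta>n: "\<eta> n \<in> borel_measurable (F (t n))" "\<And>w. norm (\<eta> n w) \<le> B" using Suc.prems by auto
    have Nm[measurable]: "?N \<in> borel_measurable M" by (rule F_measurable_M[OF IH(3,1)])
    have [measurable]: "\<eta> n \<in> borel_measurable M" by (rule F_measurable_M[OF \<eta>n(1) IH(1)])
    have mF: "m (t n) \<in> borel_measurable (F (t n))" "m (t (Suc n)) \<in> borel_measurable (F (t (Suc n)))"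
      using IH(1) tn by (auto intro!: m_adapted)
    have mM[measurable]: "m (t n) \<in> borel_measurable M" "m (t (Suc n)) \<in> borel_measurable M"
      using F_measurable_M[OF mF(1)] F_measurable_M[OF mF(2)] IH(1) tn by auto
    note D = increment_energy[OF IH(1) tn(1,2)]
    have E2: "(?E w)\<^sup>2 \<le> B\<^sup>2 * (norm (?D w))\<^sup>2" for w
    proof -
      have "\<bar>?E w\<bar> \<le> norm (\<eta> n w) * norm (?D w)" by (rule Cauchy_Schwarz_ineq2)
      also have "\<dots> \<le> B * norm (?D w)" by (intro mult_right_mono \<eta>n(2)) auto
      finally have "\<bar>?E w\<bar>\<^sup>2 \<le> (B * norm (?D w))\<^sup>2" by (intro power_mono) auto
      then show ?thesis by (simp add: power_mult_distrib)
    qed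
    have Ei2: "integrable M (\<lambda>w. (?E w)\<^sup>2)"
      by (rule Bochner_Integration.integrable_bound[OF integrable_mult_right[OF D(1), of "B\<^sup>2"]])
         (use E2 in \<open>auto intro!: AE_I2 simp: abs_mult\<close>)
    have Ei: "integrable M ?E" by (rule square_integrable_imp_integrable[OF _ Ei2]) measurable
    have E0: "expectation ?E = 0" by (rule increment_mean[OF IH(1) tn(1,2) \<eta>n(1) Ei])
    have EE: "expectation (\<lambda>w. (?E w)\<^sup>2) \<le> B\<^sup>2 * energy (t n) (t (Suc n))"
    proof -
      have "expectation (\<lambda>w. (?E w)\<^sup>2) \<le> expectation (\<lambda>w. B\<^sup>2 * (norm (?D w))\<^sup>2)"
        by (intro integral_mono Ei2 E2 integrable_mult_right D(1))
      also have "\<dots> \<le> B\<^sup>2 * energy (t n) (t (Suc n))" using D(2) by (simp add: mult_left_mono)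
      finally show ?thesis .
    qed
    have Xi: "integrable M (\<lambda>w. ?N w * ?E w)"
    proof (rule Bochner_Integration.integrable_bound[OF Bochner_Integration.integrable_add[OF IH(6) Ei2]])
      show "AE w in M. norm (?N w * ?E w) \<le> norm ((?N w)\<^sup>2 + (?E w)\<^sup>2)"
      proof (rule AE_I2)
        have "\<bar>a * b\<bar> \<le> a\<^sup>2 + b\<^sup>2" for a b :: real
        proof -
          have "2 * \<bar>a\<bar> * \<bar>b\<bar> \<le> a\<^sup>2 + b\<^sup>2" using sum_squares_bound[of "\<bar>a\<bar>" "\<bar>b\<bar>"] by simp
          moreover have "0 \<le> \<bar>a\<bar> * \<bar>b\<bar>" by simp
          ultimately have "\<bar>a\<bar> * \<bar>b\<bar> \<le> a\<^sup>2 + b\<^sup>2" by linarith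
          then show ?thesis by (simp only: abs_mult)
        qed
        then show "norm (?N w * ?E w) \<le> norm ((?N w)\<^sup>2 + (?E w)\<^sup>2)" for w by simp
      qed
    qed measurable
    \<comment> \<open>The multiplier \<open>?N *\<^sub>R \<eta> n\<close> is unbounded, which is why orthogonality is available for integrable products.\<close>
    have X0: "expectation (\<lambda>w. ?N w * ?E w) = 0"
      using increment_mean[OF IH(1) tn(1,2), of "\<lambda>w. ?N w *\<^sub>R \<eta> n w"] Xi IH(3) \<eta>n(1)
      by (simp add: borel_measurable_scaleR)
    have Dm: "?E \<in> borel_measurable (F (t (Suc n)))"
      using F_measurable_mono[OF \<eta>n(1) IH(1) tn(1)] F_measurable_mono[OF mF(1) IH(1) tn(1)] mF(2) by measurable
    have sq: "(\<lambda>w. (?N w + ?E w)\<^sup>2) = (\<lambda>w. (?N w)\<^sup>2 + 2 * (?N w * ?E w) + (?E w)\<^sup>2)"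
      by (simp add: power2_sum fun_eq_iff)
    show ?case unfolding sum.lessThan_Suc
    proof (intro conjI)
      show "0 \<le> t (Suc n)" "t 0 \<le> t (Suc n)" using IH tn by auto
      show "(\<lambda>w. ?N w + ?E w) \<in> borel_measurable (F (t (Suc n)))"
        by (intro borel_measurable_add Dm F_measurable_mono[OF IH(3,1) tn(1)])
      show "integrable M (\<lambda>w. ?N w + ?E w)" using IH(4) Ei by auto
      show "expectation (\<lambda>w. ?N w + ?E w) = 0" using IH(4,5) Ei E0 by simp
      show "integrable M (\<lambda>w. (?N w + ?E w)\<^sup>2)" unfolding sq using IH(6) Ei2 Xi by auto
      have "expectation (\<lambda>w. (?N w + ?E w)\<^sup>2) = expectation (\<lambda>w. (?N w)\<^sup>2) + expectation (\<lambda>w. (?E w)\<^sup>2)"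
        unfolding sq using IH(6) Ei2 Xi X0 by simp
      also have "\<dots> \<le> B\<^sup>2 * energy (t 0) (t n) + B\<^sup>2 * energy (t n) (t (Suc n))" using IH(7) EE by simp
      also have "\<dots> = B\<^sup>2 * energy (t 0) (t (Suc n))"
        using energy_add[of "t 0" "t n" "t (Suc n)"] Suc.prems(2) IH(2) tn by (simp add: distrib_left[symmetric])
      finally show "expectation (\<lambda>w. (?N w + ?E w)\<^sup>2) \<le> B\<^sup>2 * energy (t 0) (t (Suc n))" .
    qed
  qed
  then show "integrable M N" "expectation N = 0" "integrable M (\<lambda>w. (N w)\<^sup>2)"
    "expectation (\<lambda>w. (N w)\<^sup>2) \<le> B\<^sup>2 * energy (t 0) (t n)" by blast+
qed

text \<open>The weight cuts off the multiplier of the stochastic increments.\<close>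

lemma damping_bound:
  fixes e r :: real
  assumes "0 < e" "0 \<le> r"
  shows "1 / (1 + e * r\<^sup>2)\<^sup>2 * r \<le> 1 + 1 / e"
proof -
  have p: "1 \<le> 1 + e * r\<^sup>2" using assms by simp
  have "r \<le> (1 + 1 / e) * (1 + e * r\<^sup>2)"
  proof (cases "r \<le> 1")
    case True
    have "1 * 1 \<le> (1 + 1 / e) * (1 + e * r\<^sup>2)" using assms p by (intro mult_mono) auto
    then show ?thesis using True by simp
  next
    case False
    then have "r \<le> r\<^sup>2" using assms by (simp add: power2_eq_square)
    also have "\<dots> \<le> (1 + 1 / e) * (1 + e * r\<^sup>2)" using assms by (simp add: field_simps)
    finally show ?thesis .
  qed
  also have "\<dots> \<le> (1 + 1 / e) * (1 + e * r\<^sup>2)\<^sup>2"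
    using mult_left_mono[OF p, of "1 + e * r\<^sup>2"] p assms by (intro mult_left_mono) (auto simp: power2_eq_square)
  finally show ?thesis using p by (simp add: divide_le_eq)
qed

text \<open>The grid sums split into a martingale transform \<open>N n\<close> with bounded multipliers and the
  weighted squared increments \<open>Q n\<close>, whose expectation is at most \<open>energy 0 T\<close> since the weights
  are at most 1.\<close>

lemma damped_expectation:
  assumes e: "0 < e" and T: "0 < T"
    and v: "\<And>t. t \<in> {0..T} \<Longrightarrow> v t \<in> borel_measurable (F t)"
    and P: "P \<in> borel_measurable M" "\<And>w. 0 \<le> P w" and Y: "integrable M Y"
    and lim: "AE w in M. \<forall>d>0. \<forall>\<^sub>F n in sequentially. P w + Y w \<le>
      (\<Sum>i<n. (1 / (1 + e * (norm (v (T * real i / n) w))\<^sup>2)\<^sup>2) *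
        (2 * (v (T * real i / n) w \<bullet> (m (T * real (Suc i) / n) w - m (T * real i / n) w))
          + (norm (m (T * real (Suc i) / n) w - m (T * real i / n) w))\<^sup>2)) + d"
  shows "integrable M P" "expectation P + expectation Y \<le> energy 0 T"
proof -
  define wt where "wt = (\<lambda>t w. 1 / (1 + e * (norm (v t w))\<^sup>2)\<^sup>2)"
  define t where "t = (\<lambda>n i. T * real i / real n)"
  define N where "N = (\<lambda>n w. \<Sum>i<n. (2 * wt (t n i) w) *\<^sub>R v (t n i) w \<bullet> (m (t n (Suc i)) w - m (t n i) w))"
  define Q where "Q = (\<lambda>n w. \<Sum>i<n. wt (t n i) w * (norm (m (t n (Suc i)) w - m (t n i) w))\<^sup>2)"
  have w01: "0 \<le> wt s w" "wt s w \<le> 1" for s w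
    using e by (auto simp: wt_def divide_le_eq intro!: one_le_power)
  have tT: "t n i \<in> {0..T}" "t n i \<le> t n (Suc i)" if "i \<le> n" for n i
  proof -
    have "T * real i \<le> T * real n" using T that by (intro mult_left_mono) auto
    then show "t n i \<in> {0..T}" using T by (cases "n = 0") (auto simp: t_def divide_le_eq)
    show "t n i \<le> t n (Suc i)" using T by (auto simp: t_def divide_right_mono)
  qed
  have t0: "t n 0 = 0" for n by (simp add: t_def)
  have wm: "wt s \<in> borel_measurable (F s)" if "s \<in> {0..T}" for s
    unfolding wt_def using v[OF that] by measurable
  have \<eta>: "(\<lambda>w. (2 * wt (t n i) w) *\<^sub>R v (t n i) w) \<in> borel_measurable (F (t n i))" if "i < n" for n i
    using wm[OF tT(1)] v[OF tT(1)] that by (intro borel_measurable_scaleR borel_measurable_times) auto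
  have \<eta>b: "norm ((2 * wt (t n i) w) *\<^sub>R v (t n i) w) \<le> 2 * (1 + 1 / e)" for n i w
    using damping_bound[OF e, of "norm (v (t n i) w)"] w01[of "t n i" w] by (simp add: wt_def abs_mult)
  have en: "energy 0 (t n n) \<le> energy 0 T" for n
    using energy_add[of 0 "t n n" T] energy_nonneg[of "t n n" T] tT(1)[of n n] by auto
  have NN: "integrable M (N n)" "expectation (N n) = 0" "integrable M (\<lambda>w. (N n w)\<^sup>2)"
    "expectation (\<lambda>w. (N n w)\<^sup>2) \<le> (2 * (1 + 1 / e))\<^sup>2 * energy 0 T" for n
  proof -
    have tt: "\<And>i. i < n \<Longrightarrow> t n i \<le> t n (Suc i)" "0 \<le> t n 0" "t n n \<le> T"
      using tT[of _ n] t0 by auto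
    note s = square_transform[where t="t n" and n=n and B="2 * (1 + 1 / e)", OF tt \<eta> \<eta>b, folded N_def]
    show "integrable M (N n)" "expectation (N n) = 0" "integrable M (\<lambda>w. (N n w)\<^sup>2)"
      using s(1,2,3) by (simp_all add: N_def)
    have "expectation (\<lambda>w. (N n w)\<^sup>2) \<le> (2 * (1 + 1 / e))\<^sup>2 * energy 0 (t n n)"
      using s(4) unfolding t0 by (simp add: N_def)
    also have "\<dots> \<le> (2 * (1 + 1 / e))\<^sup>2 * energy 0 T" by (intro mult_left_mono en) auto
    finally show "expectation (\<lambda>w. (N n w)\<^sup>2) \<le> (2 * (1 + 1 / e))\<^sup>2 * energy 0 T" .
  qed
  have QQ: "integrable M (Q n) \<and> expectation (Q n) \<le> energy 0 T" for n
  proof -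
    have wi: "integrable M (\<lambda>w. wt (t n i) w * (norm (m (t n (Suc i)) w - m (t n i) w))\<^sup>2) \<and>
      expectation (\<lambda>w. wt (t n i) w * (norm (m (t n (Suc i)) w - m (t n i) w))\<^sup>2) \<le> energy (t n i) (t n (Suc i))"
      if i: "i < n" for i
    proof -
      have t: "0 \<le> t n i" "t n i \<le> t n (Suc i)" "t n (Suc i) \<le> T" "t n i \<in> {0..T}" "t n (Suc i) \<in> {0..T}"
        using tT[of i n] tT(1)[of "Suc i" n] i by auto
      note ie = increment_energy[OF t(1-3)]
      have [measurable]: "wt (t n i) \<in> borel_measurable M" "m (t n i) \<in> borel_measurable M" "m (t n (Suc i)) \<in> borel_measurable M"
        using F_measurable_M[OF wm[OF t(4)]] F_measurable_M[OF m_adapted[OF t(4)]] F_measurable_M[OF m_adapted[OF t(5)]] t by auto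
      have le: "wt (t n i) w * (norm (m (t n (Suc i)) w - m (t n i) w))\<^sup>2 \<le> (norm (m (t n (Suc i)) w - m (t n i) w))\<^sup>2" for w
        using mult_right_mono[OF w01(2), of "(norm (m (t n (Suc i)) w - m (t n i) w))\<^sup>2"] by simp
      have int: "integrable M (\<lambda>w. wt (t n i) w * (norm (m (t n (Suc i)) w - m (t n i) w))\<^sup>2)"
        by (rule Bochner_Integration.integrable_bound[OF ie(1)]) (use le w01 in \<open>auto simp: abs_mult\<close>)
      then show ?thesis using integral_mono[OF int ie(1) le] ie(2) by simp
    qed
    have "expectation (Q n) = (\<Sum>i<n. expectation (\<lambda>w. wt (t n i) w * (norm (m (t n (Suc i)) w - m (t n i) w))\<^sup>2))"
      unfolding Q_def using wi by (intro Bochner_Integration.integral_sum) auto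
    also have "\<dots> \<le> (\<Sum>i<n. energy (t n i) (t n (Suc i)))" using wi by (intro sum_mono) auto
    also have "\<dots> = energy 0 (t n n)"
    proof -
      have "(\<Sum>i<j. energy (t n i) (t n (Suc i))) = energy 0 (t n j)" if "j \<le> n" for j
        using that
      proof (induction j)
        case (Suc j)
        then show ?case using tT[of j n] tT(1)[of "Suc j" n] by (simp add: energy_add)
      qed (simp add: t0 energy_def)
      then show ?thesis by simp
    qed
    finally show ?thesis using en[of n] wi unfolding Q_def by (auto intro!: Bochner_Integration.integrable_sum)
  qed
  have eq: "(\<Sum>i<n. wt (t n i) w * (2 * (v (t n i) w \<bullet> (m (t n (Suc i)) w - m (t n i) w))
          + (norm (m (t n (Suc i)) w - m (t n i) w))\<^sup>2)) = N n w + Q n w" for n w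
    unfolding N_def Q_def sum.distrib[symmetric] by (intro sum.cong refl) (simp add: algebra_simps)
  have lim': "AE w in M. \<forall>d>0. \<forall>\<^sub>F n in sequentially. P w + Y w \<le> N n w + Q n w + d"
    using lim unfolding eq[symmetric] by (simp add: t_def wt_def)
  have Q0: "0 \<le> Q n w" for n w
    unfolding Q_def by (intro sum_nonneg mult_nonneg_nonneg w01) auto
  show "integrable M P" "expectation P + expectation Y \<le> energy 0 T"
    using expectation_le_of_pathwise_limit[OF P Y NN Q0 _ _ lim'] QQ by auto
qed

end

section \<open>Continuous processes\<close>

text \<open>The time argument is rounded down to a multiple of \<open>1 / (n + 1)\<close>. The rounded process takes its
  time index from a countable set, and it converges pointwise by continuity of the paths.\<close>

lemma continuous_process_jointly_measurable:
  fixes X :: "real \<Rightarrow> 'w \<Rightarrow> 'a::{metric_space, second_countable_topology}"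
  assumes X: "\<And>t. t \<in> {0..T} \<Longrightarrow> X t \<in> borel_measurable N"
    and c: "\<And>w. w \<in> space N \<Longrightarrow> continuous_on {0..T} (\<lambda>t. X t w)" and T: "0 \<le> T"
  shows "(\<lambda>p. X (max 0 (min T (snd p))) (fst p)) \<in> borel_measurable (N \<Otimes>\<^sub>M borel)"
proof (rule borel_measurable_LIMSEQ_metric)
  let ?c = "\<lambda>u::real. max 0 (min T u)"
  let ?g = "\<lambda>n p. nat \<lfloor>real (Suc n) * ?c (snd p)\<rfloor>"
  show "(\<lambda>p. X (min T (real (?g n p) / real (Suc n))) (fst p)) \<in> borel_measurable (N \<Otimes>\<^sub>M borel)" for n
  proof (rule measurable_compose_countable[where f="\<lambda>i p. X (min T (real i / real (Suc n))) (fst p)"])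
    fix i :: nat
    have "X (min T (real i / real (Suc n))) \<in> borel_measurable N" using T by (intro X) auto
    then show "(\<lambda>p. X (min T (real i / real (Suc n))) (fst p)) \<in> borel_measurable (N \<Otimes>\<^sub>M borel)"
      by measurable
  qed measurable
  fix p assume "p \<in> space (N \<Otimes>\<^sub>M (borel :: real measure))"
  then have w: "fst p \<in> space N" by (auto simp: space_pair_measure)
  define u where "u = ?c (snd p)"
  have u: "u \<in> {0..T}" using T by (auto simp: u_def)
  have "(\<lambda>n. of_int \<lfloor>real (Suc n) * u\<rfloor> / real (Suc n)) \<longlonglongrightarrow> u"
  proof (rule tendsto_sandwich)
    show "\<forall>\<^sub>F n in sequentially. u - 1 / real (Suc n) \<le> of_int \<lfloor>real (Suc n) * u\<rfloor> / real (Suc n)"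
    proof (rule always_eventually, rule allI)
      fix n
      have "real (Suc n) * u - 1 \<le> of_int \<lfloor>real (Suc n) * u\<rfloor>" by linarith
      then have "(real (Suc n) * u - 1) / real (Suc n) \<le> of_int \<lfloor>real (Suc n) * u\<rfloor> / real (Suc n)"
        by (rule divide_right_mono) simp
      then show "u - 1 / real (Suc n) \<le> of_int \<lfloor>real (Suc n) * u\<rfloor> / real (Suc n)"
        by (simp add: diff_divide_distrib del: of_nat_Suc)
    qed
    show "\<forall>\<^sub>F n in sequentially. of_int \<lfloor>real (Suc n) * u\<rfloor> / real (Suc n) \<le> u"
      by (rule always_eventually, rule allI) (simp add: divide_le_eq mult.commute del: of_nat_Suc)
    have "(\<lambda>n. u - 1 / real (Suc n)) \<longlonglongrightarrow> u - 0"
      by (intro tendsto_intros LIMSEQ_Suc[OF lim_const_over_n])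
    then show "(\<lambda>n. u - 1 / real (Suc n)) \<longlonglongrightarrow> u" by simp
  qed simp
  moreover have "of_int \<lfloor>real (Suc n) * u\<rfloor> / real (Suc n) = real (?g n p) / real (Suc n)" for n
    using u by (simp add: u_def[symmetric] del: of_nat_Suc)
  ultimately have "(\<lambda>n. real (?g n p) / real (Suc n)) \<longlonglongrightarrow> u" by simp
  then have "(\<lambda>n. min T (real (?g n p) / real (Suc n))) \<longlonglongrightarrow> min T u" by (intro tendsto_intros)
  then have lim: "(\<lambda>n. min T (real (?g n p) / real (Suc n))) \<longlonglongrightarrow> u" using u by simp
  have ev: "\<forall>\<^sub>F n in sequentially. min T (real (?g n p) / real (Suc n)) \<in> {0..T}"
    using T by (intro always_eventually) auto
  show "(\<lambda>n. X (min T (real (?g n p) / real (Suc n))) (fst p)) \<longlonglongrightarrow> X (?c (snd p)) (fst p)"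
    using continuous_on_tendsto_compose[OF c[OF w] lim u ev] unfolding u_def by simp
qed

lemma continuous_process_integral_measurable:
  fixes X :: "real \<Rightarrow> 'w \<Rightarrow> 'a::euclidean_space"
  assumes X: "\<And>t. t \<in> {0..T} \<Longrightarrow> X t \<in> borel_measurable N"
    and c: "\<And>w. w \<in> space N \<Longrightarrow> continuous_on {0..T} (\<lambda>t. X t w)" and T: "0 \<le> T"
  shows "(\<lambda>w. integral {0..T} (\<lambda>u. X u w)) \<in> borel_measurable N"
proof -
  note j[measurable] = continuous_process_jointly_measurable[OF X c T]
  have "(\<lambda>w. \<integral>u. indicator {0..T} u *\<^sub>R X (max 0 (min T u)) w \<partial>lborel) \<in> borel_measurable N"
  proof (rule lborel.borel_measurable_lebesgue_integral)
    have "(\<lambda>p. indicator {0..T} (snd p) *\<^sub>R X (max 0 (min T (snd p))) (fst p)) \<in> borel_measurable (N \<Otimes>\<^sub>M lborel)"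
      using j by measurable
    then show "(\<lambda>(w, u). indicator {0..T} u *\<^sub>R X (max 0 (min T u)) w) \<in> borel_measurable (N \<Otimes>\<^sub>M lborel)"
      by (simp add: split_beta)
  qed
  moreover have "integral {0..T} (\<lambda>u. X u w) = (\<integral>u. indicator {0..T} u *\<^sub>R X (max 0 (min T u)) w \<partial>lborel)"
    if w: "w \<in> space N" for w
  proof -
    have "set_integrable lborel {0..T} (\<lambda>u. X u w)" by (rule borel_integrable_compact[OF compact_Icc c[OF w], folded set_integrable_def])
    from set_borel_integral_eq_integral(2)[OF this]
    moreover have "indicator {0..T} u *\<^sub>R X (max 0 (min T u)) w = indicator {0..T} u *\<^sub>R X u w" for u
      by (cases "u \<in> {0..T}") auto
    ultimately show ?thesis by (simp only: set_lebesgue_integral_def)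
  qed
  ultimately show ?thesis by (subst measurable_cong) auto
qed

section \<open>Convex functions along a path\<close>

lemma lower_semicont_open_superlevel:
  assumes f: "lower_semicont f"
  shows "open {x. (a::ereal) < f x}"
proof (rule Topological_Spaces.openI)
  fix x assume "x \<in> {x. a < f x}"
  then have x: "a < f x" by simp
  also have "f x \<le> Liminf (at x) f" using f by (auto simp: lower_semicont_def)
  finally have "\<forall>\<^sub>F y in at x. a < f y" by (rule less_LiminfD)
  then have "\<forall>\<^sub>F y in nhds x. a < f y" unfolding eventually_at_filter
    by (rule eventually_mono) (use x in auto)
  then show "\<exists>T. open T \<and> x \<in> T \<and> T \<subseteq> {x. a < f x}" by (auto simp: eventually_nhds)
qed

lemma lower_semicont_borel: "lower_semicont f \<Longrightarrow> f \<in> borel_measurable borel"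
  by (rule borel_measurableI_greater) (auto intro: borel_open lower_semicont_open_superlevel)

definition epigraph :: "('a \<Rightarrow> ereal) \<Rightarrow> ('a \<times> real) set" where
  "epigraph f = {(x, r). f x \<le> ereal r}"

lemma closed_epigraph:
  fixes f :: "'a::topological_space \<Rightarrow> ereal"
  assumes "lower_semicont f"
  shows "closed (epigraph f)"
  unfolding closed_def
proof (rule Topological_Spaces.openI)
  fix p assume "p \<in> - epigraph f"
  then have "ereal (snd p) < f (fst p)" by (auto simp: epigraph_def split: prod.splits)
  then obtain c where c: "ereal (snd p) < ereal c" "ereal c < f (fst p)"
    using ereal_dense2 by blast
  have "open ({x. ereal c < f x} \<times> {..<c})"
    by (intro open_Times lower_semicont_open_superlevel assms open_lessThan)
  moreover have "p \<in> {x. ereal c < f x} \<times> {..<c}" using c by (cases p) auto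
  moreover have "{x. ereal c < f x} \<times> {..<c} \<subseteq> - epigraph f"
    unfolding epigraph_def by (auto simp: not_le) (meson ereal_less_eq(3) less_imp_le less_le_trans not_le order_trans)
  ultimately show "\<exists>T. open T \<and> p \<in> T \<and> T \<subseteq> - epigraph f" by blast
qed

lemma convex_epigraph:
  assumes "convex_fun f"
  shows "convex (epigraph f)"
proof (rule convexI)
  fix p q and u v :: real
  assume p: "p \<in> epigraph f" "q \<in> epigraph f" and uv: "0 \<le> u" "0 \<le> v" "u + v = 1"
  have "f ((1 - v) *\<^sub>R fst p + v *\<^sub>R fst q) \<le> ereal (1 - v) * f (fst p) + ereal v * f (fst q)"
    using assms uv unfolding convex_fun_def by auto
  also have "\<dots> \<le> ereal (1 - v) * ereal (snd p) + ereal v * ereal (snd q)"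
    using p uv by (intro add_mono ereal_mult_left_mono) (auto simp: epigraph_def split: prod.splits)
  finally have fin: "f ((1 - v) *\<^sub>R fst p + v *\<^sub>R fst q) \<le> ereal (1 - v) * ereal (snd p) + ereal v * ereal (snd q)" .
  show "u *\<^sub>R p + v *\<^sub>R q \<in> epigraph f"
  proof -
    have u: "u = 1 - v" using uv(3) by simp
    show ?thesis using fin unfolding u by (cases p; cases q) (auto simp: epigraph_def)
  qed
qed

text \<open>If the average were outside, a hyperplane would separate it strictly from the set, and
  integrating the separating inequality would contradict this.\<close>

lemma average_in_closed_convex:
  fixes f :: "real \<Rightarrow> 'a::euclidean_space"
  assumes S: "closed S" "convex S" and T: "0 < T" and f: "f integrable_on {0..T}"
    and N: "negligible N" "\<And>u. u \<in> {0..T} - N \<Longrightarrow> f u \<in> S"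
  shows "(1 / T) *\<^sub>R integral {0..T} f \<in> S"
proof (rule ccontr)
  assume "\<not> ?thesis"
  then obtain a b where ab: "a \<bullet> ((1 / T) *\<^sub>R integral {0..T} f) < b" "\<And>x. x \<in> S \<Longrightarrow> b < a \<bullet> x"
    using separating_hyperplane_closed_point[OF S(2,1)] by blast
  define g where "g = (\<lambda>u. if u \<in> N then b else a \<bullet> f u)"
  have af: "((\<lambda>u. a \<bullet> f u) has_integral a \<bullet> integral {0..T} f) {0..T}"
    using has_integral_linear[OF integrable_integral[OF f] bounded_linear_inner_right[of a]] by (simp add: o_def)
  have g: "(g has_integral a \<bullet> integral {0..T} f) {0..T}"
    by (rule has_integral_spike[OF N(1) _ af]) (auto simp: g_def)
  have "integral {0..T} (\<lambda>u. b) \<le> integral {0..T} g"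
    using g ab(2) N(2) by (intro integral_le) (auto simp: g_def intro!: less_imp_le)
  then have "T * b \<le> a \<bullet> integral {0..T} f" using integral_unique[OF g] T by simp
  then show False using ab(1) T by (simp add: field_simps)
qed

text \<open>Subtracting an integrable minorant turns the extended integral into a real integral of the
  minorant and the integral of a nonnegative function, for which Fatou's lemma and Tonelli's
  theorem are at hand.\<close>

lemma ereal_integral_minorant:
  fixes f :: "'a \<Rightarrow> ereal" and a :: "'a \<Rightarrow> real"
  assumes f[measurable]: "f \<in> borel_measurable N" and a: "integrable N a" and af: "\<And>x. x \<in> space N \<Longrightarrow> ereal (a x) \<le> f x"
    and fin: "ereal_integral N f < \<infinity>"
  shows "(\<integral>\<^sup>+x. e2ennreal (f x - ereal (a x)) \<partial>N) < \<infinity>"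
    "ereal_integral N f = ereal (integral\<^sup>L N a + enn2real (\<integral>\<^sup>+x. e2ennreal (f x - ereal (a x)) \<partial>N))"
proof -
  have [measurable]: "a \<in> borel_measurable N" using a by auto
  let ?p = "\<lambda>x. e2ennreal (f x - ereal (a x))"
  let ?F = "\<integral>\<^sup>+x. e2ennreal (f x) \<partial>N" and ?f = "\<integral>\<^sup>+x. e2ennreal (- f x) \<partial>N"
  let ?A = "\<integral>\<^sup>+x. ennreal (a x) \<partial>N" and ?a = "\<integral>\<^sup>+x. ennreal (- a x) \<partial>N" and ?P = "\<integral>\<^sup>+x. ?p x \<partial>N"
  have afin: "?A < \<infinity>" "?a < \<infinity>" using a by (auto simp: real_integrable_def top.not_eq_extremum)
  have "e2ennreal (- f x) \<le> ennreal (- a x)" if "x \<in> space N" for x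
  proof -
    have "- f x \<le> ereal (- a x)" using af[OF that] by (simp add: ereal_uminus_le_reorder flip: uminus_ereal.simps(1))
    then have "e2ennreal (- f x) \<le> e2ennreal (ereal (- a x))" by (rule e2ennreal_mono)
    then show ?thesis by (simp add: ennreal.abs_eq e2ennreal_ereal)
  qed
  then have "?f \<le> ?a" by (intro nn_integral_mono)
  then have ffin: "?f < \<infinity>" using afin(2) by simp
  have Ffin: "?F < \<infinity>"
  proof (rule ccontr)
    assume "\<not> ?F < \<infinity>"
    then have "?F = \<infinity>" by (metis infinity_ennreal_def top.not_eq_extremum)
    moreover obtain c where "0 \<le> c" "?f = ennreal c" using ffin by (cases ?f) auto
    ultimately show False using fin by (simp add: ereal_integral_def)
  qed
  have pt: "e2ennreal (f x) + ennreal (- a x) = e2ennreal (- f x) + ennreal (a x) + ?p x" if "x \<in> space N" for x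
  proof (cases "f x")
    case (real r)
    then have r: "a x \<le> r" using af[OF that] by simp
    have "ennreal r + ennreal (- a x) = ennreal (- r) + ennreal (a x) + ennreal (r - a x)"
      using r by (cases "0 \<le> a x"; cases "0 \<le> r") (auto simp: ennreal_neg ennreal_plus[symmetric] simp del: ennreal_plus)
    then show ?thesis using real by (simp add: e2ennreal_ereal)
  qed (use af[OF that] in auto)
  have "?F + ?a = (\<integral>\<^sup>+x. e2ennreal (f x) + ennreal (- a x) \<partial>N)" by (subst nn_integral_add) auto
  also have "\<dots> = (\<integral>\<^sup>+x. e2ennreal (- f x) + ennreal (a x) + ?p x \<partial>N)" by (intro nn_integral_cong pt)
  also have "\<dots> = ?f + ?A + ?P" by (subst nn_integral_add; (subst nn_integral_add)?) auto
  finally have eq: "?F + ?a = ?f + ?A + ?P" .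
  have "?P \<le> ?F + ?a" unfolding eq by simp
  also have "\<dots> < \<infinity>" using Ffin afin by (simp add: ennreal_add_less_top)
  finally show Pfin: "?P < \<infinity>" .
  have "integral\<^sup>L N a = enn2real ?A - enn2real ?a" by (rule real_lebesgue_integral_def[OF a])
  moreover obtain F where "0 \<le> F" "?F = ennreal F" using Ffin by (cases ?F) auto
  moreover obtain G where "0 \<le> G" "?f = ennreal G" using ffin by (cases ?f) auto
  moreover obtain A where "0 \<le> A" "?A = ennreal A" using afin by (cases ?A) auto
  moreover obtain B where "0 \<le> B" "?a = ennreal B" using afin by (cases ?a) auto
  moreover obtain P where "0 \<le> P" "?P = ennreal P" using Pfin by (cases ?P) auto
  ultimately show "ereal_integral N f = ereal (integral\<^sup>L N a + enn2real ?P)"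
    using eq unfolding ereal_integral_def by (simp add: ennreal_plus[symmetric] del: ennreal_plus)
qed

lemma ereal_integral_le_expectation:
  fixes f :: "'a \<Rightarrow> ereal" and L U :: "'a \<Rightarrow> real"
  assumes f[measurable]: "f \<in> borel_measurable N" and L: "integrable N L" and U: "integrable N U"
    and bounds: "AE x in N. ereal (L x) \<le> f x \<and> f x \<le> ereal (U x)"
  shows "ereal_quasi_integrable N f" "ereal_integral N f \<le> ereal (integral\<^sup>L N U)"
proof -
  have [measurable]: "L \<in> borel_measurable N" "U \<in> borel_measurable N" using L U by auto
  let ?F = "\<integral>\<^sup>+x. e2ennreal (f x) \<partial>N" and ?f = "\<integral>\<^sup>+x. e2ennreal (- f x) \<partial>N"
  let ?U = "\<integral>\<^sup>+x. ennreal (U x) \<partial>N" and ?u = "\<integral>\<^sup>+x. ennreal (- U x) \<partial>N" and ?l = "\<integral>\<^sup>+x. ennreal (- L x) \<partial>N"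
  have fin: "?U < \<infinity>" "?u < \<infinity>" "?l < \<infinity>" using L U by (auto simp: real_integrable_def top.not_eq_extremum)
  have "?F \<le> ?U"
  proof (rule nn_integral_mono_AE)
    show "AE x in N. e2ennreal (f x) \<le> ennreal (U x)"
      using bounds by eventually_elim (metis e2ennreal_ereal e2ennreal_mono)
  qed
  have "?u \<le> ?f"
  proof (rule nn_integral_mono_AE)
    show "AE x in N. ennreal (- U x) \<le> e2ennreal (- f x)"
      using bounds by eventually_elim (metis e2ennreal_ereal e2ennreal_mono ereal_minus_le_minus uminus_ereal.simps(1))
  qed
  have "?f \<le> ?l"
  proof (rule nn_integral_mono_AE)
    show "AE x in N. e2ennreal (- f x) \<le> ennreal (- L x)"
      using bounds by eventually_elim (metis e2ennreal_ereal e2ennreal_mono ereal_minus_le_minus uminus_ereal.simps(1))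
  qed
  then have ff: "?f < \<infinity>" using fin(3) by simp
  then show "ereal_quasi_integrable N f" by (simp add: ereal_quasi_integrable_def)
  have FF: "?F < \<infinity>" using \<open>?F \<le> ?U\<close> fin(1) by simp
  have "integral\<^sup>L N U = enn2real ?U - enn2real ?u" by (rule real_lebesgue_integral_def[OF U])
  moreover obtain F where "0 \<le> F" "?F = ennreal F" using FF by (cases ?F) auto
  moreover obtain G where "0 \<le> G" "?f = ennreal G" using ff by (cases ?f) auto
  moreover obtain A where "0 \<le> A" "?U = ennreal A" using fin by (cases ?U) auto
  moreover obtain B where "0 \<le> B" "?u = ennreal B" using fin by (cases ?u) auto
  ultimately show "ereal_integral N f \<le> ereal (integral\<^sup>L N U)"
    using \<open>?F \<le> ?U\<close> \<open>?u \<le> ?f\<close> unfolding ereal_integral_def by simp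
qed

lemma enn2real_integral_on_interval:
  fixes p :: "real \<Rightarrow> ennreal"
  assumes p: "(\<lambda>u. p u * indicator {r..s} u) \<in> borel_measurable borel"
    and fin: "(\<integral>\<^sup>+u\<in>{r..s}. p u \<partial>lborel) < \<infinity>"
  shows "(\<lambda>u. enn2real (p u)) absolutely_integrable_on {r..s}"
    "integral {r..s} (\<lambda>u. enn2real (p u)) = enn2real (\<integral>\<^sup>+u\<in>{r..s}. p u \<partial>lborel)"
    "negligible {u \<in> {r..s}. p u = \<infinity>}"
proof -
  let ?p = "\<lambda>u. p u * indicator {r..s} u"
  have pm[measurable]: "?p \<in> borel_measurable lborel" using p by simp
  have ae: "AE u in lborel. ?p u \<noteq> \<infinity>" by (rule nn_integral_PInf_AE[OF pm]) (use fin in auto)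
  have nn: "(\<integral>\<^sup>+u. ennreal (enn2real (?p u)) \<partial>lborel) = (\<integral>\<^sup>+u. ?p u \<partial>lborel)"
    by (rule nn_integral_cong_AE) (use ae in eventually_elim, auto simp: less_top)
  have i: "integrable lborel (\<lambda>u. enn2real (?p u))"
    by (rule integrableI_nonneg) (use nn fin in auto)
  have e: "enn2real (?p u) = indicator {r..s} u *\<^sub>R enn2real (p u)" for u
    by (cases "u \<in> {r..s}") auto
  have si: "set_integrable lborel {r..s} (\<lambda>u. enn2real (p u))"
    using i unfolding set_integrable_def e .
  then show "(\<lambda>u. enn2real (p u)) absolutely_integrable_on {r..s}"
    unfolding set_integrable_def by (subst integrable_completion) auto
  have "integral {r..s} (\<lambda>u. enn2real (p u)) = (\<integral>u. enn2real (?p u) \<partial>lborel)"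
    using set_borel_integral_eq_integral(2)[OF si] unfolding set_lebesgue_integral_def e by simp
  also have "\<dots> = enn2real (\<integral>\<^sup>+u. ?p u \<partial>lborel)"
    using integral_eq_nn_integral[of "\<lambda>u. enn2real (?p u)" lborel] i nn by simp
  finally show "integral {r..s} (\<lambda>u. enn2real (p u)) = enn2real (\<integral>\<^sup>+u\<in>{r..s}. p u \<partial>lborel)" .
  have "{u \<in> {r..s}. p u = \<infinity>} = {u \<in> space lborel. \<not> ?p u \<noteq> \<infinity>}" by (auto simp: indicator_def)
  moreover have "{u \<in> space lborel. \<not> ?p u \<noteq> \<infinity>} \<in> null_sets lborel"
    using ae by (subst (asm) AE_iff_null) auto
  ultimately show "negligible {u \<in> {r..s}. p u = \<infinity>}"
    by (simp add: negligible_iff_null_sets null_sets_completionI)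
qed

lemma (in prob_space) continuous_process_mean_integral:
  fixes Z :: "real \<Rightarrow> 'a \<Rightarrow> real"
  assumes Z: "\<And>t. t \<in> {0..T} \<Longrightarrow> Z t \<in> borel_measurable M" "\<And>t w. 0 \<le> Z t w"
    and c: "\<And>w. w \<in> space M \<Longrightarrow> continuous_on {0..T} (\<lambda>t. Z t w)" and T: "0 \<le> T"
    and E: "\<And>t. t \<in> {0..T} \<Longrightarrow> integrable M (Z t) \<and> expectation (Z t) \<le> k"
  shows "integrable M (\<lambda>w. integral {0..T} (\<lambda>u. Z u w))"
    "expectation (\<lambda>w. integral {0..T} (\<lambda>u. Z u w)) \<le> T * k"
proof -
  let ?I = "\<lambda>w. integral {0..T} (\<lambda>u. Z u w)"
  have k0: "0 \<le> k" using E[of 0] T order_trans[OF integral_nonneg_AE[of "Z 0" M]] Z(2) by auto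
  interpret pair_sigma_finite M lborel by unfold_locales
  note jm = continuous_process_jointly_measurable[OF Z(1) c T]
  have Im[measurable]: "?I \<in> borel_measurable M" by (rule continuous_process_integral_measurable[OF Z(1) c T])
  have I0: "0 \<le> ?I w" if "w \<in> space M" for w
    by (intro integral_nonneg integrable_continuous_interval c that) (simp add: Z(2))
  have zm: "(\<lambda>p. ennreal (indicator {0..T} (snd p) * Z (max 0 (min T (snd p))) (fst p))) \<in> borel_measurable (M \<Otimes>\<^sub>M lborel)"
    using jm by measurable
  have "(\<integral>\<^sup>+w. ennreal (?I w) \<partial>M) = (\<integral>\<^sup>+w. \<integral>\<^sup>+u. ennreal (indicator {0..T} u * Z (max 0 (min T u)) w) \<partial>lborel \<partial>M)"
  proof (rule nn_integral_cong)
    fix w assume w: "w \<in> space M"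
    have "(\<integral>\<^sup>+u. ennreal (indicator {0..T} u * Z u w) \<partial>lborel) = ennreal (?I w)"
      by (rule nn_integral_has_integral_lebesgue[OF Z(2) integrable_integral[OF integrable_continuous_interval[OF c[OF w]]]])
    moreover have "indicator {0..T} u * Z (max 0 (min T u)) w = indicator {0..T} u * Z u w" for u
      by (cases "u \<in> {0..T}") auto
    ultimately show "ennreal (?I w) = (\<integral>\<^sup>+u. ennreal (indicator {0..T} u * Z (max 0 (min T u)) w) \<partial>lborel)"
      by (simp only:)
  qed
  also have "\<dots> = (\<integral>\<^sup>+u. \<integral>\<^sup>+w. ennreal (indicator {0..T} u * Z (max 0 (min T u)) w) \<partial>M \<partial>lborel)"
    using Fubini'[of "\<lambda>w u. ennreal (indicator {0..T} u * Z (max 0 (min T u)) w)"] zm by (simp add: split_beta)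
  also have "\<dots> \<le> (\<integral>\<^sup>+u. ennreal k * indicator {0..T} u \<partial>lborel)"
  proof (rule nn_integral_mono)
    fix u :: real
    show "(\<integral>\<^sup>+w. ennreal (indicator {0..T} u * Z (max 0 (min T u)) w) \<partial>M) \<le> ennreal k * indicator {0..T} u"
    proof (cases "u \<in> {0..T}")
      case True
      then show ?thesis using E[OF True] Z(2) by (simp add: nn_integral_eq_integral ennreal_leI)
    qed auto
  qed
  also have "\<dots> = ennreal (T * k)"
    using T k0 by (simp add: nn_integral_cmult_indicator ennreal_mult mult.commute)
  finally have le: "(\<integral>\<^sup>+w. ennreal (?I w) \<partial>M) \<le> ennreal (T * k)" .
  then have "(\<integral>\<^sup>+w. ennreal (?I w) \<partial>M) < \<infinity>" by (rule le_less_trans) simp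
  then show i: "integrable M ?I" using I0 by (intro integrableI_nonneg) auto
  show "expectation ?I \<le> T * k"
    using le i I0 T k0 by (simp add: nn_integral_eq_integral AE_I2)
qed

section \<open>The energy estimate for the solution\<close>

lemma locally_abs_cont_imp_continuous:
  assumes "locally_abs_cont_halfline f"
  shows "continuous_on {0..} f"
  unfolding continuous_on_iff
proof (intro ballI allI impI)
  fix t e :: real assume t: "t \<in> {0..}" and e: "0 < e"
  have t1: "0 < t + 1" using t by simp
  from assms[unfolded locally_abs_cont_halfline_def, THEN spec[of _ "t + 1"], THEN mp, OF t1, THEN spec[of _ e], THEN mp, OF e]
  obtain d where d: "0 < d" and D: "\<forall>(n::nat) a b. (\<forall>i<n. 0 \<le> a i \<and> a i \<le> b i \<and> b i \<le> t + 1) \<longrightarrow>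
     disjoint_family_on (\<lambda>i. {a i<..<b i}) {..<n} \<longrightarrow>
     (\<Sum>i<n. b i - a i) < d \<longrightarrow> (\<Sum>i<n. \<bar>f (b i) - f (a i)\<bar>) < e" by (elim exE conjE)
  have one: "\<bar>f b - f a\<bar> < e" if "0 \<le> a" "a \<le> b" "b \<le> t + 1" "b - a < d" for a b
    using D[rule_format, of 1 "\<lambda>_. a" "\<lambda>_. b"] that by (auto simp: disjoint_family_on_def)
  show "\<exists>d>0. \<forall>s\<in>{0..}. dist s t < d \<longrightarrow> dist (f s) (f t) < e"
  proof (intro exI[of _ "min d 1"] conjI ballI impI)
    fix s assume s: "s \<in> {0..}" "dist s t < min d 1"
    show "dist (f s) (f t) < e"
    proof (cases "s \<le> t")
      case True
      then show ?thesis using one[of s t] s t by (auto simp: dist_real_def)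
    next
      case False
      then show ?thesis using one[of t s] s t by (auto simp: dist_real_def)
    qed
  qed (use d in auto)
qed

text \<open>The point \<open>z\<close> plays the role of a minimizer, with subgradient \<open>g\<close> and value \<open>\<phi>\<close>. The
  penalty gradient \<open>G\<close> is monotone with respect to \<open>z\<close>.\<close>

locale inclusion_solution = brownian_filtration M F W
  for M :: "'w measure" and F and W :: "real \<Rightarrow> 'w \<Rightarrow> real ^ 'm" +
  fixes \<Phi> :: "real ^ 'd \<Rightarrow> ereal" and \<beta> :: "real \<Rightarrow> real" and G :: "real ^ 'd \<Rightarrow> real ^ 'd"
    and \<sigma> :: "real \<Rightarrow> real ^ 'd \<Rightarrow> real ^ 'm ^ 'd" and Sig :: "real \<Rightarrow> real"
    and x z g :: "real ^ 'd" and \<phi> :: real and X K :: "real \<Rightarrow> 'w \<Rightarrow> real ^ 'd"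
  assumes \<Phi>: "convex_fun \<Phi>" "lower_semicont \<Phi>"
    and z: "\<Phi> z = ereal \<phi>" "\<And>y. ereal (\<phi> + g \<bullet> (y - z)) \<le> \<Phi> y"
    and \<beta>: "\<And>t. 0 \<le> t \<Longrightarrow> 0 \<le> \<beta> t" "continuous_on {0..} \<beta>"
    and G: "continuous_on UNIV G" "\<And>y. 0 \<le> (y - z) \<bullet> G y"
    and Sig: "\<And>t y. 0 \<le> t \<Longrightarrow> norm (\<sigma> t y) \<le> Sig t"
      "\<And>T. (\<lambda>t. (Sig t)\<^sup>2) absolutely_integrable_on {0..T}"
    and X: "continuous_adapted M F X" and K: "continuous_adapted M F K"
    and X0: "AE w in M. X 0 w = x"
    and K_bv: "\<And>T. 0 \<le> T \<Longrightarrow> AE w in M. bounded_variation_on 0 T (\<lambda>t. K t w)"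
    and eqn: "\<And>t. 0 \<le> t \<Longrightarrow> \<exists>J. has_ito_integral M F W (\<lambda>s w. \<sigma> s (X s w)) t J \<and>
           (AE w in M. X t w - X 0 w =
              - integral {0..t} (\<lambda>s. \<beta> s *\<^sub>R G (X s w)) + J w - (K t w - K 0 w))"
    and ineq: "\<And>r s. 0 \<le> r \<Longrightarrow> r \<le> s \<Longrightarrow>
           (AE w in M. \<exists>J. has_rs_integral (\<lambda>u. z - X u w) (\<lambda>u. K u w) r s J \<and>
              ereal J + ereal_integral (restrict_space lborel {r..s}) (\<lambda>u. \<Phi> (X u w))
                \<le> ereal (s - r) * \<Phi> z)"
begin

definition lin :: "real ^ 'd \<Rightarrow> real" where
  "lin y = g \<bullet> (y - z)"

text \<open>The excess of \<open>\<Phi>\<close> over its affine minorant at \<open>z\<close>. It is nonnegative and may be infinite, so it is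
  integrated as a nonnegative function, while the affine part is integrated as a real function.\<close>

definition gap :: "real ^ 'd \<Rightarrow> ennreal" where
  "gap y = e2ennreal (\<Phi> y - ereal (\<phi> + lin y))"

text \<open>The damped squared distance to \<open>z\<close> and its derivative with respect to the squared distance.
  Both reduce to the undamped quantities for \<open>e = 0\<close>.\<close>

definition damp :: "real \<Rightarrow> real ^ 'd \<Rightarrow> real" where
  "damp e y = (norm (y - z))\<^sup>2 / (1 + e * (norm (y - z))\<^sup>2)"

definition weight :: "real \<Rightarrow> real ^ 'd \<Rightarrow> real" where
  "weight e y = 1 / (1 + e * (norm (y - z))\<^sup>2)\<^sup>2"

definition drift :: "real \<Rightarrow> 'w \<Rightarrow> real ^ 'd" where
  "drift t w = \<beta> t *\<^sub>R G (X t w)"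

text \<open>The equation solved for the stochastic integral. In this form the integral has an adapted version.\<close>

definition mart :: "real \<Rightarrow> 'w \<Rightarrow> real ^ 'd" where
  "mart t w = X t w - X 0 w + integral {0..t} (\<lambda>s. drift s w) + (K t w - K 0 w)"

lemma X_meas: "0 \<le> t \<Longrightarrow> X t \<in> borel_measurable (F t)"
  and X_cont: "w \<in> space M \<Longrightarrow> continuous_on {0..} (\<lambda>t. X t w)"
  using X by (auto simp: continuous_adapted_def)

lemma X_meas_M [measurable]: "0 \<le> t \<Longrightarrow> X t \<in> borel_measurable M"
  by (rule F_measurable_M[OF X_meas])

lemma X_cont_on: "w \<in> space M \<Longrightarrow> 0 \<le> r \<Longrightarrow> continuous_on {r..s} (\<lambda>t. X t w)"
  by (rule continuous_on_subset[OF X_cont]) auto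

lemma drift_cont: "w \<in> space M \<Longrightarrow> continuous_on {0..T} (\<lambda>t. drift t w)"
  unfolding drift_def
  by (intro continuous_intros continuous_on_subset[OF \<beta>(2)] continuous_on_compose2[OF G(1)] X_cont_on) auto

lemma space_F: "0 \<le> t \<Longrightarrow> space (F t) = space M"
  using filt by (auto simp: filtration_halfline_def subalgebra_def)

lemma G_meas: "G \<in> borel_measurable borel"
  using G(1) by (rule borel_measurable_continuous_onI)

lemma mart_adapted: "0 \<le> t \<Longrightarrow> mart t \<in> borel_measurable (F t)"
proof -
  assume t: "0 \<le> t"
  have Xs: "X s \<in> borel_measurable (F t)" "K s \<in> borel_measurable (F t)" if "s \<in> {0..t}" for s
    using F_measurable_mono[of "X s" s t] F_measurable_mono[of "K s" s t] X K that
    by (auto simp: continuous_adapted_def)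
  have "(\<lambda>w. integral {0..t} (\<lambda>s. drift s w)) \<in> borel_measurable (F t)"
  proof (rule continuous_process_integral_measurable[OF _ _ t])
    show "drift s \<in> borel_measurable (F t)" if "s \<in> {0..t}" for s
      unfolding drift_def using measurable_compose[OF Xs(1)[OF that] G_meas] by measurable
  qed (use drift_cont space_F[OF t] in auto)
  then show ?thesis unfolding mart_def
    using Xs[of t] Xs[of 0] t by (intro borel_measurable_add borel_measurable_diff) auto
qed

lemma ito_process_mart: "ito_process M F W (\<lambda>s w. \<sigma> s (X s w)) mart Sig T"
proof unfold_locales
  fix t assume t: "t \<in> {0..T}"
  then show "mart t \<in> borel_measurable (F t)" by (simp add: mart_adapted)
  obtain J where J: "has_ito_integral M F W (\<lambda>s w. \<sigma> s (X s w)) t J" "AE w in M. X t w - X 0 w =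
              - integral {0..t} (\<lambda>s. \<beta> s *\<^sub>R G (X s w)) + J w - (K t w - K 0 w)"
    using eqn[of t] t by auto
  have "AE w in M. mart t w = J w"
    using J(2) by eventually_elim (simp add: mart_def drift_def)
  with J(1) show "\<exists>J. has_ito_integral M F W (\<lambda>s w. \<sigma> s (X s w)) t J \<and> (AE w in M. mart t w = J w)" by blast
qed (use Sig in auto)

lemma damp_weight:
  assumes e: "0 \<le> e"
  shows "0 \<le> damp e y" "damp e y \<le> (norm (y - z))\<^sup>2" "0 < weight e y" "weight e y \<le> 1"
    "(weight e y * norm (y - z))\<^sup>2 \<le> damp e y" "0 < e \<Longrightarrow> damp e y \<le> 1 / e"
proof -
  let ?r = "(norm (y - z))\<^sup>2"
  have p: "1 \<le> 1 + e * ?r" using e by simp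
  then have p0: "0 < 1 + e * ?r" by linarith
  show "0 \<le> damp e y" using p0 by (simp add: damp_def)
  have "?r * 1 \<le> ?r * (1 + e * ?r)" using p by (intro mult_left_mono) auto
  then show "damp e y \<le> ?r" using p0 by (simp add: damp_def divide_le_eq)
  show "0 < weight e y" using p0 by (simp add: weight_def)
  show w1: "weight e y \<le> 1" using one_le_power[OF p, of 2] by (simp add: weight_def divide_le_eq)
  have "(weight e y * norm (y - z))\<^sup>2 = ?r / (1 + e * ?r) ^ 4"
    by (simp add: weight_def power_mult_distrib power_divide flip: power_mult)
  also have "\<dots> \<le> ?r / (1 + e * ?r)"
    using p p0 by (intro divide_left_mono) (auto intro: self_le_power)
  finally show "(weight e y * norm (y - z))\<^sup>2 \<le> damp e y" by (simp add: damp_def)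
  show "damp e y \<le> 1 / e" if "0 < e"
    using p0 that by (simp add: damp_def field_simps)
qed

lemma damp_weight_cont:
  assumes e: "0 \<le> e"
  shows "continuous_on S (damp e)" "continuous_on S (weight e)" "continuous_on S lin"
proof -
  have p: "1 + e * (norm (y - z))\<^sup>2 \<noteq> 0" for y
    using e by (intro less_imp_neq[symmetric] add_pos_nonneg) auto
  show "continuous_on S (damp e)" "continuous_on S (weight e)" "continuous_on S lin"
    unfolding damp_def weight_def lin_def using p by (intro continuous_intros; simp)+
qed

lemma gap_meas: "gap \<in> borel_measurable borel"
proof -
  have [measurable]: "lin \<in> borel_measurable borel" "\<Phi> \<in> borel_measurable borel"
    using damp_weight_cont(3)[of 0] lower_semicont_borel[OF \<Phi>(2)] by (auto intro: borel_measurable_continuous_onI)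
  show ?thesis unfolding gap_def by measurable
qed

lemma path_restrict_measurable:
  fixes f :: "real ^ 'd \<Rightarrow> 'a::topological_space"
  assumes w: "w \<in> space M" and r: "0 \<le> r" and f: "f \<in> borel_measurable borel"
  shows "(\<lambda>u. f (X u w)) \<in> borel_measurable (restrict_space borel {r..s})"
  by (rule measurable_compose[OF borel_measurable_continuous_on_restrict[OF X_cont_on[OF w r]] f])

text \<open>The inequality defining a solution already forces the gap to be integrable along the path: its
  right-hand side is finite, and the affine minorant is bounded on compact time intervals.\<close>

lemma solution_inequality_real:
  assumes w: "w \<in> space M" and rs: "0 \<le> r" "r \<le> s"
    and le: "ereal J + ereal_integral (restrict_space lborel {r..s}) (\<lambda>u. \<Phi> (X u w)) \<le> ereal (s - r) * \<Phi> z"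
  shows "(\<integral>\<^sup>+u\<in>{r..s}. gap (X u w) \<partial>lborel) < \<infinity>"
    "J + integral {r..s} (\<lambda>u. lin (X u w) + enn2real (gap (X u w))) \<le> 0"
proof -
  let ?N = "restrict_space lborel {r..s}" and ?a = "\<lambda>u. \<phi> + lin (X u w)"
  have lc: "continuous_on {r..s} (\<lambda>u. lin (X u w))"
    by (rule continuous_on_compose2[OF damp_weight_cont(3)[of 0 UNIV] X_cont_on[OF w rs(1)]]) auto
  have sa: "set_integrable lborel {r..s} ?a"
    unfolding set_integrable_def by (rule borel_integrable_compact[OF compact_Icc]) (intro continuous_intros lc)
  have ai: "integrable ?N ?a" using sa by (subst integrable_restrict_space) (auto simp: set_integrable_def)
  have fm: "(\<lambda>u. \<Phi> (X u w)) \<in> borel_measurable ?N"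
    using path_restrict_measurable[OF w rs(1) lower_semicont_borel[OF \<Phi>(2)], of s]
    by (simp add: measurable_cong_sets[OF sets_restrict_space_cong[OF sets_lborel] refl])
  have fin: "ereal_integral ?N (\<lambda>u. \<Phi> (X u w)) < \<infinity>"
    using le by (cases "ereal_integral ?N (\<lambda>u. \<Phi> (X u w))") (auto simp: z(1))
  have ea: "ereal (?a u) \<le> \<Phi> (X u w)" for u using z(2)[of "X u w"] by (simp add: lin_def)
  note m = ereal_integral_minorant[OF fm ai ea fin]
  have nr: "(\<integral>\<^sup>+u. e2ennreal (\<Phi> (X u w) - ereal (?a u)) \<partial>?N) = (\<integral>\<^sup>+u\<in>{r..s}. gap (X u w) \<partial>lborel)"
    by (subst nn_integral_restrict_space) (auto simp: gap_def)
  show fin: "(\<integral>\<^sup>+u\<in>{r..s}. gap (X u w) \<partial>lborel) < \<infinity>" using m(1) unfolding nr .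
  have gm: "(\<lambda>u. gap (X u w) * indicator {r..s} u) \<in> borel_measurable borel"
    using path_restrict_measurable[OF w rs(1) gap_meas, of s] by (subst (asm) borel_measurable_restrict_space_iff_ennreal) auto
  note g = enn2real_integral_on_interval[OF gm fin]
  have la: "integral\<^sup>L ?N ?a = (s - r) * \<phi> + integral {r..s} (\<lambda>u. lin (X u w))"
  proof -
    have "integral\<^sup>L ?N ?a = integral {r..s} ?a"
      using set_borel_integral_eq_integral(2)[OF sa] by (subst integral_restrict_space) (auto simp: set_lebesgue_integral_def)
    also have "\<dots> = integral {r..s} (\<lambda>u. \<phi>) + integral {r..s} (\<lambda>u. lin (X u w))"
      by (rule Henstock_Kurzweil_Integration.integral_add) (auto intro: integrable_continuous_interval lc)
    finally show ?thesis using rs by simp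
  qed
  have "integral {r..s} (\<lambda>u. lin (X u w) + enn2real (gap (X u w)))
    = integral {r..s} (\<lambda>u. lin (X u w)) + enn2real (\<integral>\<^sup>+u\<in>{r..s}. gap (X u w) \<partial>lborel)"
    unfolding g(2)[symmetric] using g(1)
    by (intro Henstock_Kurzweil_Integration.integral_add integrable_continuous_interval[OF lc])
       (auto simp: absolutely_integrable_on_def)
  then show "J + integral {r..s} (\<lambda>u. lin (X u w) + enn2real (gap (X u w))) \<le> 0"
    using le unfolding m(2) nr la z(1) by simp
qed

definition gapI :: "real \<Rightarrow> real \<Rightarrow> 'w \<Rightarrow> ennreal" where
  "gapI e T w = (\<integral>\<^sup>+u\<in>{0..T}. ennreal (weight e (X u w)) * gap (X u w) \<partial>lborel)"

definition linI :: "real \<Rightarrow> real \<Rightarrow> 'w \<Rightarrow> real" where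
  "linI e T w = integral {0..T} (\<lambda>u. weight e (X u w) * lin (X u w))"

lemma path_cont:
  fixes f :: "real ^ 'd \<Rightarrow> 'a::topological_space"
  assumes "w \<in> space M" "0 \<le> r" "continuous_on UNIV f"
  shows "continuous_on {r..s} (\<lambda>u. f (X u w))"
  by (rule continuous_on_compose2[OF assms(3) X_cont_on[OF assms(1,2)]]) auto

lemma gapI_meas: "0 \<le> e \<Longrightarrow> 0 \<le> T \<Longrightarrow> gapI e T \<in> borel_measurable M"
proof -
  assume e: "0 \<le> e" and T: "0 \<le> T"
  have j[measurable]: "(\<lambda>p. X (max 0 (min T (snd p))) (fst p)) \<in> borel_measurable (M \<Otimes>\<^sub>M borel)"
    by (rule continuous_process_jointly_measurable[OF _ _ T]) (auto intro: X_cont_on)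
  have [measurable]: "weight e \<in> borel_measurable borel" "gap \<in> borel_measurable borel"
    using damp_weight_cont(2)[OF e] gap_meas by (auto intro: borel_measurable_continuous_onI)
  have "(\<lambda>p. ennreal (weight e (X (max 0 (min T (snd p))) (fst p))) * gap (X (max 0 (min T (snd p))) (fst p)) * indicator {0..T} (snd p))
     \<in> borel_measurable (M \<Otimes>\<^sub>M lborel)"
    using j by measurable
  then have "(\<lambda>w. \<integral>\<^sup>+u. ennreal (weight e (X (max 0 (min T u)) w)) * gap (X (max 0 (min T u)) w) * indicator {0..T} u \<partial>lborel) \<in> borel_measurable M"
    by (intro lborel.borel_measurable_nn_integral) (simp add: split_beta)
  moreover have "ennreal (weight e (X (max 0 (min T u)) w)) * gap (X (max 0 (min T u)) w) * indicator {0..T} u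
     = ennreal (weight e (X u w)) * gap (X u w) * indicator {0..T} u" for u w
    by (cases "u \<in> {0..T}") auto
  ultimately show ?thesis unfolding gapI_def[abs_def] by (simp only:)
qed

lemma linI_meas: "0 \<le> e \<Longrightarrow> 0 \<le> T \<Longrightarrow> linI e T \<in> borel_measurable M"
proof -
  assume e: "0 \<le> e" and T: "0 \<le> T"
  have wl: "continuous_on UNIV (\<lambda>y. weight e y * lin y)"
    by (intro continuous_intros damp_weight_cont[OF e])
  show ?thesis unfolding linI_def[abs_def]
  proof (rule continuous_process_integral_measurable[OF _ _ T])
    show "(\<lambda>w. weight e (X t w) * lin (X t w)) \<in> borel_measurable M" if "t \<in> {0..T}" for t
      using that by (intro measurable_compose[OF X_meas_M borel_measurable_continuous_onI[OF wl]]) auto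
  qed (auto intro: path_cont[OF _ _ wl])
qed

lemma gap_path_measurable:
  "w \<in> space M \<Longrightarrow> 0 \<le> e \<Longrightarrow> (\<lambda>u. ennreal (weight e (X u w)) * gap (X u w) * indicator {0..T} u) \<in> borel_measurable borel"
proof -
  assume w: "w \<in> space M" and e: "0 \<le> e"
  have [measurable]: "weight e \<in> borel_measurable borel" "gap \<in> borel_measurable borel"
    using damp_weight_cont(2)[OF e] gap_meas by (auto intro: borel_measurable_continuous_onI)
  have "(\<lambda>y. ennreal (weight e y) * gap y) \<in> borel_measurable borel" by measurable
  from path_restrict_measurable[OF w order_refl this, of T] show ?thesis
    by (subst (asm) borel_measurable_restrict_space_iff_ennreal) auto
qed

lemma weighted_gap_integral:
  assumes w: "w \<in> space M" and e: "0 \<le> e" and fin: "gapI 0 T w < \<infinity>"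
  shows "gapI e T w < \<infinity>"
    "(\<lambda>u. weight e (X u w) * enn2real (gap (X u w))) absolutely_integrable_on {0..T}"
    "integral {0..T} (\<lambda>u. weight e (X u w) * enn2real (gap (X u w))) = enn2real (gapI e T w)"
proof -
  have "gapI e T w \<le> gapI 0 T w"
    unfolding gapI_def
    by (intro nn_integral_mono mult_right_mono ennreal_leI) (use damp_weight(4)[OF e] in \<open>auto simp: weight_def\<close>)
  then show f: "gapI e T w < \<infinity>" using fin by (rule le_less_trans)
  have e2: "enn2real (ennreal (weight e y) * gap y) = weight e y * enn2real (gap y)" for y
    using damp_weight(3)[OF e, of y] by (simp add: enn2real_mult)
  show "(\<lambda>u. weight e (X u w) * enn2real (gap (X u w))) absolutely_integrable_on {0..T}"
    "integral {0..T} (\<lambda>u. weight e (X u w) * enn2real (gap (X u w))) = enn2real (gapI e T w)"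
    using enn2real_integral_on_interval(1,2)[OF gap_path_measurable[OF w e] f[unfolded gapI_def]]
    unfolding e2 gapI_def by auto
qed

lemma weight_0 [simp]: "weight 0 y = 1"
  by (simp add: weight_def)

text \<open>The part of the discrete energy balance that is controlled only in expectation: the weighted
  martingale sum together with the Ito correction.\<close>

definition noise :: "real \<Rightarrow> nat \<Rightarrow> real \<Rightarrow> 'w \<Rightarrow> real" where
  "noise e n T w = (\<Sum>i<n. weight e (X (T * real i / n) w) *
     (2 * ((X (T * real i / n) w - z) \<bullet> (mart (T * real (Suc i) / n) w - mart (T * real i / n) w))
       + (norm (mart (T * real (Suc i) / n) w - mart (T * real i / n) w))\<^sup>2))"

text \<open>All grids together have countably many intervals, so a single null set serves for all of them. The
  quantifiers over \<open>e\<close> and \<open>d\<close> then stand inside the almost sure statement.\<close>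

lemma pathwise_inequality:
  assumes T: "0 < T"
  shows "AE w in M. w \<in> space M \<and> X 0 w = x \<and> gapI 0 T w < \<infinity> \<and> (\<forall>e>0. \<forall>d>0. \<forall>\<^sub>F n in sequentially.
    damp e (X T w) + 2 * (linI e T w + enn2real (gapI e T w)) \<le> damp e x + noise e n T w + d)"
proof -
  let ?I = "\<lambda>w r s. \<exists>J. has_rs_integral (\<lambda>u. z - X u w) (\<lambda>u. K u w) r s J \<and>
              ereal J + ereal_integral (restrict_space lborel {r..s}) (\<lambda>u. \<Phi> (X u w)) \<le> ereal (s - r) * \<Phi> z"
  have grid: "AE w in M. \<forall>(n::nat) i. ?I w (T * real i / n) (T * real (Suc i) / n)"
    unfolding AE_all_countable
    by (intro allI ineq divide_right_mono mult_left_mono) (use T in auto)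
  have all: "AE w in M. ?I w 0 T" by (rule ineq) (use T in auto)
  show ?thesis
    using grid all X0 K_bv[OF less_imp_le[OF T]] AE_space
  proof eventually_elim
    case (elim w)
    note w = elim(5)
    let ?q = "\<lambda>u. lin (X u w) + enn2real (gap (X u w))"
    have fin: "gapI 0 T w < \<infinity>"
      using elim(2) solution_inequality_real(1)[OF w order_refl less_imp_le[OF T]] by (auto simp: gapI_def)
    have lc: "continuous_on {0..T} (\<lambda>u. lin (X u w))"
      by (rule path_cont[OF w order_refl damp_weight_cont(3)[of 0]]) simp
    have q: "?q absolutely_integrable_on {0..T}"
      using weighted_gap_integral(2)[OF w order_refl fin] absolutely_integrable_continuous_real[OF lc]
      by (intro set_integral_add(1)) auto
    have J: "\<exists>J. has_rs_integral (\<lambda>u. - (X u w - z)) (\<lambda>u. K u w) (T * real i / n) (T * real (Suc i) / n) J \<and>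
        J + integral {T * real i / n..T * real (Suc i) / n} ?q \<le> 0" for n i :: nat
    proof -
      obtain J where J: "has_rs_integral (\<lambda>u. z - X u w) (\<lambda>u. K u w) (T * real i / n) (T * real (Suc i) / n) J"
        "ereal J + ereal_integral (restrict_space lborel {T * real i / n..T * real (Suc i) / n}) (\<lambda>u. \<Phi> (X u w))
          \<le> ereal (T * real (Suc i) / n - T * real i / n) * \<Phi> z"
        using elim(1) by blast
      have "0 \<le> T * real i / n" "T * real i / n \<le> T * real (Suc i) / n"
        using T by (auto intro!: divide_right_mono mult_left_mono)
      from solution_inequality_real(2)[OF w this J(2)] J(1) show ?thesis
        by (intro exI[of _ J]) simp
    qed
    have "\<forall>\<^sub>F n in sequentially. damp e (X T w) + 2 * (linI e T w + enn2real (gapI e T w)) \<le> damp e x + noise e n T w + d"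
      if e: "0 < e" and d: "0 < d" for e d
    proof -
      have e0: "0 \<le> e" using e by simp
      note wg = weighted_gap_integral[OF w e0 fin]
      note wc = path_cont[OF w order_refl continuous_on_mult[OF damp_weight_cont(2,3)[OF e0]], of T]
      have "integral {0..T} (\<lambda>u. weight e (X u w) * ?q u)
        = integral {0..T} (\<lambda>u. weight e (X u w) * lin (X u w)) + integral {0..T} (\<lambda>u. weight e (X u w) * enn2real (gap (X u w)))"
        unfolding distrib_left using wg(2)
        by (intro Henstock_Kurzweil_Integration.integral_add integrable_continuous_interval[OF wc])
           (auto simp: absolutely_integrable_on_def)
      then have int: "integral {0..T} (\<lambda>u. weight e (X u w) * ?q u) = linI e T w + enn2real (gapI e T w)"
        by (simp add: linI_def wg(3))
      have "\<forall>\<^sub>F n in sequentially.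
        (norm (X T w - z))\<^sup>2 / (1 + e * (norm (X T w - z))\<^sup>2)
          + 2 * integral {0..T} (\<lambda>u. 1 / (1 + e * (norm (X u w - z))\<^sup>2)\<^sup>2 * ?q u)
        \<le> (norm (X 0 w - z))\<^sup>2 / (1 + e * (norm (X 0 w - z))\<^sup>2)
          + (\<Sum>i<n. 1 / (1 + e * (norm (X (T * real i / n) w - z))\<^sup>2)\<^sup>2 *
             (2 * ((X (T * real i / n) w - z) \<bullet> (mart (T * real (Suc i) / n) w - mart (T * real i / n) w))
              + (norm (mart (T * real (Suc i) / n) w - mart (T * real i / n) w))\<^sup>2)) + d"
      proof (rule damped_energy_inequality[OF e0 T _ drift_cont[OF w] _ elim(4) q J _ d])
        show "continuous_on {0..T} (\<lambda>t. X t w - z)" by (intro continuous_intros X_cont_on w) simp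
        show "0 \<le> (X s w - z) \<bullet> drift s w" if "s \<in> {0..T}" for s
          using G(2)[of "X s w"] \<beta>(1)[of s] that by (simp add: drift_def)
        show "mart s w = X s w - z - (X 0 w - z) + integral {0..s} (\<lambda>t. drift t w) + (K s w - K 0 w)" for s
          by (simp add: mart_def)
      qed
      then show ?thesis
        unfolding damp_def[symmetric] weight_def[symmetric] int elim(3) noise_def .
    qed
    with w elim(3) fin show ?case by blast
  qed
qed

definition budget :: "real \<Rightarrow> real" where
  "budget T = (norm (x - z))\<^sup>2 + integral {0..T} (\<lambda>u. (Sig u)\<^sup>2)"

lemma budget_mono: "0 \<le> s \<Longrightarrow> s \<le> T \<Longrightarrow> budget s \<le> budget T" and budget_ge: "0 \<le> T \<Longrightarrow> (norm (x - z))\<^sup>2 \<le> budget T"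
proof -
  have i: "(\<lambda>u. (Sig u)\<^sup>2) integrable_on {0..T}" for T using Sig(2)[of T] by (auto simp: absolutely_integrable_on_def)
  show "budget s \<le> budget T" if "0 \<le> s" "s \<le> T"
    unfolding budget_def using that by (intro add_left_mono integral_subset_le i) auto
  show "(norm (x - z))\<^sup>2 \<le> budget T" unfolding budget_def using integral_nonneg[OF i, of T] by simp
qed

lemma norm_weight_lin:
  assumes e: "0 \<le> e"
  shows "\<bar>weight e y * lin y\<bar> \<le> norm g * (weight e y * norm (y - z))"
proof -
  have "\<bar>lin y\<bar> \<le> norm g * norm (y - z)" unfolding lin_def by (rule Cauchy_Schwarz_ineq2)
  from mult_left_mono[OF this, of "weight e y"] show ?thesis
    using damp_weight(3)[OF e, of y] by (simp add: abs_mult mult_ac)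
qed

lemma damp_integrable:
  assumes e: "0 < e" and t: "0 \<le> t"
  shows "integrable M (\<lambda>w. damp e (X t w))" "expectation (\<lambda>w. damp e (X t w)) \<le> 1 / e"
proof -
  have e0: "0 \<le> e" using e by simp
  have m: "(\<lambda>w. damp e (X t w)) \<in> borel_measurable M"
    by (rule measurable_compose[OF X_meas_M[OF t] borel_measurable_continuous_onI[OF damp_weight_cont(1)[OF e0]]])
  show i: "integrable M (\<lambda>w. damp e (X t w))"
    by (rule integrable_const_bound[of _ "1 / e", OF _ m]) (use damp_weight(1,6)[OF e0] e in auto)
  have "expectation (\<lambda>w. damp e (X t w)) \<le> expectation (\<lambda>w. 1 / e)"
    by (rule integral_mono[OF i]) (use damp_weight(6)[OF e0] e in auto)
  then show "expectation (\<lambda>w. damp e (X t w)) \<le> 1 / e" by (simp add: prob_space)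
qed

lemma linI_integrable:
  assumes e: "0 < e" and T: "0 \<le> T"
  shows "integrable M (linI e T)"
proof (rule integrable_const_bound[of _ "T * (norm g * sqrt (1 / e))"])
  have e0: "0 \<le> e" using e by simp
  show "linI e T \<in> borel_measurable M" by (rule linI_meas[OF e0 T])
  show "AE w in M. norm (linI e T w) \<le> T * (norm g * sqrt (1 / e))"
  proof (rule AE_I2)
    fix w assume w: "w \<in> space M"
    have "norm (integral {0..T} (\<lambda>u. weight e (X u w) * lin (X u w))) \<le> integral {0..T} (\<lambda>u. norm g * sqrt (1 / e))"
    proof (rule Henstock_Kurzweil_Integration.integral_norm_bound_integral)
      show "(\<lambda>u. weight e (X u w) * lin (X u w)) integrable_on {0..T}"
        by (rule integrable_continuous_interval[OF path_cont[OF w order_refl continuous_on_mult[OF damp_weight_cont(2,3)[OF e0]]]])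
      show "norm (weight e (X u w) * lin (X u w)) \<le> norm g * sqrt (1 / e)" for u
      proof -
        have "(weight e (X u w) * norm (X u w - z))\<^sup>2 \<le> 1 / e"
          using damp_weight(5,6)[OF e0, of "X u w"] e by linarith
        then have "weight e (X u w) * norm (X u w - z) \<le> sqrt (1 / e)" by (rule real_le_rsqrt)
        then have "norm g * (weight e (X u w) * norm (X u w - z)) \<le> norm g * sqrt (1 / e)"
          by (intro mult_left_mono) auto
        then show ?thesis using norm_weight_lin[OF e0, of "X u w"] by simp
      qed
    qed (rule integrable_const_ivl)
    then show "norm (linI e T w) \<le> T * (norm g * sqrt (1 / e))"
      using T by (simp add: linI_def mult_ac)
  qed
qed

lemma damped_estimate:
  assumes e: "0 < e" and T: "0 < T"
  shows "integrable M (\<lambda>w. enn2real (gapI e T w))"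
    "expectation (\<lambda>w. damp e (X T w)) + 2 * expectation (linI e T) + 2 * expectation (\<lambda>w. enn2real (gapI e T w)) \<le> budget T"
proof -
  have e0: "0 \<le> e" and T0: "0 \<le> T" using e T by auto
  interpret I: ito_process M F W "\<lambda>s w. \<sigma> s (X s w)" mart Sig T by (rule ito_process_mart)
  let ?P = "\<lambda>w. 2 * enn2real (gapI e T w)" and ?Y = "\<lambda>w. damp e (X T w) + 2 * linI e T w - damp e x"
  have Pm: "?P \<in> borel_measurable M" using gapI_meas[OF e0 T0] by measurable
  have Yi: "integrable M ?Y"
    using damp_integrable(1)[OF e T0] linI_integrable[OF e T0] by auto
  have v: "(\<lambda>w. X t w - z) \<in> borel_measurable (F t)" if "t \<in> {0..T}" for t
    using borel_measurable_diff[OF X_meas[of t] borel_measurable_const] that by simp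
  have lim: "AE w in M. \<forall>d>0. \<forall>\<^sub>F n in sequentially. ?P w + ?Y w \<le>
      (\<Sum>i<n. (1 / (1 + e * (norm (X (T * real i / n) w - z))\<^sup>2)\<^sup>2) *
        (2 * ((X (T * real i / n) w - z) \<bullet> (mart (T * real (Suc i) / n) w - mart (T * real i / n) w))
          + (norm (mart (T * real (Suc i) / n) w - mart (T * real i / n) w))\<^sup>2)) + d"
    using pathwise_inequality[OF T]
  proof eventually_elim
    case (elim w)
    have arith: "2 * c + (a + 2 * b - a') \<le> S + d" if "a + 2 * (b + c) \<le> a' + S + d" for a a' b c d S :: real
      using that by (simp add: algebra_simps)
    show ?case
    proof (intro allI impI)
      fix d :: real assume d: "0 < d"
      with elim e have "\<forall>\<^sub>F n in sequentially.
        damp e (X T w) + 2 * (linI e T w + enn2real (gapI e T w)) \<le> damp e x + noise e n T w + d" by blast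
      then show "\<forall>\<^sub>F n in sequentially. ?P w + ?Y w \<le>
      (\<Sum>i<n. (1 / (1 + e * (norm (X (T * real i / n) w - z))\<^sup>2)\<^sup>2) *
        (2 * ((X (T * real i / n) w - z) \<bullet> (mart (T * real (Suc i) / n) w - mart (T * real i / n) w))
          + (norm (mart (T * real (Suc i) / n) w - mart (T * real i / n) w))\<^sup>2)) + d"
        unfolding noise_def weight_def by (rule eventually_mono) (rule arith)
    qed
  qed
  note r = I.damped_expectation[OF e T v Pm _ Yi lim]
  have Pi: "integrable M ?P" and le: "expectation ?P + expectation ?Y \<le> I.energy 0 T" using r by auto
  show "integrable M (\<lambda>w. enn2real (gapI e T w))" using Pi by simp
  have "expectation ?Y = expectation (\<lambda>w. damp e (X T w)) + 2 * expectation (linI e T) - damp e x"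
    using damp_integrable(1)[OF e T0] linI_integrable[OF e T0] by (simp add: prob_space)
  then show "expectation (\<lambda>w. damp e (X T w)) + 2 * expectation (linI e T) + 2 * expectation (\<lambda>w. enn2real (gapI e T w)) \<le> budget T"
    using le damp_weight(2)[OF e0, of x] by (simp add: budget_def I.energy_def)
qed

text \<open>The affine part contributes at most \<open>|g|\<close> times the weighted distance to \<open>z\<close>, whose square is at
  most the damped squared distance. By Young's inequality, half of the supremum \<open>U\<close> of the damped
  second moments appears on the right-hand side. It can be absorbed because damping makes \<open>U\<close>
  finite, and the resulting bound no longer depends on \<open>e\<close>.\<close>

lemma damped_moment_bound:
  assumes e: "0 < e" and T: "0 < T" and s: "s \<in> {0..T}"
  shows "expectation (\<lambda>w. damp e (X s w)) \<le> 2 * (budget T + 2 * T\<^sup>2 * (norm g)\<^sup>2)"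
proof -
  have e0: "0 \<le> e" using e by simp
  let ?u = "\<lambda>s. expectation (\<lambda>w. damp e (X s w))"
  define U where "U = (SUP s\<in>{0..T}. ?u s)"
  have bdd: "bdd_above (?u ` {0..T})"
    by (rule bdd_aboveI2[of _ _ "1 / e"]) (use damp_integrable(2)[OF e] in auto)
  have uU: "?u s \<le> U" if "s \<in> {0..T}" for s unfolding U_def by (rule cSUP_upper[OF that bdd])
  have U0: "0 \<le> U"
    using order_trans[OF Bochner_Integration.integral_nonneg uU[of 0]] damp_weight(1)[OF e0] T by auto
  have step: "?u s \<le> budget T + 2 * T\<^sup>2 * (norm g)\<^sup>2 + U / 2" if s: "s \<in> {0..T}" for s
  proof (cases "s = 0")
    case True
    have "?u 0 = expectation (\<lambda>w. damp e x)"
      by (rule integral_cong_AE)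
         (use X0 in \<open>auto intro!: measurable_compose[OF X_meas_M borel_measurable_continuous_onI[OF damp_weight_cont(1)[OF e0]]]\<close>)
    also have "\<dots> \<le> budget T" using damp_weight(2)[OF e0, of x] budget_ge[of T] T by (simp add: prob_space)
    finally have "?u 0 \<le> budget T" .
    moreover have "0 \<le> 2 * T\<^sup>2 * (norm g)\<^sup>2" by simp
    ultimately show ?thesis unfolding True using U0 by linarith
  next
    case False
    then have s0: "0 < s" "s \<le> T" "0 \<le> s" using s by auto
    let ?D = "\<lambda>w. integral {0..s} (\<lambda>r. damp e (X r w))"
    have D: "integrable M ?D" "expectation ?D \<le> s * U"
    proof -
      have m: "(\<lambda>w. damp e (X t w)) \<in> borel_measurable M" if "t \<in> {0..s}" for t
        using damp_integrable(1)[OF e, of t] that by auto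
      have c: "continuous_on {0..s} (\<lambda>t. damp e (X t w))" if "w \<in> space M" for w
        by (rule path_cont[OF that order_refl damp_weight_cont(1)[OF e0]])
      have i: "integrable M (\<lambda>w. damp e (X t w)) \<and> ?u t \<le> U" if "t \<in> {0..s}" for t
        using damp_integrable(1)[OF e, of t] uU[of t] that s0 by auto
      show "integrable M ?D" "expectation ?D \<le> s * U"
        using continuous_process_mean_integral[of s "\<lambda>r w. damp e (X r w)", OF m damp_weight(1)[OF e0] c s0(3) i]
        by auto
    qed
    have low: "- 2 * linI e s w \<le> (1 / (2 * T)) * ?D w + s * (2 * T * (norm g)\<^sup>2)" if w: "w \<in> space M" for w
    proof -
      have di: "(\<lambda>r. damp e (X r w)) integrable_on {0..s}"
        by (rule integrable_continuous_interval[OF path_cont[OF w order_refl damp_weight_cont(1)[OF e0]]])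
      have li: "(\<lambda>r. weight e (X r w) * lin (X r w)) integrable_on {0..s}"
        by (rule integrable_continuous_interval[OF path_cont[OF w order_refl continuous_on_mult[OF damp_weight_cont(2,3)[OF e0]]]])
      have "integral {0..s} (\<lambda>r. (- 2) * (weight e (X r w) * lin (X r w)))
         \<le> integral {0..s} (\<lambda>r. (1 / (2 * T)) * damp e (X r w) + 2 * T * (norm g)\<^sup>2)"
      proof (rule integral_le)
        have arith: "X \<le> (1 / (2 * T)) * b + c" if "A \<le> a + c" "a \<le> b / (2 * T)" "X \<le> A" for X A a b c :: real
          using that by simp
        fix r
        let ?y = "weight e (X r w) * norm (X r w - z)"
        have "0 \<le> (?y - 2 * T * norm g)\<^sup>2 / (2 * T)" using T by simp
        also have "\<dots> = ?y\<^sup>2 / (2 * T) - 2 * (norm g * ?y) + 2 * T * (norm g)\<^sup>2"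
          using T by (simp add: power2_diff field_simps power2_eq_square)
        finally have "2 * (norm g * ?y) \<le> ?y\<^sup>2 / (2 * T) + 2 * T * (norm g)\<^sup>2" by linarith
        moreover have "?y\<^sup>2 / (2 * T) \<le> damp e (X r w) / (2 * T)"
          using damp_weight(5)[OF e0, of "X r w"] T by (intro divide_right_mono) auto
        moreover have "(- 2) * (weight e (X r w) * lin (X r w)) \<le> 2 * (norm g * ?y)"
        proof -
          have dbl: "(- 2) * a \<le> 2 * b" if "- a \<le> b" for a b :: real using that by simp
          show ?thesis
            by (rule dbl[OF order_trans[OF abs_ge_minus_self norm_weight_lin[OF e0, of "X r w"]]])
        qed
        ultimately show "(- 2) * (weight e (X r w) * lin (X r w)) \<le> (1 / (2 * T)) * damp e (X r w) + 2 * T * (norm g)\<^sup>2"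
          by (rule arith)
      qed (intro integrable_on_mult_right li integrable_add di integrable_const_ivl)+
      moreover have "integral {0..s} (\<lambda>r. (1 / (2 * T)) * damp e (X r w) + 2 * T * (norm g)\<^sup>2)
        = (1 / (2 * T)) * ?D w + s * (2 * T * (norm g)\<^sup>2)"
        using s0 by (subst Henstock_Kurzweil_Integration.integral_add)
          (auto intro!: integrable_on_mult_right di simp del: times_divide_eq_left mult_minus_left)
      ultimately show ?thesis by (simp only: Henstock_Kurzweil_Integration.integral_mult_right linI_def)
    qed
    have "expectation (\<lambda>w. - 2 * linI e s w) \<le> expectation (\<lambda>w. (1 / (2 * T)) * ?D w + s * (2 * T * (norm g)\<^sup>2))"
      by (rule integral_mono) (use linI_integrable[OF e s0(3)] D(1) low in auto)
    then have "- 2 * expectation (linI e s) \<le> (1 / (2 * T)) * expectation ?D + s * (2 * T * (norm g)\<^sup>2)"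
      using D(1) by (simp add: prob_space)
    moreover have "(1 / (2 * T)) * expectation ?D \<le> (1 / (2 * T)) * (T * U)"
      using D(2) mult_right_mono[OF s0(2) U0] T by (intro mult_left_mono) auto
    moreover have "s * (2 * T * (norm g)\<^sup>2) \<le> T * (2 * T * (norm g)\<^sup>2)"
      using s0 T by (intro mult_right_mono) auto
    moreover have "?u s + 2 * expectation (linI e s) \<le> budget T"
    proof -
      have "0 \<le> expectation (\<lambda>w. enn2real (gapI e s w))" by (rule Bochner_Integration.integral_nonneg) simp
      then show ?thesis using damped_estimate(2)[OF e s0(1)] budget_mono[OF s0(3,2)] by linarith
    qed
    ultimately have "?u s \<le> budget T + ((1 / (2 * T)) * (T * U) + T * (2 * T * (norm g)\<^sup>2))" by linarith
    also have "\<dots> = budget T + 2 * T\<^sup>2 * (norm g)\<^sup>2 + U / 2" using T by (simp add: power2_eq_square)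
    finally show ?thesis .
  qed
  have U_le: "U \<le> budget T + 2 * T\<^sup>2 * (norm g)\<^sup>2 + U / 2"
    unfolding U_def by (rule cSUP_least) (use T step[unfolded U_def] in auto)
  have absorb: "a \<le> 2 * b" if "c \<le> b + c / 2" "a \<le> c" for a b c :: real using that by linarith
  show ?thesis by (rule absorb[OF U_le uU[OF s]])
qed

text \<open>The moment bound is uniform in the damping, so it passes to the undamped second moment by Fatou's
  lemma.\<close>

lemma distance_integrable:
  assumes T: "0 < T"
  shows "integrable M (\<lambda>w. integral {0..T} (\<lambda>u. norm (X u w - z)))"
proof -
  define k where "k = 2 * (budget T + 2 * T\<^sup>2 * (norm g)\<^sup>2)"
  have k0: "0 \<le> k"
    using budget_ge[of T] T order_trans[OF zero_le_power2 budget_ge[of T]] by (simp add: k_def)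
  have sq: "integrable M (\<lambda>w. (norm (X s w - z))\<^sup>2) \<and> expectation (\<lambda>w. (norm (X s w - z))\<^sup>2) \<le> k"
    if s: "s \<in> {0..T}" for s
  proof -
    have [measurable]: "X s \<in> borel_measurable M" using s by auto
    define e where "e = (\<lambda>n. 1 / real (Suc n))"
    have e: "0 < e n" for n by (simp add: e_def)
    have "(sqnorm M (\<lambda>w. X s w - z)) = (\<integral>\<^sup>+w. liminf (\<lambda>n. ennreal (damp (e n) (X s w))) \<partial>M)"
    proof (rule nn_integral_cong)
      fix w
      have e_lim: "e \<longlonglongrightarrow> 0" unfolding e_def by (rule LIMSEQ_Suc[OF lim_const_over_n])
      have "(\<lambda>n. damp (e n) (X s w)) \<longlonglongrightarrow> (norm (X s w - z))\<^sup>2 / (1 + 0 * (norm (X s w - z))\<^sup>2)"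
        unfolding damp_def by (intro tendsto_intros e_lim) simp
      then have "(\<lambda>n. ennreal (damp (e n) (X s w))) \<longlonglongrightarrow> ennreal ((norm (X s w - z))\<^sup>2)" by (intro tendsto_ennrealI) simp
      then show "ennreal ((norm (X s w - z))\<^sup>2) = liminf (\<lambda>n. ennreal (damp (e n) (X s w)))"
        by (simp add: lim_imp_Liminf)
    qed
    also have "\<dots> \<le> liminf (\<lambda>n. \<integral>\<^sup>+w. ennreal (damp (e n) (X s w)) \<partial>M)"
    proof (rule nn_integral_liminf)
      show "(\<lambda>w. ennreal (damp (e n) (X s w))) \<in> borel_measurable M" for n
        using damp_integrable(1)[OF e, of s n] s by auto
    qed
    also have "\<dots> \<le> limsup (\<lambda>n. \<integral>\<^sup>+w. ennreal (damp (e n) (X s w)) \<partial>M)" by (rule Liminf_le_Limsup) simp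
    also have "\<dots> \<le> ennreal k"
    proof (rule Limsup_bounded, rule always_eventually, rule allI)
      fix n
      have "(\<integral>\<^sup>+w. ennreal (damp (e n) (X s w)) \<partial>M) = ennreal (expectation (\<lambda>w. damp (e n) (X s w)))"
        using damp_integrable(1)[OF e, of s n] damp_weight(1)[of "e n"] e[of n] s
        by (intro nn_integral_eq_integral) auto
      then show "(\<integral>\<^sup>+w. ennreal (damp (e n) (X s w)) \<partial>M) \<le> ennreal k"
        using damped_moment_bound[OF e T s] by (simp add: k_def ennreal_leI)
    qed
    finally have le: "(sqnorm M (\<lambda>w. X s w - z)) \<le> ennreal k" .
    then have "(sqnorm M (\<lambda>w. X s w - z)) < \<infinity>" by (rule le_less_trans) simp
    then have i: "integrable M (\<lambda>w. (norm (X s w - z))\<^sup>2)" by (intro integrableI_nonneg) auto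
    then show ?thesis using le k0 by (simp add: nn_integral_eq_integral)
  qed
  have n1: "integrable M (\<lambda>w. norm (X s w - z)) \<and> expectation (\<lambda>w. norm (X s w - z)) \<le> 1 + k"
    if s: "s \<in> {0..T}" for s
  proof -
    have [measurable]: "X s \<in> borel_measurable M" using s by auto
    have le: "r \<le> 1 + r\<^sup>2" if "0 \<le> r" for r :: real
      using zero_le_power2[of "r - 1"] that by (simp add: power2_diff)
    have i2: "integrable M (\<lambda>w. 1 + (norm (X s w - z))\<^sup>2)" using sq[OF s] by auto
    have i: "integrable M (\<lambda>w. norm (X s w - z))"
      by (rule Bochner_Integration.integrable_bound[OF i2]) (use le in auto)
    have "expectation (\<lambda>w. norm (X s w - z)) \<le> expectation (\<lambda>w. 1 + (norm (X s w - z))\<^sup>2)"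
      by (rule integral_mono[OF i i2]) (use le in auto)
    then show ?thesis using i sq[OF s] by (simp add: prob_space)
  qed
  have nc: "continuous_on UNIV (\<lambda>y. norm (y - z))" by (intro continuous_intros)
  show ?thesis
    by (rule continuous_process_mean_integral(1)[where k="1 + k"])
       (use n1 T path_cont[OF _ order_refl nc] in auto)
qed

text \<open>As \<open>e\<close> tends to 0 the weights tend to 1. The gap is nonnegative, so Fatou's lemma applies to it
  twice, in time and on the probability space. The affine part is dominated by a multiple of the
  distance to \<open>z\<close>.\<close>

lemma undamped_estimate:
  assumes T: "0 < T"
  shows "AE w in M. gapI 0 T w < \<infinity>" "integrable M (linI 0 T)" "integrable M (\<lambda>w. enn2real (gapI 0 T w))"
    "expectation (linI 0 T) + expectation (\<lambda>w. enn2real (gapI 0 T w)) \<le> budget T / 2"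
proof -
  have T0: "0 \<le> T" using T by simp
  define e where "e = (\<lambda>n. 1 / real (Suc n))"
  have e: "0 < e n" "0 \<le> e n" for n by (simp_all add: e_def)
  have e_lim: "e \<longlonglongrightarrow> 0" unfolding e_def by (rule LIMSEQ_Suc[OF lim_const_over_n])
  have w_lim: "(\<lambda>n. weight (e n) y) \<longlonglongrightarrow> 1" for y
  proof -
    have "(\<lambda>n. weight (e n) y) \<longlonglongrightarrow> 1 / (1 + 0 * (norm (y - z))\<^sup>2)\<^sup>2"
      unfolding weight_def by (intro tendsto_intros e_lim) simp
    then show ?thesis by simp
  qed
  show fin: "AE w in M. gapI 0 T w < \<infinity>" using pathwise_inequality[OF T] by eventually_elim simp
  have wl: "continuous_on UNIV (\<lambda>y. weight e y * lin y)" if "0 \<le> e" for e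
    by (intro continuous_intros damp_weight_cont[OF that])
  let ?V = "\<lambda>w. integral {0..T} (\<lambda>u. norm (X u w - z))"
  have Vi: "integrable M (\<lambda>w. norm g * ?V w)" using distance_integrable[OF T] by auto
  have nc: "continuous_on UNIV (\<lambda>y. norm g * norm (y - z))" by (intro continuous_intros)
  have wle: "norm (weight e y * lin y) \<le> norm g * norm (y - z)" if "0 \<le> e" for e y
    using norm_weight_lin[OF that, of y] mult_right_mono[OF damp_weight(4)[OF that, of y], of "norm (y - z)"]
    by (simp add: order_trans[OF _ mult_left_mono])
  have linV: "norm (linI e T w) \<le> norm g * ?V w" if w: "w \<in> space M" and e: "0 \<le> e" for e w
  proof -
    have "norm (linI e T w) \<le> integral {0..T} (\<lambda>u. norm g * norm (X u w - z))"
      unfolding linI_def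
      by (rule Henstock_Kurzweil_Integration.integral_norm_bound_integral)
         (use wle[OF e] in \<open>auto intro: integrable_continuous_interval path_cont[OF w order_refl wl[OF e]] path_cont[OF w order_refl nc]\<close>)
    then show ?thesis by simp
  qed
  have lin_lim: "(\<lambda>n. linI (e n) T w) \<longlonglongrightarrow> linI 0 T w" if w: "w \<in> space M" for w
    unfolding linI_def
  proof (rule dominated_convergence(2))
    show "(\<lambda>u. weight (e n) (X u w) * lin (X u w)) integrable_on {0..T}" for n
      by (rule integrable_continuous_interval[OF path_cont[OF w order_refl wl[OF e(2)]]])
    show "(\<lambda>u. norm g * norm (X u w - z)) integrable_on {0..T}"
      by (rule integrable_continuous_interval[OF path_cont[OF w order_refl nc]])
    show "norm (weight (e n) (X u w) * lin (X u w)) \<le> norm g * norm (X u w - z)" for n u by (rule wle[OF e(2)])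
    show "(\<lambda>n. weight (e n) (X u w) * lin (X u w)) \<longlonglongrightarrow> weight 0 (X u w) * lin (X u w)" for u
      using tendsto_mult[OF w_lim tendsto_const] by simp
  qed
  have linm: "linI 0 T \<in> borel_measurable M" "\<And>n. linI (e n) T \<in> borel_measurable M"
    by (intro linI_meas T0 e order_refl)+
  have E_lim: "(\<lambda>n. expectation (linI (e n) T)) \<longlonglongrightarrow> expectation (linI 0 T)"
    by (rule integral_dominated_convergence[OF linm Vi])
       (use lin_lim linV e(2) in auto)
  show li: "integrable M (linI 0 T)"
    by (rule Bochner_Integration.integrable_bound[OF Vi linm(1)]) (use linV[of _ 0] in \<open>auto intro: order_trans[OF _ abs_ge_self]\<close>)
  let ?G = "\<lambda>n. expectation (\<lambda>w. enn2real (gapI (e n) T w))"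
  have G: "0 \<le> ?G n" "?G n \<le> budget T / 2 - expectation (linI (e n) T)" for n
  proof -
    show "0 \<le> ?G n" by (rule Bochner_Integration.integral_nonneg) simp
    have "0 \<le> expectation (\<lambda>w. damp (e n) (X T w))" by (rule Bochner_Integration.integral_nonneg) (rule damp_weight(1)[OF e(2)])
    then show "?G n \<le> budget T / 2 - expectation (linI (e n) T)" using damped_estimate(2)[OF e(1) T, of n] by linarith
  qed
  have R_lim: "(\<lambda>n. budget T / 2 - expectation (linI (e n) T)) \<longlonglongrightarrow> budget T / 2 - expectation (linI 0 T)"
    by (intro tendsto_intros E_lim)
  have R0: "0 \<le> budget T / 2 - expectation (linI 0 T)"
    by (rule LIMSEQ_le_const[OF R_lim]) (use order_trans[OF G] in blast)
  have nnG: "(\<integral>\<^sup>+w. gapI (e n) T w \<partial>M) = ennreal (?G n)" for n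
  proof -
    have "(\<integral>\<^sup>+w. gapI (e n) T w \<partial>M) = (\<integral>\<^sup>+w. ennreal (enn2real (gapI (e n) T w)) \<partial>M)"
    proof (rule nn_integral_cong_AE)
      show "AE w in M. gapI (e n) T w = ennreal (enn2real (gapI (e n) T w))"
        using fin AE_space by eventually_elim (use weighted_gap_integral(1)[OF _ e(2)] in auto)
    qed
    also have "\<dots> = ennreal (?G n)" by (rule nn_integral_eq_integral[OF damped_estimate(1)[OF e(1) T]]) simp
    finally show ?thesis .
  qed
  have "(\<integral>\<^sup>+w. gapI 0 T w \<partial>M) \<le> (\<integral>\<^sup>+w. liminf (\<lambda>n. gapI (e n) T w) \<partial>M)"
  proof (rule nn_integral_mono)
    fix w assume w: "w \<in> space M"
    have "gapI 0 T w = (\<integral>\<^sup>+u. liminf (\<lambda>n. ennreal (weight (e n) (X u w)) * gap (X u w) * indicator {0..T} u) \<partial>lborel)"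
      unfolding gapI_def
    proof (rule nn_integral_cong)
      fix u
      have "(\<lambda>n. ennreal (weight (e n) (X u w)) * (gap (X u w) * indicator {0..T} u)) \<longlonglongrightarrow> ennreal 1 * (gap (X u w) * indicator {0..T} u)"
        by (intro tendsto_mult_ennreal tendsto_ennrealI w_lim tendsto_const) simp
      then have "(\<lambda>n. ennreal (weight (e n) (X u w)) * gap (X u w) * indicator {0..T} u) \<longlonglongrightarrow> gap (X u w) * indicator {0..T} u"
        by (simp add: mult.assoc)
      from lim_imp_Liminf[OF _ this] show "ennreal (weight 0 (X u w)) * gap (X u w) * indicator {0..T} u
        = liminf (\<lambda>n. ennreal (weight (e n) (X u w)) * gap (X u w) * indicator {0..T} u)" by simp
    qed
    also have "\<dots> \<le> liminf (\<lambda>n. gapI (e n) T w)"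
      unfolding gapI_def by (rule nn_integral_liminf) (use gap_path_measurable[OF w e(2)] in simp)
    finally show "gapI 0 T w \<le> liminf (\<lambda>n. gapI (e n) T w)" .
  qed
  also have "\<dots> \<le> liminf (\<lambda>n. \<integral>\<^sup>+w. gapI (e n) T w \<partial>M)" by (rule nn_integral_liminf) (rule gapI_meas[OF e(2) T0])
  also have "\<dots> \<le> liminf (\<lambda>n. ennreal (budget T / 2 - expectation (linI (e n) T)))"
    unfolding nnG by (intro Liminf_mono always_eventually allI ennreal_leI G)
  also have "\<dots> = ennreal (budget T / 2 - expectation (linI 0 T))"
    by (intro lim_imp_Liminf tendsto_ennrealI R_lim) simp
  finally have le: "(\<integral>\<^sup>+w. gapI 0 T w \<partial>M) \<le> ennreal (budget T / 2 - expectation (linI 0 T))" .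
  have eq: "(\<integral>\<^sup>+w. ennreal (enn2real (gapI 0 T w)) \<partial>M) = (\<integral>\<^sup>+w. gapI 0 T w \<partial>M)"
    by (rule nn_integral_cong_AE) (use fin in eventually_elim, simp)
  have [measurable]: "gapI 0 T \<in> borel_measurable M" by (rule gapI_meas[OF order_refl T0])
  have "(\<integral>\<^sup>+w. ennreal (enn2real (gapI 0 T w)) \<partial>M) < \<infinity>"
    unfolding eq using le by (rule le_less_trans) simp
  then show gi: "integrable M (\<lambda>w. enn2real (gapI 0 T w))" by (intro integrableI_nonneg) auto
  show "expectation (linI 0 T) + expectation (\<lambda>w. enn2real (gapI 0 T w)) \<le> budget T / 2"
    using le R0 unfolding eq[symmetric] by (simp add: nn_integral_eq_integral gi)
qed

text \<open>The affine part commutes with averaging, which gives the lower bound. For the upper bound, the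
  average of points of the epigraph of \<open>\<Phi>\<close> lies in the epigraph.\<close>

lemma average_bounds:
  assumes w: "w \<in> space M" and T: "0 < T" and fin: "gapI 0 T w < \<infinity>"
  shows "ereal (linI 0 T w / T) \<le> \<Phi> (time_average X T w) - ereal \<phi>"
    "\<Phi> (time_average X T w) - ereal \<phi> \<le> ereal ((linI 0 T w + enn2real (gapI 0 T w)) / T)"
proof -
  have Xi: "(\<lambda>u. X u w) integrable_on {0..T}"
    by (rule integrable_continuous_interval[OF X_cont_on[OF w order_refl]])
  have li: "(\<lambda>u. lin (X u w)) integrable_on {0..T}"
    by (rule integrable_continuous_interval[OF path_cont[OF w order_refl damp_weight_cont(3)[of 0]]]) simp
  have gi: "(\<lambda>u. enn2real (gap (X u w))) integrable_on {0..T}"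
    "integral {0..T} (\<lambda>u. enn2real (gap (X u w))) = enn2real (gapI 0 T w)"
    using weighted_gap_integral(2,3)[OF w order_refl fin] by (auto simp: absolutely_integrable_on_def)
  have lin_avg: "lin (time_average X T w) = linI 0 T w / T"
  proof -
    have "linI 0 T w = integral {0..T} (\<lambda>u. g \<bullet> X u w - g \<bullet> z)"
      by (simp add: linI_def lin_def inner_diff_right)
    also have "\<dots> = g \<bullet> integral {0..T} (\<lambda>u. X u w) - T * (g \<bullet> z)"
      using integral_linear[OF Xi bounded_linear_inner_right[of g]] integrable_linear[OF Xi bounded_linear_inner_right[of g]] T
      by (subst Henstock_Kurzweil_Integration.integral_diff) (auto simp: o_def)
    finally show ?thesis using T by (simp add: lin_def time_average_def inner_diff_right field_simps)
  qed
  have "ereal (\<phi> + linI 0 T w / T) \<le> \<Phi> (time_average X T w)"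
    using z(2)[of "time_average X T w"] lin_avg by (simp add: lin_def)
  then show "ereal (linI 0 T w / T) \<le> \<Phi> (time_average X T w) - ereal \<phi>"
    by (cases "\<Phi> (time_average X T w)") auto
  let ?r = "\<lambda>u. \<phi> + lin (X u w) + enn2real (gap (X u w))"
  have r: "(?r has_integral T * \<phi> + linI 0 T w + enn2real (gapI 0 T w)) {0..T}"
    using has_integral_add[OF has_integral_add[OF has_integral_const_real[of \<phi> 0 T] integrable_integral[OF li]] integrable_integral[OF gi(1)]]
      T by (simp add: gi(2) linI_def)
  have f: "((\<lambda>u. (X u w, ?r u)) has_integral
      (integral {0..T} (\<lambda>u. X u w), T * \<phi> + linI 0 T w + enn2real (gapI 0 T w))) {0..T}"
    using has_integral_add[OF
        has_integral_linear[OF integrable_integral[OF Xi] bounded_linear_Pair[OF bounded_linear_ident bounded_linear_zero]]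
        has_integral_linear[OF r bounded_linear_Pair[OF bounded_linear_zero bounded_linear_ident]]]
    by (simp add: o_def)
  have neg: "negligible {u \<in> {0..T}. gap (X u w) = \<infinity>}"
    using enn2real_integral_on_interval(3)[OF gap_path_measurable[OF w order_refl] fin[unfolded gapI_def]] by simp
  have "(1 / T) *\<^sub>R integral {0..T} (\<lambda>u. (X u w, ?r u)) \<in> epigraph \<Phi>"
  proof (rule average_in_closed_convex[OF closed_epigraph[OF \<Phi>(2)] convex_epigraph[OF \<Phi>(1)] T has_integral_integrable[OF f] neg])
    fix u assume u: "u \<in> {0..T} - {u \<in> {0..T}. gap (X u w) = \<infinity>}"
    let ?y = "X u w"
    have "ereal (\<phi> + lin ?y) \<le> \<Phi> ?y" using z(2)[of ?y] by (simp add: lin_def)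
    moreover have "gap ?y \<noteq> \<infinity>" using u by auto
    ultimately have "\<Phi> ?y = ereal (\<phi> + lin ?y + enn2real (gap ?y))"
      by (cases "\<Phi> ?y") (auto simp: gap_def e2ennreal_ereal)
    then show "(?y, ?r u) \<in> epigraph \<Phi>" by (simp add: epigraph_def)
  qed
  then have "\<Phi> (time_average X T w) \<le> ereal ((1 / T) * (T * \<phi> + linI 0 T w + enn2real (gapI 0 T w)))"
    unfolding integral_unique[OF f] by (simp add: epigraph_def time_average_def)
  also have "(1 / T) * (T * \<phi> + linI 0 T w + enn2real (gapI 0 T w)) = \<phi> + (linI 0 T w + enn2real (gapI 0 T w)) / T"
    using T by (simp add: field_simps)
  finally show "\<Phi> (time_average X T w) - ereal \<phi> \<le> ereal ((linI 0 T w + enn2real (gapI 0 T w)) / T)"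
    by (cases "\<Phi> (time_average X T w)") auto
qed

lemma expected_gap_of_average:
  assumes T: "0 < T"
  shows "ereal_quasi_integrable M (\<lambda>w. \<Phi> (time_average X T w) - ereal \<phi>)"
    "ereal_integral M (\<lambda>w. \<Phi> (time_average X T w) - ereal \<phi>) \<le> ereal (budget T / (2 * T))"
proof -
  note u = undamped_estimate[OF T]
  have am: "time_average X T \<in> borel_measurable M"
  proof -
    have "(\<lambda>w. integral {0..T} (\<lambda>s. X s w)) \<in> borel_measurable M"
      by (rule continuous_process_integral_measurable) (use T X_cont_on in auto)
    then show ?thesis unfolding time_average_def[abs_def] by measurable
  qed
  have m: "(\<lambda>w. \<Phi> (time_average X T w) - ereal \<phi>) \<in> borel_measurable M"
    using measurable_compose[OF am lower_semicont_borel[OF \<Phi>(2)]] by measurable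
  let ?U = "\<lambda>w. (linI 0 T w + enn2real (gapI 0 T w)) / T"
  have ae: "AE w in M. ereal (linI 0 T w / T) \<le> \<Phi> (time_average X T w) - ereal \<phi> \<and>
     \<Phi> (time_average X T w) - ereal \<phi> \<le> ereal (?U w)"
    using u(1) AE_space by eventually_elim (use average_bounds[OF _ T] in blast)
  have Li: "integrable M (\<lambda>w. linI 0 T w / T)" and Ui: "integrable M ?U" using u(2,3) by auto
  note r = ereal_integral_le_expectation[OF m Li Ui ae]
  show "ereal_quasi_integrable M (\<lambda>w. \<Phi> (time_average X T w) - ereal \<phi>)" by (rule r(1))
  have "expectation ?U = (expectation (linI 0 T) + expectation (\<lambda>w. enn2real (gapI 0 T w))) / T"
    using u(2,3) by simp
  also have "\<dots> \<le> (budget T / 2) / T" using u(4) T by (intro divide_right_mono) auto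
  finally have "expectation ?U \<le> budget T / (2 * T)" by simp
  with r(2) show "ereal_integral M (\<lambda>w. \<Phi> (time_average X T w) - ereal \<phi>) \<le> ereal (budget T / (2 * T))"
    by (meson ereal_less_eq(3) order_trans)
qed

end

section \<open>The ergodic rate\<close>

lemma convex_gradient_inequality:
  fixes f :: "'a::real_inner \<Rightarrow> real"
  assumes f: "convex_on UNIV f" and D: "GDERIV f y :> D"
  shows "f y + D \<bullet> (z - y) \<le> f z"
proof -
  let ?p = "\<lambda>s::real. y + s *\<^sub>R (z - y)"
  have "convex_on UNIV (\<lambda>s. f (?p s))"
  proof (rule convex_onI)
    fix t a b :: real assume t: "0 < t" "t < 1"
    have "?p ((1 - t) *\<^sub>R a + t *\<^sub>R b) = (1 - t) *\<^sub>R ?p a + t *\<^sub>R ?p b"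
      by (simp add: algebra_simps)
    then show "f (?p ((1 - t) *\<^sub>R a + t *\<^sub>R b)) \<le> (1 - t) * f (?p a) + t * f (?p b)"
      using convex_onD[OF f, of t "?p a" "?p b"] t by simp
  qed simp
  moreover have "((\<lambda>s. f (?p s)) has_real_derivative D \<bullet> (z - y)) (at 0)"
  proof -
    have p: "(?p has_derivative (\<lambda>h. h *\<^sub>R (z - y))) (at 0)"
      by (auto intro!: derivative_eq_intros)
    have "(f has_derivative (\<lambda>h. h \<bullet> D)) (at (?p 0))" using D by (simp add: gderiv_def)
    from has_derivative_compose[OF p this]
    have "((\<lambda>s. f (?p s)) has_derivative (\<lambda>h. h * (D \<bullet> (z - y)))) (at 0)" by (simp add: inner_commute)
    moreover have "(\<lambda>h. h * (D \<bullet> (z - y))) = (*) (D \<bullet> (z - y))" by (simp add: fun_eq_iff mult.commute)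
    ultimately show ?thesis by (simp only: has_field_derivative_def)
  qed
  ultimately have "(D \<bullet> (z - y)) * (1 - 0) \<le> f (?p 1) - f (?p 0)"
    by (intro convex_on_imp_above_tangent[where A=UNIV]) auto
  then show ?thesis by simp
qed

theorem proposition4p6:
  fixes M :: "'w measure" and F :: "real \<Rightarrow> 'w measure"
    and W :: "real \<Rightarrow> 'w \<Rightarrow> real ^ 'm"
    and \<Phi> :: "real ^ 'd \<Rightarrow> ereal" and \<Psi> :: "real ^ 'd \<Rightarrow> real" and grad_\<Psi> :: "real ^ 'd \<Rightarrow> real ^ 'd"
    and C S :: "(real ^ 'd) set" and \<beta> l Sig :: "real \<Rightarrow> real"
    and \<sigma> :: "real \<Rightarrow> real ^ 'd \<Rightarrow> real ^ 'm ^ 'd"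
    and x :: "real ^ 'd" and X :: "real \<Rightarrow> 'w \<Rightarrow> real ^ 'd"
  assumes prob: "prob_space M" and filt: "filtration_halfline M F" and bm: "brownian_motion M F W"
    and \<Phi>: "proper_fun \<Phi>" "convex_fun \<Phi>" "lower_semicont \<Phi>"
    and C: "C \<noteq> {}" "closed C" "convex C"
    and int_dom: "interior (op_dom (subdiff \<Phi>)) \<noteq> {}"
    and max_mono: "maximal_monotone_op (op_sum (subdiff \<Phi>) (normal_cone C))"
    and S: "S = zer (op_sum (subdiff \<Phi>) (normal_cone C))" "S = minimizers_on C \<Phi>" "S \<noteq> {}"
    and \<Psi>: "convex_on UNIV \<Psi>" "\<forall>u. GDERIV \<Psi> u :> grad_\<Psi> u" "continuous_on UNIV grad_\<Psi>"
      "\<exists>L. L-lipschitz_on UNIV grad_\<Psi>"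
    and C_\<Psi>: "C = {u. \<Psi> u = 0}" "C = minimizers_on UNIV \<Psi>"
    and \<beta>: "\<forall>t\<ge>0. 0 < \<beta> t" "locally_abs_cont_halfline \<beta>" "mono_on {0..} \<beta>"
    and attouch_czarnecki: "\<forall>q \<in> op_range (normal_cone C).
      ereal_integral (restrict_space lborel {0..})
        (\<lambda>r. ereal (\<beta> r) * (fenchel_conj \<Psi> (q /\<^sub>R \<beta> r) - support_fun C (q /\<^sub>R \<beta> r))) < \<infinity>"
    and \<sigma>_meas: "(\<lambda>(t, y). \<sigma> t y) \<in> borel_measurable (restrict_space borel ({0..} \<times> UNIV))"
    and \<sigma>_lip: "\<forall>t\<ge>0. \<forall>y z. norm (\<sigma> t y - \<sigma> t z) \<le> l t * norm (y - z)"
    and l: "\<forall>t\<ge>0. 0 \<le> l t" "L2_halfline l"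
    and Sig: "\<forall>t\<ge>0. bdd_above (range (\<lambda>y. norm (\<sigma> t y)))"
      "\<forall>t\<ge>0. Sig t = (SUP y. norm (\<sigma> t y))" "L2_halfline Sig"
    and x: "x \<in> closure (eff_dom \<Phi>)"
    and X: "strong_solution M F W \<Phi> \<beta> grad_\<Psi> \<sigma> x X"
  shows "(\<forall>t>0.
      ereal_quasi_integrable M (\<lambda>\<omega>. \<Phi> (time_average X t \<omega>) - (INF u\<in>C. \<Phi> u)) \<and>
      ereal_integral M (\<lambda>\<omega>. \<Phi> (time_average X t \<omega>) - (INF u\<in>C. \<Phi> u))
        \<le> ereal ((infdist x S)\<^sup>2 / (2 * t) + 1 / (2 * t) * integral {0..t} (\<lambda>s. (Sig s)\<^sup>2)))
    \<and> (\<lambda>t. (infdist x S)\<^sup>2 / (2 * t) + 1 / (2 * t) * integral {0..t} (\<lambda>s. (Sig s)\<^sup>2)) \<in> O(\<lambda>t. 1 / t)"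
proof -
  let ?E = "\<lambda>t. integral {0..t} (\<lambda>s. (Sig s)\<^sup>2)" and ?d = "infdist x S"
  let ?I = "\<lambda>t. ereal_integral M (\<lambda>\<omega>. \<Phi> (time_average X t \<omega>) - (INF u\<in>C. \<Phi> u))"
  let ?Q = "\<lambda>t. ereal_quasi_integrable M (\<lambda>\<omega>. \<Phi> (time_average X t \<omega>) - (INF u\<in>C. \<Phi> u))"
  have Sig_int: "(\<lambda>t. (Sig t)\<^sup>2) absolutely_integrable_on {0..}"
    using Sig(3) by (simp add: L2_halfline_def)
  have Sig_int_T: "(\<lambda>t. (Sig t)\<^sup>2) absolutely_integrable_on {0..T}" for T
    by (rule set_integrable_subset[OF Sig_int]) auto
  have point: "?Q t \<and> ?I t \<le> ereal (((dist x z)\<^sup>2 + ?E t) / (2 * t))" if zS: "z \<in> S" and t: "0 < t" for z t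
  proof -
    have zC: "z \<in> C" "\<And>y. y \<in> C \<Longrightarrow> \<Phi> z \<le> \<Phi> y" using zS S(2) by (auto simp: minimizers_on_def)
    obtain g where g: "g \<in> subdiff \<Phi> z" using zS S(1) by (auto simp: zer_def op_sum_def)
    obtain y0 where "\<Phi> y0 \<noteq> \<infinity>" using \<Phi>(1) by (auto simp: proper_fun_def)
    moreover have "\<Phi> z + ereal (g \<bullet> (y0 - z)) \<le> \<Phi> y0" using g by (auto simp: subdiff_def)
    ultimately have "\<Phi> z \<noteq> \<infinity>" by auto
    moreover have "\<Phi> z \<noteq> - \<infinity>" using \<Phi>(1) by (auto simp: proper_fun_def)
    ultimately obtain \<phi> where \<phi>: "\<Phi> z = ereal \<phi>" by (cases "\<Phi> z") auto
    \<comment> \<open>The infimum is attained at \<open>z\<close>, so the quantity to be bounded is the same for every choice of \<open>z\<close>.\<close>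
    have INF: "(INF u\<in>C. \<Phi> u) = ereal \<phi>"
      unfolding \<phi>[symmetric] by (intro antisym INF_lower zC(1) INF_greatest zC(2))
    have grad: "0 \<le> (y - z) \<bullet> grad_\<Psi> y" for y
    proof -
      have "\<Psi> z = 0" using zC(1) C_\<Psi>(1) by auto
      moreover have "\<Psi> z \<le> \<Psi> y" using zC(1) C_\<Psi>(2) by (auto simp: minimizers_on_def)
      moreover have "\<Psi> y + grad_\<Psi> y \<bullet> (z - y) \<le> \<Psi> z"
        using convex_gradient_inequality[OF \<Psi>(1)] \<Psi>(2) by blast
      ultimately show ?thesis by (simp add: inner_diff_left inner_diff_right inner_commute)
    qed
    obtain K where K: "continuous_adapted M F K"
      "\<forall>T\<ge>0. AE \<omega> in M. bounded_variation_on 0 T (\<lambda>t. K t \<omega>)"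
      "\<forall>t\<ge>0. \<exists>J. has_ito_integral M F W (\<lambda>s \<omega>. \<sigma> s (X s \<omega>)) t J \<and>
           (AE \<omega> in M. X t \<omega> - X 0 \<omega> =
              - integral {0..t} (\<lambda>s. \<beta> s *\<^sub>R grad_\<Psi> (X s \<omega>)) + J \<omega> - (K t \<omega> - K 0 \<omega>))"
      "\<forall>z r s. 0 \<le> r \<longrightarrow> r \<le> s \<longrightarrow>
           (AE \<omega> in M. \<exists>J. has_rs_integral (\<lambda>u. z - X u \<omega>) (\<lambda>u. K u \<omega>) r s J \<and>
              ereal J + ereal_integral (restrict_space lborel {r..s}) (\<lambda>u. \<Phi> (X u \<omega>))
                \<le> ereal (s - r) * \<Phi> z)"
      using X unfolding strong_solution_def by blast
    have X': "continuous_adapted M F X" "AE \<omega> in M. X 0 \<omega> = x"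
      using X unfolding strong_solution_def by blast+
    interpret prob_space M by (rule prob)
    interpret sol: inclusion_solution M F W \<Phi> \<beta> grad_\<Psi> \<sigma> Sig x z g \<phi> X K
    proof
      show "ereal (\<phi> + g \<bullet> (y - z)) \<le> \<Phi> y" for y using g \<phi> by (auto simp: subdiff_def)
      show "0 \<le> \<beta> t" if "0 \<le> t" for t using \<beta>(1) that by (simp add: less_imp_le)
      show "norm (\<sigma> t y) \<le> Sig t" if "0 \<le> t" for t y
        using Sig(1,2) that by (auto intro: cSUP_upper)
      show "\<exists>J. has_ito_integral M F W (\<lambda>s \<omega>. \<sigma> s (X s \<omega>)) t J \<and>
           (AE \<omega> in M. X t \<omega> - X 0 \<omega> =
              - integral {0..t} (\<lambda>s. \<beta> s *\<^sub>R grad_\<Psi> (X s \<omega>)) + J \<omega> - (K t \<omega> - K 0 \<omega>))" if "0 \<le> t" for t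
        using K(3) that by blast
      show "AE \<omega> in M. \<exists>J. has_rs_integral (\<lambda>u. z - X u \<omega>) (\<lambda>u. K u \<omega>) r s J \<and>
              ereal J + ereal_integral (restrict_space lborel {r..s}) (\<lambda>u. \<Phi> (X u \<omega>))
                \<le> ereal (s - r) * \<Phi> z" if "0 \<le> r" "r \<le> s" for r s
        using K(4) that by blast
      show "AE \<omega> in M. bounded_variation_on 0 T (\<lambda>t. K t \<omega>)" if "0 \<le> T" for T
        using K(2) that by blast
    qed (use filt bm \<Phi> \<phi> locally_abs_cont_imp_continuous[OF \<beta>(2)] \<Psi>(3) grad Sig_int_T X' K(1) in auto)
    show ?thesis
      using sol.expected_gap_of_average[OF t] unfolding INF sol.budget_def dist_norm by blast
  qed
  have bound: "?I t \<le> ereal (?d\<^sup>2 / (2 * t) + 1 / (2 * t) * ?E t)" if t: "0 < t" for t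
  proof (rule LIMSEQ_le_const)
    show "\<exists>N. \<forall>n\<ge>N. ?I t \<le> ereal (((?d + 1 / real (Suc n))\<^sup>2 + ?E t) / (2 * t))"
    proof (intro exI allI impI)
      fix n :: nat
      \<comment> \<open>Points of \<open>S\<close> that nearly attain the distance suffice, because the left-hand side does not involve \<open>z\<close>.\<close>
      have "(INF z\<in>S. dist x z) < ?d + 1 / real (Suc n)" using S(3) by (simp add: infdist_def)
      then obtain z where z: "z \<in> S" "dist x z < ?d + 1 / real (Suc n)"
        using S(3) by (subst (asm) cINF_less_iff) auto
      then have "(dist x z)\<^sup>2 \<le> (?d + 1 / real (Suc n))\<^sup>2" by (intro power_mono) auto
      then have "((dist x z)\<^sup>2 + ?E t) / (2 * t) \<le> ((?d + 1 / real (Suc n))\<^sup>2 + ?E t) / (2 * t)"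
        using t by (intro divide_right_mono) auto
      then show "?I t \<le> ereal (((?d + 1 / real (Suc n))\<^sup>2 + ?E t) / (2 * t))"
        using point[OF z(1) t] by (meson ereal_less_eq(3) order_trans)
    qed
    have "(\<lambda>n. ((?d + 1 / real (Suc n))\<^sup>2 + ?E t) / (2 * t)) \<longlonglongrightarrow> ((?d + 0)\<^sup>2 + ?E t) / (2 * t)"
      using t by (intro tendsto_intros LIMSEQ_Suc[OF lim_const_over_n]) auto
    then show "(\<lambda>n. ereal (((?d + 1 / real (Suc n))\<^sup>2 + ?E t) / (2 * t))) \<longlonglongrightarrow> ereal (?d\<^sup>2 / (2 * t) + 1 / (2 * t) * ?E t)"
      by (simp add: add_divide_distrib)
  qed
  have "(\<lambda>t. ?d\<^sup>2 / (2 * t) + 1 / (2 * t) * ?E t) \<in> O(\<lambda>t. 1 / t)"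
  proof (rule bigoI)
    let ?c = "(?d\<^sup>2 + integral {0..} (\<lambda>s. (Sig s)\<^sup>2)) / 2"
    show "\<forall>\<^sub>F t in at_top. norm (?d\<^sup>2 / (2 * t) + 1 / (2 * t) * ?E t) \<le> ?c * norm (1 / t)"
      using eventually_gt_at_top[of 0]
    proof eventually_elim
      case (elim t)
      have i: "(\<lambda>s. (Sig s)\<^sup>2) integrable_on {0..t}" "(\<lambda>s. (Sig s)\<^sup>2) integrable_on {0..}"
        using Sig_int Sig_int_T by (auto simp: absolutely_integrable_on_def)
      have "?E t \<le> integral {0..} (\<lambda>s. (Sig s)\<^sup>2)" by (rule integral_subset_le[OF _ i]) auto
      moreover have "0 \<le> ?E t" by (rule Henstock_Kurzweil_Integration.integral_nonneg[OF i(1)]) simp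
      ultimately show ?case using elim by (simp add: field_simps)
    qed
  qed
  moreover obtain z where "z \<in> S" using S(3) by blast
  ultimately show ?thesis using point bound by blast
qed

end
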